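(* Let $M$ be a smooth $m$-dimensional manifold, let $\mathcal G\subset\mathcal D(M)$ be a tame Lie pseudogroup acting on $M$, with associated integer $n^*\ge 1$, and let $J^n=J^n(M,p)$ denote the bundle of $n$-jets of $p$-dimensional submanifolds of $M$, with canonical projections $\widetilde\pi^{n+k}_n\colon J^{n+k}\to J^n$. Let $n\ge n^*+1$ be an integer and suppose that $\mathcal G$ acts freely at $z_o^{(n)}\in J^n$. Then for every integer $k\ge 0$, $\mathcal G$ acts freely at every $z_o^{(n+k)}\in J^{n+k}$ with $\widetilde\pi^{n+k}_n(z_o^{(n+k)})=z_o^{(n)}$.
   Context: **Diffeomorphism jets.** $\mathcal D=\mathcal D(M)$ is the pseudogroup of all local diffeomorphisms $\varphi$ of $M$ with open domain $\mathrm{dom}\,\varphi\subset M$. $\mathcal D^{(n)}$ is the bundle of their $n$-jets $j^n_z\varphi$, $z\in\mathrm{dom}\,\varphi$, with source map $\sigma^n(j^n_z\varphi)=z$ and target map $\tau^n(j^n_z\varphi)=\varphi(z)$. It is a groupoid under $j^n_{\varphi(z)}\psi\cdot j^n_z\varphi=j^n_z(\psi\circ\varphi)$. The identity jet at $z$ is $\mathbb I^{(n)}_z=j^n_z\mathrm{id}$. Local coordinates on $\mathcal D^{(n)}$ are $(z,Z^{(n)})$, with $Z^a_{b_1\cdots b_k}=\partial^k\varphi^a/\partial z^{b_1}\cdots\partial z^{b_k}(z)$, $0\le k\le n$. **Prolongation of submanifolds of $\mathcal D^{(n)}$.** The prolongation $\mathrm{pr}^{(1)}\mathcal R\subset\mathcal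 D^{(n+1)}$ of a submanifold $\mathcal R\subset\mathcal D^{(n)}$ consists of the jets $j^{n+1}_z\varphi$ such that $j^n_z\varphi\in\mathcal R$ and $(j^n\varphi)_*(T_zM)\subset T_{j^n_z\varphi}\mathcal R$, where $j^n\varphi$ is the local section $w\mapsto j^n_w\varphi$ of $\sigma^n$. $\mathrm{pr}^{(k)}$ denotes the $k$-fold repeated prolongation. **Lie pseudogroup.** For $\mathcal G\subset\mathcal D$ let $\mathcal G^{(n)}\subset\mathcal D^{(n)}$ be the set of $n$-jets of elements of $\mathcal G$. $\mathcal G$ is a Lie pseudogroup if $\varphi,\psi\in\mathcal G$ implies $\varphi\circ\psi^{-1}\in\mathcal G$ where defined, and there is an integer $n^*\ge1$ such that for all $n\ge n^*$: 1. $\mathcal G^{(n)}\subset\mathcal D^{(n)}$ is a smooth, embedded subbundle (over $M$ via $\sigma^n$); 2. every $\varphi\in\mathcal D$ with $j^n_z\varphi\in\mathcal G^{(n)}$ for all $z\in\mathrm{dom}\,\varphi$ belongs to $\mathcal G$; 3. $\mathcal G^{(n)}=\mathrm{pr}^{(n-n^* )}\mathcal G^{(n^* )}$. **Tameness.** A $\mathcal G$ vector field is a locally defined smooth vector field $\mathbf v$ on $M$ whose flow maps at all fixed times $t$ belong to $\mathcal G$. An $n$-jet at $z$ of a vector field $\sum_a\zeta^a\partial/\partial z^a$, with derivative coordinates $\zeta^a_{b_1\cdots b_k}$, $0\le k\le n$, satisfies the infinitesimal determining equations of order $n$ if the vector $\sum_{a}\sum_{0\le k\le n}\zeta^a_{b_1\cdots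 b_k}\,\partial/\partial Z^a_{b_1\cdots b_k}$ at $\mathbb I^{(n)}_z$ is tangent to $\mathcal G^{(n)}$; that is, the jet satisfies the linearization at the identity jet of the local equations defining $\mathcal G^{(n)}$. $\mathcal G$ is tame if, for all $n\ge n^*$, every such $n$-jet is the $n$-jet of some $\mathcal G$ vector field. **Submanifold jets and prolonged action.** $J^n=J^n(M,p)$ is the $n$th order (extended) jet bundle: the equivalence classes of $p$-dimensional submanifolds of $M$ under $n$th order contact at a point ($p$ fixed, $J^0=M$), with projection $\widetilde\pi^n_o\colon J^n\to M$. Local diffeomorphisms preserve $n$th order contact, so $\mathcal D$ acts on $J^n$. This induces an action $g^{(n)}\cdot z^{(n)}$ of $\mathcal D^{(n)}$ on $J^n$, defined when $\sigma^n(g^{(n)})=\widetilde\pi^n_o(z^{(n)})$: if $g^{(n)}=j^n_z\varphi$ and $z^{(n)}$ is the $n$-jet of a submanifold $S$ at $z$, then $g^{(n)}\cdot z^{(n)}$ is the $n$-jet of $\varphi(S)$ at $\varphi(z)$. **Freeness.** For $z^{(n)}\in J^n$ over $z\in M$, the isotropy subgroup is $$\mathcal G^{(n)}_{z^{(n)}}=\{g^{(n)}\in\mathcal G^{(n)}\mid \sigma^n(g^{(n)})=\tau^n(g^{(n)})=z,\ g^{(n)}\cdot z^{(n)}=z^{(n)}\}.$$ $\mathcal G$ acts freely at $z^{(n)}$ if $\mathcal G^{(n)}_{z^{(n)}}=\{\mathbb I^{(n)}_z\}$. *)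

theory Defs
  imports "HOL-Analysis.Analysis" "HOL-Analysis.Finite_Function_Topology"
begin

section \<open>Smooth maps between normed spaces\<close>

fun iter_deriv ::
  "'x::real_normed_vector list \<Rightarrow> ('x \<Rightarrow> 'y::real_normed_vector) \<Rightarrow> 'x \<Rightarrow> 'y" where
  "iter_deriv [] f = f"
| "iter_deriv (v # vs) f = (\<lambda>x. frechet_derivative (iter_deriv vs f) (at x) v)"

text \<open>To be used for open \<open>U\<close> only. As differentiability implies continuity, on a finite-dimensional
  space this is the usual class of infinitely differentiable maps.\<close>

definition smooth :: "'x::real_normed_vector set \<Rightarrow> ('x \<Rightarrow> 'y::real_normed_vector) \<Rightarrow> bool" where
  "smooth U f \<longleftrightarrow> (\<forall>vs. \<forall>x\<in>U. iter_deriv vs f differentiable (at x))"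

text \<open>Directions of the partial derivatives of order at most \<open>n\<close>, i.e. the indices
  \<open>b\<^sub>1 \<dots> b\<^sub>k\<close> with \<open>0 \<le> k \<le> n\<close>.\<close>

definition indices :: "nat \<Rightarrow> 'e::euclidean_space list set" where
  "indices n = {bs. set bs \<subseteq> Basis \<and> length bs \<le> n}"

section \<open>Partial maps\<close>

text \<open>A map that is only locally defined is a partial map; its domain is \<open>dom f\<close>.
  The inverse is meaningful for maps that are injective on their domain.\<close>

definition pinv :: "('x \<rightharpoonup> 'y) \<Rightarrow> 'y \<rightharpoonup> 'x" where
  "pinv f = (\<lambda>y. if y \<in> ran f then Some (THE x. f x = Some y) else None)"

definition psmooth :: "('x::real_normed_vector \<rightharpoonup> 'y::real_normed_vector) \<Rightarrow> bool" where
  "psmooth f \<longleftrightarrow> open (dom f) \<and> smooth (dom f) (the \<circ> f)"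

section \<open>Smooth manifolds\<close>

definition is_chart :: "('a::topological_space \<rightharpoonup> 'e::euclidean_space) \<Rightarrow> bool" where
  "is_chart c \<longleftrightarrow> open (dom c) \<and> open (ran c) \<and>
     homeomorphism (dom c) (ran c) (the \<circ> c) (the \<circ> pinv c)"

definition compatible :: "('a \<rightharpoonup> 'e::euclidean_space) \<Rightarrow> ('a \<rightharpoonup> 'e) \<Rightarrow> bool" where
  "compatible c d \<longleftrightarrow> psmooth (d \<circ>\<^sub>m pinv c) \<and> psmooth (c \<circ>\<^sub>m pinv d)"

text \<open>\<open>A\<close> is a maximal smooth atlas on the space \<open>'a\<close>; the dimension of the manifold is \<open>DIM('e)\<close>.\<close>

definition smooth_manifold ::
  "('a::{t2_space,second_countable_topology} \<rightharpoonup> 'e::euclidean_space) set \<Rightarrow> bool" where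
  "smooth_manifold A \<longleftrightarrow>
     (\<forall>c\<in>A. is_chart c) \<and> (\<Union>c\<in>A. dom c) = UNIV \<and>
     (\<forall>c\<in>A. \<forall>d\<in>A. compatible c d) \<and>
     (\<forall>c. is_chart c \<and> (\<forall>d\<in>A. compatible c d) \<longrightarrow> c \<in> A)"

definition in_charts :: "('a \<rightharpoonup> 'e) \<Rightarrow> ('b \<rightharpoonup> 'f) \<Rightarrow> ('a \<rightharpoonup> 'b) \<Rightarrow> 'e \<Rightarrow> 'f" where
  "in_charts c d \<phi> = (\<lambda>x. the ((d \<circ>\<^sub>m \<phi> \<circ>\<^sub>m pinv c) x))"

text \<open>The pseudogroup \<open>\<D>(M)\<close>.\<close>

definition local_diffeos ::
  "('a::topological_space \<rightharpoonup> 'e::euclidean_space) set \<Rightarrow> ('a \<rightharpoonup> 'a) set" where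
  "local_diffeos A = {\<phi>. open (dom \<phi>) \<and> open (ran \<phi>) \<and> inj_on \<phi> (dom \<phi>) \<and>
     (\<forall>c\<in>A. \<forall>d\<in>A. psmooth (d \<circ>\<^sub>m \<phi> \<circ>\<^sub>m pinv c) \<and> psmooth (c \<circ>\<^sub>m pinv \<phi> \<circ>\<^sub>m pinv d))}"

section \<open>Smooth maps and submanifolds relative to a family of charts\<close>

text \<open>Here the charts may take values in any normed space; their images need only be subsets of
  some finite-dimensional subspace. This is needed for the jet bundles, the dimension of which
  depends on the order of the jets: all of them have coordinates in one (infinite-dimensional)
  normed space.

  A map on a subset \<open>S\<close> is smooth if, in suitable charts, it locally extends to a smooth map.\<close>

definition smooth_map ::
  "('p \<rightharpoonup> 'x::real_normed_vector) set \<Rightarrow> ('q \<rightharpoonup> 'y::real_normed_vector) set \<Rightarrow>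
     'p set \<Rightarrow> ('p \<Rightarrow> 'q) \<Rightarrow> bool" where
  "smooth_map C D S f \<longleftrightarrow>
     (\<forall>x\<in>S. \<exists>c\<in>C. \<exists>d\<in>D. x \<in> dom c \<and> f x \<in> dom d \<and>
        (\<exists>U g. open U \<and> the (c x) \<in> U \<and> smooth U g \<and>
           (\<forall>y\<in>S \<inter> dom c. the (c y) \<in> U \<longrightarrow> f y \<in> dom d \<and> the (d (f y)) = g (the (c y)))))"

definition diffeo_between ::
  "('p \<rightharpoonup> 'x::real_normed_vector) set \<Rightarrow> ('q \<rightharpoonup> 'y::real_normed_vector) set \<Rightarrow>
     'p set \<Rightarrow> 'q set \<Rightarrow> ('p \<Rightarrow> 'q) \<Rightarrow> ('q \<Rightarrow> 'p) \<Rightarrow> bool" where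
  "diffeo_between C D S T f g \<longleftrightarrow>
     (\<forall>x\<in>S. f x \<in> T \<and> g (f x) = x) \<and> (\<forall>y\<in>T. g y \<in> S \<and> f (g y) = y) \<and>
     smooth_map C D S f \<and> smooth_map D C T g"

text \<open>Embedded \<open>k\<close>-dimensional submanifolds: subsets that are locally (in their relative topology)
  diffeomorphic to an open subset of a \<open>k\<close>-dimensional vector space, which is taken inside the
  coordinate space. The singleton \<open>{Some}\<close> is the atlas of a normed space.\<close>

definition embedded_submanifold ::
  "('p \<rightharpoonup> 'x::real_normed_vector) set \<Rightarrow> nat \<Rightarrow> 'p set \<Rightarrow> bool" where
  "embedded_submanifold C k R \<longleftrightarrow>
     (\<forall>j\<in>R. \<exists>c\<in>C. j \<in> dom c \<and>
        (\<exists>U (B :: 'x set) W f g. open U \<and> the (c j) \<in> U \<and>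
           finite B \<and> independent B \<and> card B = k \<and> openin (top_of_set (span B)) W \<and>
           diffeo_between C {Some} {i \<in> R \<inter> dom c. the (c i) \<in> U} W f g))"

definition prod_chart :: "('p \<rightharpoonup> 'x) \<Rightarrow> ('q \<rightharpoonup> 'y) \<Rightarrow> ('p \<times> 'q) \<rightharpoonup> ('x \<times> 'y)" where
  "prod_chart c d = (\<lambda>(x, y). if x \<in> dom c \<and> y \<in> dom d then Some (the (c x), the (d y)) else None)"

definition prod_atlas :: "('p \<rightharpoonup> 'x) set \<Rightarrow> ('q \<rightharpoonup> 'y) set \<Rightarrow> (('p \<times> 'q) \<rightharpoonup> ('x \<times> 'y)) set" where
  "prod_atlas C D = {prod_chart c d | c d. c \<in> C \<and> d \<in> D}"

text \<open>Velocities at \<open>x\<close> of the smooth curves in \<open>N\<close>, which form the tangent space at \<open>x\<close> when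
  \<open>N\<close> is an embedded submanifold.\<close>

definition tangent_vectors :: "'x::real_normed_vector set \<Rightarrow> 'x \<Rightarrow> 'x set" where
  "tangent_vectors N x = {w. \<exists>\<gamma> e. 0 < e \<and> smooth {-e<..<e} \<gamma> \<and> \<gamma> ` {-e<..<e} \<subseteq> N \<and>
     \<gamma> 0 = x \<and> (\<gamma> has_vector_derivative w) (at (0::real))}"

section \<open>Jets of local diffeomorphisms\<close>

definition same_jet ::
  "('a::topological_space \<rightharpoonup> 'e::euclidean_space) set \<Rightarrow> nat \<Rightarrow> 'a \<Rightarrow> ('a \<rightharpoonup> 'a) \<Rightarrow> ('a \<rightharpoonup> 'a) \<Rightarrow> bool"
  where
  "same_jet A n z \<phi> \<psi> \<longleftrightarrow> \<phi> z = \<psi> z \<and>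
     (\<forall>c\<in>A. \<forall>d\<in>A. z \<in> dom c \<and> the (\<phi> z) \<in> dom d \<longrightarrow>
        (\<forall>bs\<in>indices n. iter_deriv bs (in_charts c d \<phi>) (the (c z)) =
                        iter_deriv bs (in_charts c d \<psi>) (the (c z))))"

text \<open>A jet is given by its source point and the equivalence class of its representatives.\<close>

type_synonym 'a diffeo_jet = "'a \<times> ('a \<rightharpoonup> 'a) set"

definition jet ::
  "('a::topological_space \<rightharpoonup> 'e::euclidean_space) set \<Rightarrow> nat \<Rightarrow> ('a \<rightharpoonup> 'a) \<Rightarrow> 'a \<Rightarrow> 'a diffeo_jet" where
  "jet A n \<phi> z = (z, {\<psi> \<in> local_diffeos A. z \<in> dom \<psi> \<and> same_jet A n z \<phi> \<psi>})"

text \<open>\<open>\<G>\<^sup>(\<^sup>n\<^sup>)\<close>; in particular \<open>jets A n (local_diffeos A)\<close> is \<open>\<D>\<^sup>(\<^sup>n\<^sup>)\<close>.\<close>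

definition jets ::
  "('a::topological_space \<rightharpoonup> 'e::euclidean_space) set \<Rightarrow> nat \<Rightarrow> ('a \<rightharpoonup> 'a) set \<Rightarrow> 'a diffeo_jet set" where
  "jets A n G = {jet A n \<phi> z | \<phi> z. \<phi> \<in> G \<and> z \<in> dom \<phi>}"

definition jet_rep :: "'a diffeo_jet \<Rightarrow> 'a \<rightharpoonup> 'a" where
  "jet_rep j = (SOME \<phi>. \<phi> \<in> snd j)"

definition jet_source :: "'a diffeo_jet \<Rightarrow> 'a" where
  "jet_source j = fst j"

definition jet_target :: "'a diffeo_jet \<Rightarrow> 'a" where
  "jet_target j = the (jet_rep j (jet_source j))"

definition identity_jet ::
  "('a::topological_space \<rightharpoonup> 'e::euclidean_space) set \<Rightarrow> nat \<Rightarrow> 'a \<Rightarrow> 'a diffeo_jet" where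
  "identity_jet A n z = jet A n Some z"

text \<open>An array of derivatives (taken at \<open>x\<close>, up to order \<open>n\<close>) as a finitely supported function
  of its indices \<open>b\<^sub>1 \<dots> b\<^sub>k\<close>; the value at \<open>[]\<close> is that of the function itself.\<close>

definition deriv_array ::
  "nat \<Rightarrow> ('e::euclidean_space \<Rightarrow> 'e) \<Rightarrow> 'e \<Rightarrow> ('e list \<Rightarrow>\<^sub>0 'e)" where
  "deriv_array n f x = (\<Sum>bs\<in>indices n. Poly_Mapping.single bs (iter_deriv bs f x))"

text \<open>The local coordinates \<open>(z, Z\<^sup>(\<^sup>n\<^sup>))\<close> on \<open>\<D>\<^sup>(\<^sup>n\<^sup>)\<close>, from charts \<open>c\<close> at the source and \<open>d\<close> at the target.
  The arrays \<open>Z\<^sup>(\<^sup>n\<^sup>)\<close> that occur are the symmetric ones, so the image is an open subset of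
  a finite-dimensional subspace.\<close>

definition jet_chart ::
  "('a::topological_space \<rightharpoonup> 'e::euclidean_space) set \<Rightarrow> nat \<Rightarrow> ('a \<rightharpoonup> 'e) \<Rightarrow> ('a \<rightharpoonup> 'e) \<Rightarrow>
     'a diffeo_jet \<rightharpoonup> ('e \<times> ('e list \<Rightarrow>\<^sub>0 'e))" where
  "jet_chart A n c d = (\<lambda>j.
     if j \<in> jets A n (local_diffeos A) \<and> jet_source j \<in> dom c \<and> jet_target j \<in> dom d
     then let x = the (c (jet_source j)) in Some (x, deriv_array n (in_charts c d (jet_rep j)) x)
     else None)"

definition jet_atlas ::
  "('a::topological_space \<rightharpoonup> 'e::euclidean_space) set \<Rightarrow> nat \<Rightarrow>
     ('a diffeo_jet \<rightharpoonup> ('e \<times> ('e list \<Rightarrow>\<^sub>0 'e))) set" where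
  "jet_atlas A n = {jet_chart A n c d | c d. c \<in> A \<and> d \<in> A}"

text \<open>A subbundle over \<open>M\<close> via the source map: an embedded submanifold on which the source map is
  surjective and locally trivial.\<close>

definition smooth_subbundle ::
  "('a::topological_space \<rightharpoonup> 'e::euclidean_space) set \<Rightarrow> nat \<Rightarrow> 'a diffeo_jet set \<Rightarrow> bool" where
  "smooth_subbundle A n R \<longleftrightarrow>
     R \<subseteq> jets A n (local_diffeos A) \<and>
     (\<exists>k. embedded_submanifold (jet_atlas A n) k R) \<and>
     jet_source ` R = UNIV \<and>
     (\<forall>z. \<exists>U. open U \<and> z \<in> U \<and>
        (\<exists>f g. diffeo_between (jet_atlas A n) (prod_atlas A (jet_atlas A n))
                 {j \<in> R. jet_source j \<in> U} (U \<times> {j \<in> R. jet_source j = z}) f g \<and>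
               (\<forall>j\<in>R. jet_source j \<in> U \<longrightarrow> fst (f j) = jet_source j)))"

text \<open>The tangent space of \<open>R \<subseteq> \<D>\<^sup>(\<^sup>n\<^sup>)\<close> at \<open>j\<close>, in the coordinates given by \<open>c\<close> and \<open>d\<close>.\<close>

definition jet_tangent ::
  "('a::topological_space \<rightharpoonup> 'e::euclidean_space) set \<Rightarrow> nat \<Rightarrow> ('a \<rightharpoonup> 'e) \<Rightarrow> ('a \<rightharpoonup> 'e) \<Rightarrow>
     'a diffeo_jet set \<Rightarrow> 'a diffeo_jet \<Rightarrow> ('e \<times> ('e list \<Rightarrow>\<^sub>0 'e)) set" where
  "jet_tangent A n c d R j =
     tangent_vectors ((the \<circ> jet_chart A n c d) ` (R \<inter> dom (jet_chart A n c d)))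
       (the (jet_chart A n c d j))"

text \<open>The Frechet derivative is the push-forward \<open>(j\<^sup>n\<phi>)\<^sub>*\<close> in coordinates.\<close>

definition prolong ::
  "('a::topological_space \<rightharpoonup> 'e::euclidean_space) set \<Rightarrow> nat \<Rightarrow> 'a diffeo_jet set \<Rightarrow> 'a diffeo_jet set"
  where
  "prolong A n R = {jet A (Suc n) \<phi> z | \<phi> z.
     \<phi> \<in> local_diffeos A \<and> z \<in> dom \<phi> \<and> jet A n \<phi> z \<in> R \<and>
     (\<forall>c\<in>A. \<forall>d\<in>A. z \<in> dom c \<and> the (\<phi> z) \<in> dom d \<longrightarrow>
        (\<forall>v. frechet_derivative (\<lambda>x. the (jet_chart A n c d (jet A n \<phi> (the (pinv c x)))))
               (at (the (c z))) v \<in> jet_tangent A n c d R (jet A n \<phi> z)))}"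

fun prolong_iter ::
  "('a::topological_space \<rightharpoonup> 'e::euclidean_space) set \<Rightarrow> nat \<Rightarrow> nat \<Rightarrow> 'a diffeo_jet set \<Rightarrow>
     'a diffeo_jet set" where
  "prolong_iter A n 0 R = R"
| "prolong_iter A n (Suc k) R = prolong A (n + k) (prolong_iter A n k R)"

section \<open>Lie pseudogroups\<close>

definition lie_pseudogroup ::
  "('a::topological_space \<rightharpoonup> 'e::euclidean_space) set \<Rightarrow> ('a \<rightharpoonup> 'a) set \<Rightarrow> nat \<Rightarrow> bool" where
  "lie_pseudogroup A G ns \<longleftrightarrow>
     G \<subseteq> local_diffeos A \<and>
     (\<forall>\<phi>\<in>G. \<forall>\<psi>\<in>G. \<phi> \<circ>\<^sub>m pinv \<psi> \<in> G) \<and>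
     1 \<le> ns \<and>
     (\<forall>n\<ge>ns.
        smooth_subbundle A n (jets A n G) \<and>
        (\<forall>\<phi>\<in>local_diffeos A. (\<forall>z\<in>dom \<phi>. jet A n \<phi> z \<in> jets A n G) \<longrightarrow> \<phi> \<in> G) \<and>
        jets A n G = prolong_iter A ns (n - ns) (jets A ns G))"

section \<open>Vector fields and tameness\<close>

text \<open>A vector field with domain \<open>U\<close> is given by its components \<open>X c\<close> in all charts \<open>c\<close>, subject to
  the transformation law; \<open>in_charts c d Some\<close> is the change of coordinates from \<open>c\<close> to \<open>d\<close>.\<close>

definition vector_field ::
  "('a::topological_space \<rightharpoonup> 'e::euclidean_space) set \<Rightarrow> 'a set \<Rightarrow> (('a \<rightharpoonup> 'e) \<Rightarrow> 'a \<Rightarrow> 'e) \<Rightarrow> bool" where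
  "vector_field A U X \<longleftrightarrow> open U \<and>
     (\<forall>c\<in>A. smooth ((the \<circ> c) ` (U \<inter> dom c)) (\<lambda>x. X c (the (pinv c x)))) \<and>
     (\<forall>c\<in>A. \<forall>d\<in>A. \<forall>z\<in>U \<inter> dom c \<inter> dom d.
        X d z = frechet_derivative (in_charts c d Some) (at (the (c z))) (X c z))"

definition integral_curve ::
  "('a::topological_space \<rightharpoonup> 'e::euclidean_space) set \<Rightarrow> 'a set \<Rightarrow> (('a \<rightharpoonup> 'e) \<Rightarrow> 'a \<Rightarrow> 'e) \<Rightarrow>
     real \<Rightarrow> (real \<Rightarrow> 'a) \<Rightarrow> bool" where
  "integral_curve A U X t \<gamma> \<longleftrightarrow>
     continuous_on (closed_segment 0 t) \<gamma> \<and>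
     (\<forall>s\<in>closed_segment 0 t. \<gamma> s \<in> U \<and>
        (\<forall>c\<in>A. \<gamma> s \<in> dom c \<longrightarrow>
           ((\<lambda>r. the (c (\<gamma> r))) has_vector_derivative X c (\<gamma> s)) (at s within closed_segment 0 t)))"

text \<open>The flow map at time \<open>t\<close> (possibly negative), defined at the points whose integral curve
  exists up to time \<open>t\<close>.\<close>

definition flow ::
  "('a::topological_space \<rightharpoonup> 'e::euclidean_space) set \<Rightarrow> 'a set \<Rightarrow> (('a \<rightharpoonup> 'e) \<Rightarrow> 'a \<Rightarrow> 'e) \<Rightarrow>
     real \<Rightarrow> 'a \<rightharpoonup> 'a" where
  "flow A U X t = (\<lambda>x.
     if \<exists>\<gamma>. integral_curve A U X t \<gamma> \<and> \<gamma> 0 = x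
     then Some (THE y. \<exists>\<gamma>. integral_curve A U X t \<gamma> \<and> \<gamma> 0 = x \<and> \<gamma> t = y)
     else None)"

definition pseudogroup_vector_field ::
  "('a::topological_space \<rightharpoonup> 'e::euclidean_space) set \<Rightarrow> ('a \<rightharpoonup> 'a) set \<Rightarrow> 'a set \<Rightarrow>
     (('a \<rightharpoonup> 'e) \<Rightarrow> 'a \<Rightarrow> 'e) \<Rightarrow> bool" where
  "pseudogroup_vector_field A G U X \<longleftrightarrow> vector_field A U X \<and> (\<forall>t. flow A U X t \<in> G)"

text \<open>The derivative coordinates \<open>\<zeta>\<close> in the chart \<open>c\<close> of the \<open>n\<close>-jet at \<open>z\<close> of a vector field.\<close>

definition vector_jet ::
  "nat \<Rightarrow> ('a \<rightharpoonup> 'e::euclidean_space) \<Rightarrow> (('a \<rightharpoonup> 'e) \<Rightarrow> 'a \<Rightarrow> 'e) \<Rightarrow> 'a \<Rightarrow> ('e list \<Rightarrow>\<^sub>0 'e)" where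
  "vector_jet n c X z = deriv_array n (\<lambda>x. X c (the (pinv c x))) (the (c z))"

text \<open>The vector \<open>\<Sum> \<zeta> \<partial>/\<partial>Z\<close> has no component in the direction of the source coordinates.\<close>

definition inf_determining_eqs ::
  "('a::topological_space \<rightharpoonup> 'e::euclidean_space) set \<Rightarrow> ('a \<rightharpoonup> 'a) set \<Rightarrow> nat \<Rightarrow> ('a \<rightharpoonup> 'e) \<Rightarrow> 'a \<Rightarrow>
     ('e list \<Rightarrow>\<^sub>0 'e) \<Rightarrow> bool" where
  "inf_determining_eqs A G n c z \<zeta> \<longleftrightarrow>
     (0, \<zeta>) \<in> jet_tangent A n c c (jets A n G) (identity_jet A n z)"

definition tame ::
  "('a::topological_space \<rightharpoonup> 'e::euclidean_space) set \<Rightarrow> ('a \<rightharpoonup> 'a) set \<Rightarrow> nat \<Rightarrow> bool" where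
  "tame A G ns \<longleftrightarrow>
     (\<forall>n\<ge>ns. \<forall>c\<in>A. \<forall>z\<in>dom c. \<forall>U X.
        vector_field A U X \<and> z \<in> U \<and> inf_determining_eqs A G n c z (vector_jet n c X z) \<longrightarrow>
        (\<exists>V Y. pseudogroup_vector_field A G V Y \<and> z \<in> V \<and> vector_jet n c Y z = vector_jet n c X z))"

section \<open>Jets of submanifolds\<close>

definition slice_chart ::
  "('a::topological_space \<rightharpoonup> 'e::euclidean_space) set \<Rightarrow> 'e set \<Rightarrow> 'a set \<Rightarrow> ('a \<rightharpoonup> 'e) \<Rightarrow> bool" where
  "slice_chart A L S c \<longleftrightarrow> c \<in> A \<and> (\<forall>x\<in>dom c. x \<in> S \<longleftrightarrow> the (c x) \<in> L)"

definition submanifold ::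
  "('a::topological_space \<rightharpoonup> 'e::euclidean_space) set \<Rightarrow> nat \<Rightarrow> 'a set \<Rightarrow> bool" where
  "submanifold A p S \<longleftrightarrow>
     (\<forall>z\<in>S. \<exists>c L. subspace L \<and> dim L = p \<and> slice_chart A L S c \<and> z \<in> dom c)"

text \<open>Contact of order \<open>n\<close> of two submanifolds through \<open>z\<close>: they have local parametrizations with the
  same \<open>n\<close>-jet at a parameter value of \<open>z\<close>. The parametrizations are defined on open subsets of a
  \<open>p\<close>-dimensional space \<open>L\<close> and are obtained by restricting the inverses of slice charts to \<open>L\<close>
  (near a given point, every parametrization is of this form), so that only derivatives in directions of
  \<open>L\<close> are compared.\<close>

definition contact ::
  "('a::topological_space \<rightharpoonup> 'e::euclidean_space) set \<Rightarrow> nat \<Rightarrow> nat \<Rightarrow> 'a \<Rightarrow> 'a set \<Rightarrow> 'a set \<Rightarrow> bool" where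
  "contact A p n z S T \<longleftrightarrow> z \<in> S \<and> z \<in> T \<and>
     (\<exists>L c d. subspace L \<and> dim L = p \<and> slice_chart A L S c \<and> slice_chart A L T d \<and>
        z \<in> dom c \<and> z \<in> dom d \<and> c z = d z \<and>
        (\<forall>k\<in>A. z \<in> dom k \<longrightarrow>
           (\<forall>vs. set vs \<subseteq> L \<and> length vs \<le> n \<longrightarrow>
              iter_deriv vs (in_charts c k Some) (the (c z)) =
              iter_deriv vs (in_charts d k Some) (the (d z)))))"

type_synonym 'a sub_jet = "'a \<times> 'a set set"

definition sub_jet ::
  "('a::topological_space \<rightharpoonup> 'e::euclidean_space) set \<Rightarrow> nat \<Rightarrow> nat \<Rightarrow> 'a set \<Rightarrow> 'a \<Rightarrow> 'a sub_jet" where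
  "sub_jet A p n S z = (z, {T. submanifold A p T \<and> z \<in> T \<and> contact A p n z S T})"

text \<open>\<open>J\<^sup>n(M, p)\<close>\<close>

definition sub_jets ::
  "('a::topological_space \<rightharpoonup> 'e::euclidean_space) set \<Rightarrow> nat \<Rightarrow> nat \<Rightarrow> 'a sub_jet set" where
  "sub_jets A p n = {sub_jet A p n S z | S z. submanifold A p S \<and> z \<in> S}"

definition sub_jet_base :: "'a sub_jet \<Rightarrow> 'a" where
  "sub_jet_base w = fst w"

definition sub_jet_rep :: "'a sub_jet \<Rightarrow> 'a set" where
  "sub_jet_rep w = (SOME S. S \<in> snd w)"

text \<open>The projection onto \<open>J\<^sup>n(M, p)\<close> of jets of order at least \<open>n\<close>.\<close>

definition sub_jet_proj ::
  "('a::topological_space \<rightharpoonup> 'e::euclidean_space) set \<Rightarrow> nat \<Rightarrow> nat \<Rightarrow> 'a sub_jet \<Rightarrow> 'a sub_jet" where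
  "sub_jet_proj A p n w = sub_jet A p n (sub_jet_rep w) (sub_jet_base w)"

text \<open>Meaningful if \<open>jet_source g = sub_jet_base w\<close>; \<open>ran (\<phi> |` S)\<close> is the image \<open>\<phi>(S \<inter> dom \<phi>)\<close>.\<close>

definition jet_action ::
  "('a::topological_space \<rightharpoonup> 'e::euclidean_space) set \<Rightarrow> nat \<Rightarrow> nat \<Rightarrow> 'a diffeo_jet \<Rightarrow> 'a sub_jet \<Rightarrow>
     'a sub_jet" where
  "jet_action A p n g w = sub_jet A p n (ran (jet_rep g |` sub_jet_rep w)) (jet_target g)"

section \<open>Freeness\<close>

definition isotropy ::
  "('a::topological_space \<rightharpoonup> 'e::euclidean_space) set \<Rightarrow> ('a \<rightharpoonup> 'a) set \<Rightarrow> nat \<Rightarrow> nat \<Rightarrow> 'a sub_jet \<Rightarrow>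
     'a diffeo_jet set" where
  "isotropy A G p n w = {g \<in> jets A n G.
     jet_source g = sub_jet_base w \<and> jet_target g = sub_jet_base w \<and> jet_action A p n g w = w}"

definition acts_freely_at ::
  "('a::topological_space \<rightharpoonup> 'e::euclidean_space) set \<Rightarrow> ('a \<rightharpoonup> 'a) set \<Rightarrow> nat \<Rightarrow> nat \<Rightarrow> 'a sub_jet \<Rightarrow>
     bool" where
  "acts_freely_at A G p n w \<longleftrightarrow> isotropy A G p n w = {identity_jet A n (sub_jet_base w)}"

end

theory Submission
  imports Defs
begin

text \<open>It suffices to pass from an order \<open>N \<ge> n\<^sup>* + 1 \<ge> 2\<close> to \<open>N + 1\<close>. Suppose that \<open>\<phi> \<in> \<G>\<close> fixes \<open>z\<close> and the
  \<open>(N + 1)\<close>-jet of the submanifold \<open>S\<close> at \<open>z\<close>. By freeness at order \<open>N\<close>, in a slice chart of \<open>S\<close> with slice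
  \<open>L\<close> we have \<open>\<phi> = id + E\<close> where \<open>E\<close> vanishes to order \<open>N\<close>, and the component of \<open>E\<close> normal to \<open>L\<close> vanishes
  along \<open>L\<close> to order \<open>N + 1\<close>.

  For every direction \<open>u\<close> the \<open>N\<close>-jet of \<open>\<partial>\<^sub>u E\<close> is the difference of the velocities of two curves in
  \<open>\<G>\<^sup>(\<^sup>N\<^sup>)\<close>, namely of the \<open>N\<close>-jets of \<open>\<phi>\<close> and of the identity along the line in direction \<open>u\<close>. So it
  satisfies the infinitesimal determining equations, and by tameness it is the \<open>N\<close>-jet of some \<open>\<G>\<close> vector
  field, the time one flow of which is \<open>id + \<partial>\<^sub>u E\<close> to order \<open>N\<close>. If \<open>\<partial>\<^sub>u E\<close> is tangent to \<open>L\<close> along \<open>L\<close> to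
  order \<open>N\<close>, then this flow map fixes the \<open>N\<close>-jet of \<open>S\<close>, and freeness shows that \<open>\<partial>\<^sub>u E\<close> vanishes to
  order \<open>N\<close>.

  This applies to all \<open>u \<in> L\<close>. By the symmetry of mixed derivatives, \<open>\<partial>\<^sub>v E\<close> then vanishes along \<open>L\<close> to
  order \<open>N\<close> for every \<open>v\<close>, so that it applies to all \<open>v\<close>. Hence \<open>E\<close> vanishes to order \<open>N + 1\<close>.\<close>

section \<open>Calculus of smooth maps\<close>

text \<open>The hypothesis \<open>ns + 1 \<le> N\<close> gives, besides tameness at order
  \<open>N\<close>, that \<open>N \<ge> 2\<close>. A field with the \<open>N\<close>-jet of
  \<partial>_u E then vanishes at \<open>z\<close> together with its first derivatives. At distance
  r it has size of order r^N and Lipschitz constant of order r, so its time one map differs from id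
  plus the field by order r^(N+1) only. This estimate takes the place of the variational equations
  of the flow: finite differences turn it back into an equality of jets.

  Tangent vectors of a set of jets are velocities of curves by definition. That a difference of two
  of them is again one depends on the submanifold structure and is proved in a parametrization,
  which is smooth in charts of its own choice; hence the transition maps between jet charts have to
  be shown smooth.

  Contact compares derivatives along \<open>L\<close> only. Composition with a linear retraction
  onto \<open>L\<close> turns these into full jets on the coordinate space, so that one chain rule
  for jets covers diffeomorphisms and submanifolds alike.\<close>

definition dir_deriv :: "'x::real_normed_vector \<Rightarrow> ('x \<Rightarrow> 'y::real_normed_vector) \<Rightarrow> 'x \<Rightarrow> 'y" where
  "dir_deriv v f = (\<lambda>x. frechet_derivative f (at x) v)"

lemma iter_deriv_append: "iter_deriv (us @ vs) f = iter_deriv us (iter_deriv vs f)"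
  by (induction us) auto

lemma iter_deriv_Cons': "iter_deriv (v # vs) f = dir_deriv v (iter_deriv vs f)"
  by (simp add: dir_deriv_def)

text \<open>The last entry of a list is the direction differentiated first. Splitting there turns
  order \<open>m + 1\<close> for \<open>f\<close> into order \<open>m\<close> for
  \<open>dir_deriv v f\<close>, the shape of the inductions on the order.\<close>

lemma iter_deriv_snoc: "iter_deriv (vs @ [v]) f = iter_deriv vs (dir_deriv v f)"
  by (simp add: iter_deriv_append dir_deriv_def)

text \<open>\<open>frechet_derivative\<close> is a choice, so the whole set of derivatives at
  \<open>x\<close> has to coincide; this covers points without any derivative as well.\<close>

lemma frechet_derivative_cong:
  assumes "open U" "x \<in> U" "\<And>y. y \<in> U \<Longrightarrow> f y = g y"
  shows "frechet_derivative f (at x) = frechet_derivative g (at x)"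
proof -
  have "(f has_derivative D) (at x) \<longleftrightarrow> (g has_derivative D) (at x)" for D
    using assms has_derivative_transform_within_open[of f D x UNIV U g]
      has_derivative_transform_within_open[of g D x UNIV U f] by auto
  then show ?thesis by (simp add: frechet_derivative_def)
qed

lemma differentiable_cong:
  assumes "open U" "x \<in> U" "\<And>y. y \<in> U \<Longrightarrow> f y = g y"
  shows "f differentiable (at x) \<longleftrightarrow> g differentiable (at x)"
proof -
  have "(f has_derivative D) (at x) \<longleftrightarrow> (g has_derivative D) (at x)" for D
    using assms has_derivative_transform_within_open[of f D x UNIV U g]
      has_derivative_transform_within_open[of g D x UNIV U f] by auto
  then show ?thesis by (simp add: differentiable_def)
qed

lemma iter_deriv_cong:
  assumes "open U" "\<And>y. y \<in> U \<Longrightarrow> f y = g y" "x \<in> U"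
  shows "iter_deriv vs f x = iter_deriv vs g x"
  using assms(3)
proof (induction vs arbitrary: x)
  case (Cons v vs)
  then show ?case
    using frechet_derivative_cong[OF assms(1) Cons.prems, of "iter_deriv vs f" "iter_deriv vs g"] by simp
qed (use assms in auto)

lemma has_derivative_dir_deriv:
  "f differentiable (at x) \<Longrightarrow> (f has_derivative (\<lambda>v. dir_deriv v f x)) (at x)"
  using frechet_derivative_works unfolding dir_deriv_def by auto

lemma dir_deriv_eq: "(f has_derivative D) (at x) \<Longrightarrow> dir_deriv v f x = D v"
  unfolding dir_deriv_def using frechet_derivative_at[of f D x] by simp

text \<open>The finite stages of \<open>smooth\<close>. The product and chain rules at order
  \<open>m + 1\<close> follow from first derivatives and the same rules at order \<open>m\<close>,
  which calls for an order that can be counted.\<close>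

definition differentiable_upto :: "nat \<Rightarrow> 'x::real_normed_vector set \<Rightarrow> ('x \<Rightarrow> 'y::real_normed_vector) \<Rightarrow> bool" where
  "differentiable_upto m U f \<longleftrightarrow> (\<forall>vs. length vs \<le> m \<longrightarrow> (\<forall>x\<in>U. iter_deriv vs f differentiable (at x)))"

lemma smooth_iff_upto: "smooth U f \<longleftrightarrow> (\<forall>m. differentiable_upto m U f)"
  unfolding smooth_def differentiable_upto_def by auto

lemma differentiable_upto_0: "differentiable_upto 0 U f \<longleftrightarrow> (\<forall>x\<in>U. f differentiable (at x))"
  unfolding differentiable_upto_def by auto

lemma differentiable_upto_Suc:
  "differentiable_upto (Suc m) U f \<longleftrightarrow>
     (\<forall>x\<in>U. f differentiable (at x)) \<and> (\<forall>v. differentiable_upto m U (dir_deriv v f))"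
proof safe
  fix x assume "differentiable_upto (Suc m) U f" "x \<in> U"
  then show "f differentiable (at x)" unfolding differentiable_upto_def
    by (metis iter_deriv.simps(1) le0 list.size(3))
next
  fix v assume a: "differentiable_upto (Suc m) U f"
  show "differentiable_upto m U (dir_deriv v f)"
    unfolding differentiable_upto_def iter_deriv_snoc[symmetric]
    using a[unfolded differentiable_upto_def] by auto
next
  assume a: "\<forall>x\<in>U. f differentiable (at x)" "\<forall>v. differentiable_upto m U (dir_deriv v f)"
  show "differentiable_upto (Suc m) U f"
    unfolding differentiable_upto_def
  proof (intro allI impI)
    fix vs :: "'a list" assume l: "length vs \<le> Suc m"
    show "\<forall>x\<in>U. iter_deriv vs f differentiable at x"
    proof (cases vs rule: rev_cases)
      case (snoc ws w)
      then show ?thesis using a(2) l unfolding snoc iter_deriv_snoc differentiable_upto_def by auto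
    qed (use a in auto)
  qed
qed

lemma differentiable_upto_mono: "differentiable_upto m U f \<Longrightarrow> k \<le> m \<Longrightarrow> V \<subseteq> U \<Longrightarrow> differentiable_upto k V f"
  unfolding differentiable_upto_def by auto

lemma differentiable_upto_cong:
  assumes "open U" "\<And>x. x \<in> U \<Longrightarrow> f x = g x"
  shows "differentiable_upto m U f \<longleftrightarrow> differentiable_upto m U g"
proof -
  have "iter_deriv vs f differentiable at x \<longleftrightarrow> iter_deriv vs g differentiable at x" if "x \<in> U" for vs x
    by (rule differentiable_cong[OF assms(1) that]) (rule iter_deriv_cong[OF assms])
  then show ?thesis unfolding differentiable_upto_def by simp
qed

lemma differentiable_upto_SucI:
  assumes "open U" "\<And>x. x \<in> U \<Longrightarrow> f differentiable (at x)"
    and "\<And>v x. x \<in> U \<Longrightarrow> dir_deriv v f x = h v x" "\<And>v. differentiable_upto m U (h v)"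
  shows "differentiable_upto (Suc m) U f"
  unfolding differentiable_upto_Suc using assms differentiable_upto_cong[OF assms(1), of "dir_deriv _ f" "h _"] by metis

lemma differentiable_upto_SucD:
  assumes "differentiable_upto (Suc m) U f"
  shows "x \<in> U \<Longrightarrow> f differentiable (at x)" "differentiable_upto m U (dir_deriv v f)" "differentiable_upto m U f"
  using assms differentiable_upto_mono[OF assms, of m U] unfolding differentiable_upto_Suc by auto

lemma differentiable_upto_const: "differentiable_upto m U (\<lambda>x. c)"
proof (induction m arbitrary: c)
  case (Suc m)
  have "dir_deriv v (\<lambda>x::'a. c) = (\<lambda>x. 0)" for v unfolding dir_deriv_def by (auto simp: frechet_derivative_const)
  then show ?case using Suc unfolding differentiable_upto_Suc by simp
qed (auto simp: differentiable_upto_0)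

lemma bounded_linear_differentiable: "bounded_linear f \<Longrightarrow> f differentiable (at x)"
  using bounded_linear_imp_has_derivative differentiable_def by blast

lemma differentiable_compose_at:
  "f differentiable (at x) \<Longrightarrow> g differentiable (at (f x)) \<Longrightarrow> (\<lambda>x. g (f x)) differentiable (at x)"
  unfolding differentiable_def using has_derivative_compose by blast

lemma dir_deriv_bounded_linear: "bounded_linear f \<Longrightarrow> dir_deriv v f x = f v"
  using dir_deriv_eq[OF bounded_linear_imp_has_derivative] by auto

lemma dir_deriv_add:
  assumes "f differentiable (at x)" "g differentiable (at x)"
  shows "dir_deriv v (\<lambda>x. f x + g x) x = dir_deriv v f x + dir_deriv v g x"
  using dir_deriv_eq[OF has_derivative_add[OF has_derivative_dir_deriv[OF assms(1)] has_derivative_dir_deriv[OF assms(2)]]] by auto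

lemma dir_deriv_compose_linear:
  assumes "bounded_linear L" "f differentiable (at x)"
  shows "dir_deriv v (\<lambda>x. L (f x)) x = L (dir_deriv v f x)"
  using dir_deriv_eq[OF bounded_linear.has_derivative[OF assms(1) has_derivative_dir_deriv[OF assms(2)]]] by auto

lemma dir_deriv_scaleR:
  assumes "f differentiable (at x)" "g differentiable (at x)"
  shows "dir_deriv v (\<lambda>x. f x *\<^sub>R g x) x = f x *\<^sub>R dir_deriv v g x + dir_deriv v f x *\<^sub>R g x"
  using dir_deriv_eq[OF has_derivative_scaleR[OF has_derivative_dir_deriv[OF assms(1)] has_derivative_dir_deriv[OF assms(2)]]] by auto

lemma dir_deriv_compose:
  assumes "f differentiable (at x)" "g differentiable (at (f x))"
  shows "dir_deriv v (\<lambda>x. g (f x)) x = dir_deriv (dir_deriv v f x) g (f x)"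
  using dir_deriv_eq[OF has_derivative_compose[OF has_derivative_dir_deriv[OF assms(1)] has_derivative_dir_deriv[OF assms(2)]]] by auto

lemma bounded_linear_dir_deriv: "f differentiable (at x) \<Longrightarrow> bounded_linear (\<lambda>v. dir_deriv v f x)"
  using has_derivative_dir_deriv has_derivative_bounded_linear by blast

lemma differentiable_upto_bounded_linear:
  assumes "bounded_linear f" "open U" shows "differentiable_upto m U f"
  by (cases m) (use assms in \<open>auto simp: differentiable_upto_0 dir_deriv_bounded_linear bounded_linear_differentiable
      intro!: differentiable_upto_SucI[where h = "\<lambda>v x. f v"] differentiable_upto_const\<close>)

lemma differentiable_upto_add:
  assumes "open U" "differentiable_upto m U f" "differentiable_upto m U g"
  shows "differentiable_upto m U (\<lambda>x. f x + g x)"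
  using assms(2,3)
proof (induction m arbitrary: f g)
  case (Suc m)
  note f = differentiable_upto_SucD[OF Suc.prems(1)] and g = differentiable_upto_SucD[OF Suc.prems(2)]
  show ?case
    by (rule differentiable_upto_SucI[OF assms(1) differentiable_add[OF f(1) g(1)] dir_deriv_add[OF f(1) g(1)] Suc.IH[OF f(2) g(2)]])
qed (auto simp: differentiable_upto_0)

lemma differentiable_upto_sum:
  assumes "open U" "\<And>i. i \<in> I \<Longrightarrow> differentiable_upto m U (f i)"
  shows "differentiable_upto m U (\<lambda>x. \<Sum>i\<in>I. f i x)"
  using assms(2)
proof (induction I rule: infinite_finite_induct)
qed (auto simp: differentiable_upto_const intro!: differentiable_upto_add[OF assms(1)])

lemma differentiable_upto_compose_linear:
  assumes "open U" "bounded_linear L" "differentiable_upto m U f"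
  shows "differentiable_upto m U (\<lambda>x. L (f x))"
  using assms(3)
proof (induction m arbitrary: f)
  case (Suc m)
  note f = differentiable_upto_SucD[OF Suc.prems(1)]
  show ?case
    by (rule differentiable_upto_SucI[OF assms(1) differentiable_compose_at[OF f(1) bounded_linear_differentiable[OF assms(2)]]
          dir_deriv_compose_linear[OF assms(2) f(1)] Suc.IH[OF f(2)]])
qed (use assms(2) in \<open>simp add: differentiable_upto_0 differentiable_compose_at[where g = L, OF _ bounded_linear_differentiable]\<close>)

lemma differentiable_upto_scaleR:
  assumes "open U" "differentiable_upto m U f" "differentiable_upto m U g"
  shows "differentiable_upto m U (\<lambda>x. f x *\<^sub>R g x)"
  using assms(2,3)
proof (induction m arbitrary: f g)
  case (Suc m)
  note f = differentiable_upto_SucD[OF Suc.prems(1)] and g = differentiable_upto_SucD[OF Suc.prems(2)]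
  show ?case
    by (rule differentiable_upto_SucI[OF assms(1) differentiable_scaleR[OF f(1) g(1)] dir_deriv_scaleR[OF f(1) g(1)]
          differentiable_upto_add[OF assms(1) Suc.IH[OF f(3) g(2)] Suc.IH[OF f(2) g(3)]]])
qed (auto simp: differentiable_upto_0 intro!: differentiable_scaleR)

section \<open>Composition of smooth maps\<close>

text \<open>A set lying in a finite-dimensional subspace with continuous coordinates. In infinite
  dimensions, a map that is smooth along all fixed directions can only be composed with maps
  taking values in such a set.\<close>

definition finite_coordinates :: "'y::real_normed_vector set \<Rightarrow> bool" where
  "finite_coordinates S \<longleftrightarrow> (\<exists>B l. finite B \<and> (\<forall>b\<in>B. bounded_linear (l b :: 'y \<Rightarrow> real)) \<and>
     (\<forall>y\<in>S. y = (\<Sum>b\<in>B. l b y *\<^sub>R b)))"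

lemma finite_coordinates_euclidean: "finite_coordinates (S :: 'y::euclidean_space set)"
  unfolding finite_coordinates_def
  by (rule exI[of _ Basis], rule exI[of _ "\<lambda>b y. y \<bullet> b"])
     (auto simp: euclidean_representation bounded_linear_inner_left)

lemma finite_coordinates_subset: "finite_coordinates T \<Longrightarrow> S \<subseteq> T \<Longrightarrow> finite_coordinates S"
  unfolding finite_coordinates_def by (meson subsetD)

text \<open>The chain rule differentiates \<open>g\<close> in the direction
  \<open>dir_deriv v f x\<close>, which varies with \<open>x\<close>, while smoothness of
  \<open>g\<close> concerns fixed directions. Expansion in \<open>B\<close> leaves fixed directions
  with varying real coefficients.\<close>

lemma dir_deriv_compose_coordinates:
  assumes "open U" "x \<in> U" and B: "finite B" "\<And>b. b \<in> B \<Longrightarrow> bounded_linear (l b :: 'y \<Rightarrow> real)"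
    "\<And>y. y \<in> f ` U \<Longrightarrow> y = (\<Sum>b\<in>B. l b y *\<^sub>R b)"
    and f: "f differentiable (at x)" and g: "(g :: 'y::real_normed_vector \<Rightarrow> 'z::real_normed_vector) differentiable (at (f x))"
  shows "dir_deriv v (\<lambda>x. g (f x)) x = (\<Sum>b\<in>B. l b (dir_deriv v f x) *\<^sub>R dir_deriv b g (f x))"
proof -
  have L: "bounded_linear (\<lambda>y. \<Sum>b\<in>B. l b y *\<^sub>R b)"
    using B(2) by (intro bounded_linear_sum bounded_linear_scaleR_const) auto
  \<comment> \<open>On \<open>U\<close> the map \<open>f\<close> equals its own expansion in
    \<open>B\<close>, so its derivative lies in the span of \<open>B\<close>, with coordinates
    obtained by applying the same functionals \<open>l b\<close>.\<close>
  have "dir_deriv v f x = dir_deriv v (\<lambda>x. \<Sum>b\<in>B. l b (f x) *\<^sub>R b) x"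
    unfolding dir_deriv_def using frechet_derivative_cong[OF assms(1,2), of f "\<lambda>x. \<Sum>b\<in>B. l b (f x) *\<^sub>R b"] B(3)
    by auto
  also have "\<dots> = (\<Sum>b\<in>B. l b (dir_deriv v f x) *\<^sub>R b)"
    by (rule dir_deriv_compose_linear[OF L f])
  finally have *: "dir_deriv v f x = (\<Sum>b\<in>B. l b (dir_deriv v f x) *\<^sub>R b)" .
  interpret g: bounded_linear "\<lambda>v. dir_deriv v g (f x)" by (rule bounded_linear_dir_deriv[OF g])
  have "dir_deriv v (\<lambda>x. g (f x)) x = dir_deriv (\<Sum>b\<in>B. l b (dir_deriv v f x) *\<^sub>R b) g (f x)"
    using dir_deriv_compose[OF f g] * by simp
  then show ?thesis by (simp add: g.sum g.scaleR)
qed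

text \<open>By the chain rule in coordinates the inner map stays the same and only \<open>g\<close>
  is replaced by its derivatives in the directions of \<open>B\<close>; hence the induction
  generalizes \<open>g\<close> alone.\<close>

lemma differentiable_upto_compose:
  assumes "open U" "finite_coordinates (f ` U)" "differentiable_upto m U f"
    and "f ` U \<subseteq> V" "differentiable_upto m V (g :: 'y::real_normed_vector \<Rightarrow> 'z::real_normed_vector)"
  shows "differentiable_upto m U (\<lambda>x. g (f x))"
  using assms(3,5)
proof (induction m arbitrary: g)
  case 0
  then show ?case using assms(4)
    using differentiable_compose_at[where f = f and g = g] by (simp add: differentiable_upto_0 image_subset_iff)
next
  case (Suc m)
  obtain B l where B: "finite B" "\<And>b. b \<in> B \<Longrightarrow> bounded_linear (l b :: 'y \<Rightarrow> real)"
    "\<And>y. y \<in> f ` U \<Longrightarrow> y = (\<Sum>b\<in>B. l b y *\<^sub>R b)"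
    using assms(2) unfolding finite_coordinates_def by blast
  note f = differentiable_upto_SucD[OF Suc.prems(1)] and g = differentiable_upto_SucD[OF Suc.prems(2)]
  have g1: "g differentiable (at (f x))" if "x \<in> U" for x using g(1) assms(4) that by blast
  show ?case
  proof (rule differentiable_upto_SucI[OF assms(1)])
    show "dir_deriv v (\<lambda>x. g (f x)) x = (\<Sum>b\<in>B. l b (dir_deriv v f x) *\<^sub>R dir_deriv b g (f x))" if "x \<in> U" for x v
      by (rule dir_deriv_compose_coordinates[where f = f and g = g and l = l and B = B and U = U])
        (fact assms(1) that B f(1)[OF that] g1[OF that])+
    show "differentiable_upto m U (\<lambda>x. \<Sum>b\<in>B. l b (dir_deriv v f x) *\<^sub>R dir_deriv b g (f x))" for v
    proof (rule differentiable_upto_sum[OF assms(1)])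
      fix b assume "b \<in> B"
      show "differentiable_upto m U (\<lambda>x. l b (dir_deriv v f x) *\<^sub>R dir_deriv b g (f x))"
        using differentiable_upto_compose_linear[OF assms(1) B(2)[OF \<open>b \<in> B\<close>] f(2)]
        by (rule differentiable_upto_scaleR[OF assms(1) _ Suc.IH[OF f(3) g(2)]])
    qed
  qed (rule differentiable_compose_at[OF f(1) g1])
qed

text \<open>The derivative of \<open>L\<close> is the fixed direction \<open>L v\<close>, so here
  the chain rule stays within fixed directions by itself.\<close>

lemma differentiable_upto_precompose_linear:
  assumes "open U" "bounded_linear L" "L ` U \<subseteq> V" "differentiable_upto m V g"
  shows "differentiable_upto m U (\<lambda>x. g (L x))"
  using assms(4)
proof (induction m arbitrary: g)
  case 0
  then show ?case using assms(3) bounded_linear_differentiable[OF assms(2)]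
    using differentiable_compose_at[where f = L and g = g] by (simp add: differentiable_upto_0 image_subset_iff)
next
  case (Suc m)
  note g = differentiable_upto_SucD[OF Suc.prems(1)]
  have d: "L differentiable (at x)" "g differentiable (at (L x))" if "x \<in> U" for x
    using g(1) assms(3) that bounded_linear_differentiable[OF assms(2)] by auto
  have eq: "dir_deriv v (\<lambda>x. g (L x)) x = dir_deriv (L v) g (L x)" if "x \<in> U" for v x
    using dir_deriv_compose[OF d[OF that]] dir_deriv_bounded_linear[OF assms(2)] by simp
  show ?case
    by (rule differentiable_upto_SucI[OF assms(1) differentiable_compose_at[OF d] eq Suc.IH[OF g(2)]])
qed

lemma smooth_imp_upto: "smooth U f \<Longrightarrow> differentiable_upto m U f"
  by (simp add: smooth_iff_upto)

lemma smooth_dir_deriv: "smooth U f \<Longrightarrow> smooth U (dir_deriv v f)"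
  unfolding smooth_iff_upto using differentiable_upto_SucD(2) by blast

lemma smooth_subset: "smooth U f \<Longrightarrow> V \<subseteq> U \<Longrightarrow> smooth V f"
  unfolding smooth_def by auto

lemma smooth_cong: "open U \<Longrightarrow> (\<And>x. x \<in> U \<Longrightarrow> f x = g x) \<Longrightarrow> smooth U f \<longleftrightarrow> smooth U g"
  unfolding smooth_iff_upto using differentiable_upto_cong by metis

lemma smooth_const: "smooth U (\<lambda>x. c)"
  unfolding smooth_iff_upto using differentiable_upto_const by blast

lemma smooth_bounded_linear: "bounded_linear f \<Longrightarrow> open U \<Longrightarrow> smooth U f"
  unfolding smooth_iff_upto using differentiable_upto_bounded_linear by blast

lemma smooth_add: "open U \<Longrightarrow> smooth U f \<Longrightarrow> smooth U g \<Longrightarrow> smooth U (\<lambda>x. f x + g x)"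
  unfolding smooth_iff_upto using differentiable_upto_add by blast

lemma smooth_scaleR: "open U \<Longrightarrow> smooth U f \<Longrightarrow> smooth U g \<Longrightarrow> smooth U (\<lambda>x. f x *\<^sub>R g x)"
  unfolding smooth_iff_upto using differentiable_upto_scaleR by blast

lemma smooth_compose_linear: "open U \<Longrightarrow> bounded_linear L \<Longrightarrow> smooth U f \<Longrightarrow> smooth U (\<lambda>x. L (f x))"
  unfolding smooth_iff_upto using differentiable_upto_compose_linear by blast

lemma smooth_precompose_linear:
  "open U \<Longrightarrow> bounded_linear L \<Longrightarrow> L ` U \<subseteq> V \<Longrightarrow> smooth V g \<Longrightarrow> smooth U (\<lambda>x. g (L x))"
  unfolding smooth_iff_upto using differentiable_upto_precompose_linear by blast

lemma smooth_compose_coordinates: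
  "open U \<Longrightarrow> finite_coordinates (f ` U) \<Longrightarrow> f ` U \<subseteq> V \<Longrightarrow> smooth U f \<Longrightarrow> smooth V g \<Longrightarrow> smooth U (\<lambda>x. g (f x))"
  unfolding smooth_iff_upto using differentiable_upto_compose by blast

lemma smooth_compose:
  fixes f :: "'x::real_normed_vector \<Rightarrow> 'y::euclidean_space"
  shows "open U \<Longrightarrow> f ` U \<subseteq> V \<Longrightarrow> smooth U f \<Longrightarrow> smooth V g \<Longrightarrow> smooth U (\<lambda>x. g (f x))"
  using smooth_compose_coordinates[OF _ finite_coordinates_euclidean] by blast

lemma smooth_differentiable: "smooth U f \<Longrightarrow> x \<in> U \<Longrightarrow> f differentiable (at x)"
  unfolding smooth_def by (metis iter_deriv.simps(1))

lemma smooth_continuous_on: "smooth U f \<Longrightarrow> continuous_on U f"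
  by (meson continuous_at_imp_continuous_on differentiable_imp_continuous_within smooth_differentiable)

section \<open>Germs and jets of smooth maps\<close>

definition smooth_at :: "('x::real_normed_vector \<Rightarrow> 'y::real_normed_vector) \<Rightarrow> 'x \<Rightarrow> bool" where
  "smooth_at f a \<longleftrightarrow> (\<exists>U. open U \<and> a \<in> U \<and> smooth U f)"

lemma smooth_atI: "smooth U f \<Longrightarrow> open U \<Longrightarrow> a \<in> U \<Longrightarrow> smooth_at f a"
  unfolding smooth_at_def by blast

lemma smooth_at_differentiable: "smooth_at f a \<Longrightarrow> f differentiable (at a)"
  unfolding smooth_at_def using smooth_differentiable by blast

lemma smooth_at_isCont: "smooth_at f a \<Longrightarrow> isCont f a"
  using smooth_at_differentiable differentiable_imp_continuous_within by blast

lemma smooth_at_eventually: "smooth_at f a \<Longrightarrow> \<forall>\<^sub>F x in nhds a. smooth_at f x"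
  unfolding smooth_at_def eventually_nhds by blast

lemma smooth_at_dir_deriv: "smooth_at f a \<Longrightarrow> smooth_at (dir_deriv v f) a"
  unfolding smooth_at_def using smooth_dir_deriv by blast

lemma smooth_at_iter_deriv: "smooth_at f a \<Longrightarrow> smooth_at (iter_deriv vs f) a"
proof (induction vs)
  case (Cons v vs)
  then show ?case unfolding iter_deriv_Cons' by (intro smooth_at_dir_deriv) auto
qed auto

lemma iter_deriv_cong_ev:
  assumes "\<forall>\<^sub>F x in nhds a. f x = g x"
  shows "\<forall>\<^sub>F x in nhds a. iter_deriv vs f x = iter_deriv vs g x" "iter_deriv vs f a = iter_deriv vs g a"
proof -
  obtain U where U: "open U" "a \<in> U" "\<And>x. x \<in> U \<Longrightarrow> f x = g x" using assms unfolding eventually_nhds by blast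
  have *: "iter_deriv vs f x = iter_deriv vs g x" if "x \<in> U" for x by (rule iter_deriv_cong[OF U(1,3) that])
  show "\<forall>\<^sub>F x in nhds a. iter_deriv vs f x = iter_deriv vs g x" "iter_deriv vs f a = iter_deriv vs g a"
    using U * unfolding eventually_nhds by blast+
qed

lemma dir_deriv_cong_ev:
  assumes "\<forall>\<^sub>F x in nhds a. f x = g x"
  shows "\<forall>\<^sub>F x in nhds a. dir_deriv v f x = dir_deriv v g x" "dir_deriv v f a = dir_deriv v g a"
  using iter_deriv_cong_ev[OF assms, of "[v]"] by (simp_all add: dir_deriv_def)

lemma smooth_at_cong_ev:
  assumes "\<forall>\<^sub>F x in nhds a. f x = g x" "smooth_at f a"
  shows "smooth_at g a"
proof -
  obtain U where U: "open U" "a \<in> U" "\<And>x. x \<in> U \<Longrightarrow> f x = g x" using assms(1) unfolding eventually_nhds by blast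
  obtain V where V: "open V" "a \<in> V" "smooth V f" using assms(2) unfolding smooth_at_def by blast
  have "smooth (U \<inter> V) g"
    using smooth_cong[of "U \<inter> V" f g] smooth_subset[OF V(3), of "U \<inter> V"] U V by auto
  then show ?thesis using U V smooth_atI[of "U \<inter> V"] by auto
qed

lemma smooth_at_const: "smooth_at (\<lambda>x. c) a"
  using smooth_atI[OF smooth_const open_UNIV] by auto

lemma smooth_at_bounded_linear: "bounded_linear f \<Longrightarrow> smooth_at f a"
  using smooth_atI[OF smooth_bounded_linear open_UNIV] by auto

lemma smooth_at_id: "smooth_at (\<lambda>x. x) a"
  by (rule smooth_at_bounded_linear[OF bounded_linear_ident])

lemma smooth_at_add:
  assumes "smooth_at f a" "smooth_at g a" shows "smooth_at (\<lambda>x. f x + g x) a"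
proof -
  obtain U V where "open U" "a \<in> U" "smooth U f" "open V" "a \<in> V" "smooth V g"
    using assms unfolding smooth_at_def by blast
  then show ?thesis
    by (intro smooth_atI[of "U \<inter> V"] smooth_add) (auto intro: smooth_subset)
qed

lemma smooth_at_scaleR:
  assumes "smooth_at f a" "smooth_at g a" shows "smooth_at (\<lambda>x. f x *\<^sub>R g x) a"
proof -
  obtain U V where "open U" "a \<in> U" "smooth U f" "open V" "a \<in> V" "smooth V g"
    using assms unfolding smooth_at_def by blast
  then show ?thesis
    by (intro smooth_atI[of "U \<inter> V"] smooth_scaleR) (auto intro: smooth_subset)
qed

lemma smooth_at_compose_linear: "bounded_linear L \<Longrightarrow> smooth_at f a \<Longrightarrow> smooth_at (\<lambda>x. L (f x)) a"
  unfolding smooth_at_def using smooth_compose_linear by blast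

lemma smooth_at_diff: "smooth_at f a \<Longrightarrow> smooth_at g a \<Longrightarrow> smooth_at (\<lambda>x. f x - g x) a"
  using smooth_at_add[of f a "\<lambda>x. - g x"] smooth_at_compose_linear[OF bounded_linear_minus[OF bounded_linear_ident], of g a] by simp

lemma smooth_at_sum: "(\<And>i. i \<in> I \<Longrightarrow> smooth_at (f i) a) \<Longrightarrow> smooth_at (\<lambda>x. \<Sum>i\<in>I. f i x) a"
  by (induction I rule: infinite_finite_induct) (auto simp: smooth_at_const intro!: smooth_at_add)

lemma smooth_at_Pair:
  assumes "smooth_at f a" "smooth_at g a" shows "smooth_at (\<lambda>x. (f x, g x)) a"
proof -
  have "smooth_at (\<lambda>x. (f x, 0) + (0, g x)) a"
    by (intro smooth_at_add smooth_at_compose_linear[OF _ assms(1)] smooth_at_compose_linear[OF _ assms(2)]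
        bounded_linear_Pair bounded_linear_ident bounded_linear_zero)
  then show ?thesis by simp
qed

lemma eventually_compose_isCont:
  "isCont f a \<Longrightarrow> \<forall>\<^sub>F y in nhds (f a). P y \<Longrightarrow> \<forall>\<^sub>F x in nhds a. P (f x)"
  using eventually_compose_filterlim isCont_def tendsto_at_iff_tendsto_nhds by blast

lemma open_inter_vimage_smooth: "smooth U f \<Longrightarrow> open U \<Longrightarrow> open V \<Longrightarrow> open (U \<inter> f -` V)"
  using continuous_open_preimage[OF smooth_continuous_on] by blast

lemma smooth_at_compose_coordinates:
  assumes "smooth_at f a" "smooth_at g (f a)" "\<forall>\<^sub>F x in nhds a. f x \<in> S" "finite_coordinates S"
  shows "smooth_at (\<lambda>x. g (f x)) a"
proof -
  obtain U V W where *: "open U" "a \<in> U" "smooth U f" "open V" "f a \<in> V" "smooth V g" "open W" "a \<in> W" "\<And>x. x \<in> W \<Longrightarrow> f x \<in> S"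
    using assms(1-3) unfolding smooth_at_def eventually_nhds by blast
  let ?U = "W \<inter> (U \<inter> f -` V)"
  have o: "open ?U" using open_inter_vimage_smooth[of U f V] * by auto
  moreover have "smooth ?U (\<lambda>x. g (f x))"
    using * by (intro smooth_compose_coordinates[OF o finite_coordinates_subset[OF assms(4)] _ _ *(6)] smooth_subset[OF *(3)]) auto
  ultimately show ?thesis using * by (intro smooth_atI[of ?U]) auto
qed

lemma smooth_at_compose:
  fixes f :: "'x::real_normed_vector \<Rightarrow> 'y::euclidean_space"
  assumes "smooth_at f a" "smooth_at g (f a)"
  shows "smooth_at (\<lambda>x. g (f x)) a"
  using smooth_at_compose_coordinates[OF assms, of UNIV] finite_coordinates_euclidean by auto

lemma smooth_at_precompose_linear:
  assumes "bounded_linear L" "smooth_at g (L a)"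
  shows "smooth_at (\<lambda>x. g (L x)) a"
proof -
  obtain V where V: "open V" "L a \<in> V" "smooth V g" using assms(2) unfolding smooth_at_def by blast
  have "open (L -` V)" using V(1) assms(1) linear_continuous_on[OF assms(1), of UNIV] continuous_on_open_vimage[of UNIV L] by auto
  then show ?thesis using V assms(1) by (intro smooth_atI[of "L -` V"] smooth_precompose_linear[OF _ _ _ V(3)]) auto
qed

lemma smooth_iff_smooth_at: "open U \<Longrightarrow> smooth U f \<longleftrightarrow> (\<forall>x\<in>U. smooth_at f x)"
  unfolding smooth_at_def smooth_def by (meson subsetD)

section \<open>Directional derivatives on Euclidean spaces\<close>

lemma linear_sum_Basis:
  fixes A :: "'e::euclidean_space \<Rightarrow> 'y::real_vector"
  assumes "linear A" shows "A v = (\<Sum>b\<in>Basis. (v \<bullet> b) *\<^sub>R A b)"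
proof -
  have "A v = A (\<Sum>b\<in>Basis. (v \<bullet> b) *\<^sub>R b)" by (simp add: euclidean_representation)
  then show ?thesis by (simp only: linear_sum[OF assms] linear_scale[OF assms])
qed

lemma dir_deriv_sum_Basis:
  fixes f :: "'x::euclidean_space \<Rightarrow> 'y::real_normed_vector"
  assumes "f differentiable (at x)"
  shows "dir_deriv v f x = (\<Sum>b\<in>Basis. (v \<bullet> b) *\<^sub>R dir_deriv b f x)"
  by (rule linear_sum_Basis[OF bounded_linear.linear[OF bounded_linear_dir_deriv[OF assms]]])

text \<open>The mean value inequality, with the operator norm estimated from the basis directions
  because growth is known for directional derivatives only.\<close>

lemma norm_diff_le_dir_deriv_bound:
  fixes f :: "'x::euclidean_space \<Rightarrow> 'y::real_normed_vector"
  assumes "convex S" "\<And>x. x \<in> S \<Longrightarrow> f differentiable (at x)"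
    "\<And>x b. x \<in> S \<Longrightarrow> b \<in> Basis \<Longrightarrow> norm (dir_deriv b f x) \<le> C b" "x \<in> S" "y \<in> S"
  shows "norm (f x - f y) \<le> (\<Sum>b\<in>Basis. C b) * norm (x - y)"
proof (rule differentiable_bound[OF assms(1) _ _ assms(4,5)])
  fix u assume u: "u \<in> S"
  show "(f has_derivative (\<lambda>v. dir_deriv v f u)) (at u within S)"
    by (rule has_derivative_at_withinI[OF has_derivative_dir_deriv[OF assms(2)[OF u]]])
  show "onorm (\<lambda>v. dir_deriv v f u) \<le> (\<Sum>b\<in>Basis. C b)"
  proof (rule onorm_le)
    fix v
    have "dir_deriv v f u = (\<Sum>b\<in>Basis. (v \<bullet> b) *\<^sub>R dir_deriv b f u)"
      by (rule dir_deriv_sum_Basis[OF assms(2)[OF u]])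
    also have "norm \<dots> \<le> (\<Sum>b\<in>Basis. norm v * C b)"
      using assms(3)[OF u] Basis_le_norm[of _ v]
      by (intro order_trans[OF norm_sum sum_mono]) (simp add: mult_mono)
    finally show "norm (dir_deriv v f u) \<le> (\<Sum>b\<in>Basis. C b) * norm v"
      by (simp add: sum_distrib_left sum_distrib_right mult.commute)
  qed
qed

lemma dir_deriv_scaleR_direction: "f differentiable (at x) \<Longrightarrow> dir_deriv (s *\<^sub>R v) f x = s *\<^sub>R dir_deriv v f x"
  using linear_scale[OF bounded_linear.linear[OF bounded_linear_dir_deriv]] by auto

text \<open>Unlike \<open>same_jet\<close>, this admits all directions: it makes sense on any normed
  space and is compatible with linear maps. On Euclidean spaces \<open>jets_agree_Basis\<close>
  recovers it from the partial derivatives.\<close>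

definition jets_agree :: "nat \<Rightarrow> ('x::real_normed_vector \<Rightarrow> 'y::real_normed_vector) \<Rightarrow> ('x \<Rightarrow> 'y) \<Rightarrow> 'x \<Rightarrow> bool" where
  "jets_agree m f g a \<longleftrightarrow> (\<forall>vs. length vs \<le> m \<longrightarrow> iter_deriv vs f a = iter_deriv vs g a)"

lemma jets_agree_refl: "jets_agree m f f a"
  by (simp add: jets_agree_def)

lemma jets_agree_sym: "jets_agree m f g a \<Longrightarrow> jets_agree m g f a"
  by (simp add: jets_agree_def)

lemma jets_agree_trans: "jets_agree m f g a \<Longrightarrow> jets_agree m g h a \<Longrightarrow> jets_agree m f h a"
  by (simp add: jets_agree_def)

lemma jets_agree_mono: "jets_agree m f g a \<Longrightarrow> k \<le> m \<Longrightarrow> jets_agree k f g a"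
  by (simp add: jets_agree_def)

lemma jets_agree_value: "jets_agree m f g a \<Longrightarrow> f a = g a"
  unfolding jets_agree_def by (metis iter_deriv.simps(1) le0 list.size(3))

lemma jets_agree_cong_ev: "\<forall>\<^sub>F x in nhds a. f x = g x \<Longrightarrow> jets_agree m f g a"
  unfolding jets_agree_def using iter_deriv_cong_ev(2) by blast

lemma jets_agree_0: "jets_agree 0 f g a \<longleftrightarrow> f a = g a"
  by (simp add: jets_agree_def)

lemma jets_agree_Suc:
  "jets_agree (Suc m) f g a \<longleftrightarrow> f a = g a \<and> (\<forall>v. jets_agree m (dir_deriv v f) (dir_deriv v g) a)"
proof safe
  fix v assume a: "jets_agree (Suc m) f g a"
  show "jets_agree m (dir_deriv v f) (dir_deriv v g) a"
    unfolding jets_agree_def iter_deriv_snoc[symmetric] using a unfolding jets_agree_def by auto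
next
  assume a: "f a = g a" "\<forall>v. jets_agree m (dir_deriv v f) (dir_deriv v g) a"
  show "jets_agree (Suc m) f g a"
    unfolding jets_agree_def
  proof (intro allI impI)
    fix vs :: "'a list" assume l: "length vs \<le> Suc m"
    show "iter_deriv vs f a = iter_deriv vs g a"
    proof (cases vs rule: rev_cases)
      case (snoc ws w)
      then show ?thesis using a(2) l unfolding snoc iter_deriv_snoc jets_agree_def by auto
    qed (use a in auto)
  qed
qed (auto intro: jets_agree_value)

lemma iter_deriv_add:
  assumes "smooth_at f a" "smooth_at g a"
  shows "iter_deriv vs (\<lambda>x. f x + g x) a = iter_deriv vs f a + iter_deriv vs g a"
  using assms
proof (induction vs arbitrary: a)
  case (Cons v vs)
  have "\<forall>\<^sub>F x in nhds a. iter_deriv vs (\<lambda>x. f x + g x) x = iter_deriv vs f x + iter_deriv vs g x"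
    using smooth_at_eventually[OF Cons.prems(1)] smooth_at_eventually[OF Cons.prems(2)]
    by eventually_elim (rule Cons.IH)
  from dir_deriv_cong_ev(2)[OF this, of v] show ?case
    unfolding iter_deriv_Cons' using Cons.prems
    by (simp add: dir_deriv_add smooth_at_differentiable smooth_at_iter_deriv)
qed auto

lemma iter_deriv_compose_linear:
  assumes "bounded_linear L" "smooth_at f a"
  shows "iter_deriv vs (\<lambda>x. L (f x)) a = L (iter_deriv vs f a)"
  using assms(2)
proof (induction vs arbitrary: a)
  case (Cons v vs)
  have "\<forall>\<^sub>F x in nhds a. iter_deriv vs (\<lambda>x. L (f x)) x = L (iter_deriv vs f x)"
    using smooth_at_eventually[OF Cons.prems] by eventually_elim (rule Cons.IH)
  from dir_deriv_cong_ev(2)[OF this, of v] show ?case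
    unfolding iter_deriv_Cons' using Cons.prems
    by (simp add: dir_deriv_compose_linear[OF assms(1)] smooth_at_differentiable smooth_at_iter_deriv)
qed auto

lemma iter_deriv_precompose_linear:
  assumes "bounded_linear L" "smooth_at g (L a)"
  shows "iter_deriv vs (\<lambda>x. g (L x)) a = iter_deriv (map L vs) g (L a)"
  using assms(2)
proof (induction vs arbitrary: a)
  case (Cons v vs)
  have "isCont L a" using assms(1) linear_continuous_at by blast
  have "\<forall>\<^sub>F x in nhds a. iter_deriv vs (\<lambda>x. g (L x)) x = iter_deriv (map L vs) g (L x)"
    using eventually_compose_isCont[OF \<open>isCont L a\<close> smooth_at_eventually[OF Cons.prems]]
    by eventually_elim (rule Cons.IH)
  from dir_deriv_cong_ev(2)[OF this, of v] show ?case
    using dir_deriv_compose[where f = L and g = "iter_deriv (map L vs) g" and x = a and v = v]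
    by (simp add: iter_deriv_Cons' dir_deriv_bounded_linear[OF assms(1)] bounded_linear_differentiable[OF assms(1)]
        smooth_at_differentiable[OF smooth_at_iter_deriv[OF Cons.prems]] del: iter_deriv.simps)
qed auto

lemma iter_deriv_diff:
  assumes "smooth_at f a" "smooth_at g a"
  shows "iter_deriv vs (\<lambda>x. f x - g x) a = iter_deriv vs f a - iter_deriv vs g a"
  using iter_deriv_add[OF assms(1) smooth_at_compose_linear[OF bounded_linear_minus[OF bounded_linear_ident] assms(2)]]
    iter_deriv_compose_linear[OF bounded_linear_minus[OF bounded_linear_ident] assms(2)] by simp

lemma jets_agree_add:
  assumes "jets_agree m f f' a" "jets_agree m g g' a" "smooth_at f a" "smooth_at g a" "smooth_at f' a" "smooth_at g' a"
  shows "jets_agree m (\<lambda>x. f x + g x) (\<lambda>x. f' x + g' x) a"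
  using assms unfolding jets_agree_def by (simp add: iter_deriv_add)

lemma jets_agree_diff:
  assumes "jets_agree m f f' a" "jets_agree m g g' a" "smooth_at f a" "smooth_at g a" "smooth_at f' a" "smooth_at g' a"
  shows "jets_agree m (\<lambda>x. f x - g x) (\<lambda>x. f' x - g' x) a"
  using assms unfolding jets_agree_def by (simp add: iter_deriv_diff)

lemma jets_agree_compose_linear:
  assumes "bounded_linear L" "jets_agree m f f' a" "smooth_at f a" "smooth_at f' a"
  shows "jets_agree m (\<lambda>x. L (f x)) (\<lambda>x. L (f' x)) a"
  using assms unfolding jets_agree_def by (simp add: iter_deriv_compose_linear)

lemma jets_agree_sum:
  assumes "\<And>i. i \<in> I \<Longrightarrow> jets_agree m (f i) (g i) a"
    "\<And>i. i \<in> I \<Longrightarrow> smooth_at (f i) a" "\<And>i. i \<in> I \<Longrightarrow> smooth_at (g i) a"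
  shows "jets_agree m (\<lambda>x. \<Sum>i\<in>I. f i x) (\<lambda>x. \<Sum>i\<in>I. g i x) a"
  using assms
proof (induction I rule: infinite_finite_induct)
  case (insert i I)
  then show ?case by (simp add: jets_agree_add smooth_at_sum)
qed (simp_all add: jets_agree_refl)

text \<open>The Leibniz rule is an identity of germs at \<open>a\<close>; it is substituted on both
  sides before the induction hypothesis is applied to the two summands.\<close>

lemma jets_agree_scaleR:
  assumes "jets_agree m f f' a" "jets_agree m g g' a" "smooth_at f a" "smooth_at g a" "smooth_at f' a" "smooth_at g' a"
  shows "jets_agree m (\<lambda>x. f x *\<^sub>R g x) (\<lambda>x. f' x *\<^sub>R g' x) a"
  using assms
proof (induction m arbitrary: f f' g g')
  case (Suc m)
  have *: "\<forall>\<^sub>F x in nhds a. h x *\<^sub>R dir_deriv v k x + dir_deriv v h x *\<^sub>R k x = dir_deriv v (\<lambda>x. h x *\<^sub>R k x) x"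
    if "smooth_at h a" "smooth_at k a" for h k and v :: 'a
    using smooth_at_eventually[OF that(1)] smooth_at_eventually[OF that(2)]
    by eventually_elim (simp add: dir_deriv_scaleR smooth_at_differentiable)
  have "jets_agree m (dir_deriv v (\<lambda>x. f x *\<^sub>R g x)) (dir_deriv v (\<lambda>x. f' x *\<^sub>R g' x)) a" for v
  proof (rule jets_agree_trans[OF jets_agree_sym[OF jets_agree_cong_ev[OF *]] jets_agree_trans[OF _ jets_agree_cong_ev[OF *]]])
    show "jets_agree m (\<lambda>x. f x *\<^sub>R dir_deriv v g x + dir_deriv v f x *\<^sub>R g x)
       (\<lambda>x. f' x *\<^sub>R dir_deriv v g' x + dir_deriv v f' x *\<^sub>R g' x) a"
      using Suc.prems jets_agree_mono[OF Suc.prems(1), of m] jets_agree_mono[OF Suc.prems(2), of m]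
      by (intro jets_agree_add Suc.IH smooth_at_scaleR smooth_at_dir_deriv)
        (simp_all add: jets_agree_Suc[of m f] jets_agree_Suc[of m g])
  qed (use Suc.prems in auto)
  then show ?case using jets_agree_value[OF Suc.prems(1)] jets_agree_value[OF Suc.prems(2)]
    by (simp add: jets_agree_Suc)
qed (auto simp: jets_agree_0)

lemma dir_deriv_compose_Basis:
  fixes f :: "'x::real_normed_vector \<Rightarrow> 'y::euclidean_space"
  assumes "f differentiable (at x)" "g differentiable (at (f x))"
  shows "dir_deriv v (\<lambda>x. g (f x)) x = (\<Sum>b\<in>Basis. (dir_deriv v f x \<bullet> b) *\<^sub>R dir_deriv b g (f x))"
  unfolding dir_deriv_compose[OF assms] by (rule dir_deriv_sum_Basis[OF assms(2)])

text \<open>One derivative of the composite is a sum of products of components of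
  \<open>dir_deriv v f\<close> with \<open>dir_deriv b g\<close> after \<open>f\<close>. The latter
  are composites of lower order, so induction takes the place of an explicit formula for higher
  derivatives of composites.\<close>

lemma jets_agree_compose:
  fixes f f' :: "'x::real_normed_vector \<Rightarrow> 'y::euclidean_space" and g g' :: "'y \<Rightarrow> 'z::real_normed_vector"
  assumes "jets_agree m f f' a" "jets_agree m g g' (f a)"
    and "smooth_at f a" "smooth_at f' a" "smooth_at g (f a)" "smooth_at g' (f a)"
  shows "jets_agree m (\<lambda>x. g (f x)) (\<lambda>x. g' (f' x)) a"
  using assms
proof (induction m arbitrary: g g')
  case 0
  then show ?case by (auto simp: jets_agree_0)
next
  case (Suc m)
  have fa: "f a = f' a" using jets_agree_value[OF Suc.prems(1)] .
  have m: "jets_agree m f f' a" using jets_agree_mono[OF Suc.prems(1)] by auto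
  have *: "\<forall>\<^sub>F x in nhds a. (\<Sum>b\<in>Basis. (dir_deriv v h x \<bullet> b) *\<^sub>R dir_deriv b k (h x)) = dir_deriv v (\<lambda>x. k (h x)) x"
    if "smooth_at h a" "smooth_at k (h a)" for h :: "'x \<Rightarrow> 'y" and k :: "'y \<Rightarrow> 'z" and v :: 'x
    using smooth_at_eventually[OF that(1)] eventually_compose_isCont[OF smooth_at_isCont[OF that(1)] smooth_at_eventually[OF that(2)]]
    by eventually_elim (simp add: dir_deriv_compose_Basis smooth_at_differentiable)
  have "jets_agree m (dir_deriv v (\<lambda>x. g (f x))) (dir_deriv v (\<lambda>x. g' (f' x))) a" for v
  proof (rule jets_agree_trans[OF jets_agree_sym[OF jets_agree_cong_ev[OF *]] jets_agree_trans[OF _ jets_agree_cong_ev[OF *]]])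
    have 1: "jets_agree m (\<lambda>x. dir_deriv v f x \<bullet> b) (\<lambda>x. dir_deriv v f' x \<bullet> b) a" for b
      using Suc.prems by (intro jets_agree_compose_linear[OF bounded_linear_inner_left] smooth_at_dir_deriv) (auto simp: jets_agree_Suc)
    have 2: "jets_agree m (\<lambda>x. dir_deriv b g (f x)) (\<lambda>x. dir_deriv b g' (f' x)) a" for b
      using Suc.prems m by (intro Suc.IH smooth_at_dir_deriv) (auto simp: jets_agree_Suc)
    have 3: "smooth_at (\<lambda>x. dir_deriv v h x \<bullet> b) a" if "smooth_at h a" for b and h :: "'x \<Rightarrow> 'y"
      by (rule smooth_at_compose_linear[OF bounded_linear_inner_left smooth_at_dir_deriv[OF that]])
    have 4: "smooth_at (\<lambda>x. dir_deriv b k (h x)) a" if "smooth_at h a" "smooth_at k (h a)" for b and h :: "'x \<Rightarrow> 'y" and k :: "'y \<Rightarrow> 'z"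
      by (rule smooth_at_compose[OF that(1) smooth_at_dir_deriv[OF that(2)]])
    show "jets_agree m (\<lambda>x. \<Sum>b\<in>Basis. (dir_deriv v f x \<bullet> b) *\<^sub>R dir_deriv b g (f x))
       (\<lambda>x. \<Sum>b\<in>Basis. (dir_deriv v f' x \<bullet> b) *\<^sub>R dir_deriv b g' (f' x)) a"
      using Suc.prems(3-) fa
      by (intro jets_agree_sum jets_agree_scaleR 1 2 smooth_at_scaleR 3 4) auto
  qed (use Suc.prems fa in auto)
  then show ?case using jets_agree_value[OF Suc.prems(2)] fa
    by (simp add: jets_agree_Suc)
qed

lemma indices_snoc: "bs \<in> indices m \<Longrightarrow> b \<in> Basis \<Longrightarrow> bs @ [b] \<in> indices (Suc m)"
  by (auto simp: indices_def)

text \<open>A derivative in any direction is a combination of the basis derivatives with constant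
  coefficients, which passes agreement on from order to order.\<close>

lemma jets_agree_Basis:
  fixes f g :: "'x::euclidean_space \<Rightarrow> 'y::real_normed_vector"
  assumes "\<And>bs. bs \<in> indices m \<Longrightarrow> iter_deriv bs f a = iter_deriv bs g a" "smooth_at f a" "smooth_at g a"
  shows "jets_agree m f g a"
  using assms
proof (induction m arbitrary: f g)
  case 0
  then show ?case using 0(1)[of "[]"] by (simp add: jets_agree_0 indices_def)
next
  case (Suc m)
  have b: "jets_agree m (dir_deriv b f) (dir_deriv b g) a" if "b \<in> Basis" for b
    using Suc.prems(2,3) by (intro Suc.IH smooth_at_dir_deriv) (auto simp: iter_deriv_snoc[symmetric] intro!: Suc.prems(1) indices_snoc that)
  have *: "\<forall>\<^sub>F x in nhds a. (\<Sum>b\<in>Basis. (v \<bullet> b) *\<^sub>R dir_deriv b h x) = dir_deriv v h x"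
    if "smooth_at h a" for h :: "'x \<Rightarrow> 'y" and v :: 'x
    using smooth_at_eventually[OF that] by eventually_elim (rule dir_deriv_sum_Basis[OF smooth_at_differentiable, symmetric])
  have "jets_agree m (dir_deriv v f) (dir_deriv v g) a" for v
  proof (rule jets_agree_trans[OF jets_agree_sym[OF jets_agree_cong_ev[OF *]] jets_agree_trans[OF _ jets_agree_cong_ev[OF *]]])
    show "jets_agree m (\<lambda>x. \<Sum>b\<in>Basis. (v \<bullet> b) *\<^sub>R dir_deriv b f x) (\<lambda>x. \<Sum>b\<in>Basis. (v \<bullet> b) *\<^sub>R dir_deriv b g x) a"
      using Suc.prems(2,3) by (intro jets_agree_sum jets_agree_scaleR smooth_at_scaleR smooth_at_const jets_agree_refl b smooth_at_dir_deriv) auto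
  qed (use Suc.prems in auto)
  moreover have "f a = g a" using Suc.prems(1)[of "[]"] by (simp add: indices_def)
  ultimately show ?case by (simp add: jets_agree_Suc)
qed

section \<open>Finite differences\<close>

text \<open>Iterated differences are symmetric in the increments by mere algebra and are bounded by
  values of \<open>f\<close>. The first fact yields the symmetry of mixed derivatives, the second
  the passage from growth estimates to vanishing derivatives.\<close>

primrec finite_difference :: "'x::real_normed_vector list \<Rightarrow> ('x \<Rightarrow> real) \<Rightarrow> 'x \<Rightarrow> real" where
  "finite_difference [] f x = f x"
| "finite_difference (v # vs) f x = finite_difference vs f (x + v) - finite_difference vs f x"

lemma finite_difference_has_derivative:
  assumes "smooth (ball a r) f" "dist a (x + t *\<^sub>R v) + (\<Sum>w\<leftarrow>vs. norm w) < r"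
  shows "((\<lambda>t. finite_difference vs f (x + t *\<^sub>R v)) has_real_derivative
           finite_difference vs (dir_deriv v f) (x + t *\<^sub>R v)) (at t)"
  using assms(2)
proof (induction vs arbitrary: x)
  case Nil
  have "f differentiable (at (x + t *\<^sub>R v))" using Nil smooth_differentiable[OF assms(1)] by auto
  have "((\<lambda>t. x + t *\<^sub>R v) has_derivative (\<lambda>s. s *\<^sub>R v)) (at t)"
    by (auto intro!: derivative_eq_intros)
  from has_derivative_compose[OF this has_derivative_dir_deriv[OF \<open>f differentiable _\<close>]]
  have "((\<lambda>t. f (x + t *\<^sub>R v)) has_derivative (\<lambda>s. dir_deriv (s *\<^sub>R v) f (x + t *\<^sub>R v))) (at t)" .
  moreover have "dir_deriv (s *\<^sub>R v) f (x + t *\<^sub>R v) = dir_deriv v f (x + t *\<^sub>R v) * s" for s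
    using dir_deriv_scaleR_direction[OF \<open>f differentiable _\<close>] by simp
  ultimately show ?case by (simp add: has_field_derivative_def)
next
  case (Cons w vs)
  have "dist a (x + w + t *\<^sub>R v) \<le> dist a (x + t *\<^sub>R v) + norm w"
    using norm_triangle_ineq4[of "a - (x + t *\<^sub>R v)" w] by (simp add: dist_norm algebra_simps)
  then have "dist a (x + w + t *\<^sub>R v) + (\<Sum>w\<leftarrow>vs. norm w) < r" "dist a (x + t *\<^sub>R v) + (\<Sum>w\<leftarrow>vs. norm w) < r"
    using Cons.prems norm_ge_zero[of w] by (auto simp del: norm_ge_zero)
  note d = DERIV_diff[OF Cons.IH[OF this(1)] Cons.IH[OF this(2)]]
  have e: "x + t *\<^sub>R v + w = x + w + t *\<^sub>R v" for t by simp
  show ?case unfolding finite_difference.simps e by (rule d)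
qed

text \<open>The mean value theorem once per increment. The head of the list is treated first and so
  becomes the innermost derivative, whence the reversal.\<close>

lemma finite_difference_mean_value:
  assumes "smooth (ball a r) f" "dist a x + (\<Sum>w\<leftarrow>vs. norm w) < r"
  shows "\<exists>y. dist x y \<le> (\<Sum>w\<leftarrow>vs. norm w) \<and> finite_difference vs f x = iter_deriv (rev vs) f y"
  using assms
proof (induction vs arbitrary: f x)
  case (Cons v vs)
  have d: "dist a (x + t *\<^sub>R v) \<le> dist a x + norm v" if "0 \<le> t" "t \<le> 1" for t
  proof -
    have "dist a (x + t *\<^sub>R v) \<le> dist a x + norm (t *\<^sub>R v)"
      using norm_triangle_ineq4[of "a - x" "t *\<^sub>R v"] by (simp add: dist_norm algebra_simps)
    also have "\<dots> \<le> dist a x + norm v" using that by (simp add: mult_left_le_one_le)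
    finally show ?thesis .
  qed
  have "\<exists>t. 0 < t \<and> t < 1 \<and> finite_difference vs f (x + 1 *\<^sub>R v) - finite_difference vs f (x + 0 *\<^sub>R v)
      = (1 - 0) * finite_difference vs (dir_deriv v f) (x + t *\<^sub>R v)"
    using d Cons.prems by (intro MVT2 finite_difference_has_derivative[OF Cons.prems(1)]) fastforce+
  then obtain t where t: "0 < t" "t < 1" "finite_difference (v # vs) f x = finite_difference vs (dir_deriv v f) (x + t *\<^sub>R v)"
    by auto
  have "dist a (x + t *\<^sub>R v) + (\<Sum>w\<leftarrow>vs. norm w) < r" using d[of t] t Cons.prems by auto
  from Cons.IH[OF smooth_dir_deriv[OF Cons.prems(1)] this] obtain y where
    y: "dist (x + t *\<^sub>R v) y \<le> (\<Sum>w\<leftarrow>vs. norm w)" "finite_difference vs (dir_deriv v f) (x + t *\<^sub>R v) = iter_deriv (rev vs) (dir_deriv v f) y"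
    by blast
  have "dist x y \<le> dist x (x + t *\<^sub>R v) + dist (x + t *\<^sub>R v) y" by (rule dist_triangle)
  also have "dist x (x + t *\<^sub>R v) \<le> norm v" using t by (simp add: dist_norm mult_left_le_one_le)
  finally show ?case using y t by (intro exI[of _ y]) (auto simp: iter_deriv_snoc)
qed auto

lemma iter_deriv_scaleR_directions:
  assumes "smooth_at f a"
  shows "iter_deriv (map ((*\<^sub>R) s) vs) f a = s ^ length vs *\<^sub>R iter_deriv vs f a"
  using assms
proof (induction vs arbitrary: a)
  case (Cons v vs)
  have "\<forall>\<^sub>F x in nhds a. iter_deriv (map ((*\<^sub>R) s) vs) f x = s ^ length vs *\<^sub>R iter_deriv vs f x"
    using smooth_at_eventually[OF Cons.prems] by eventually_elim (rule Cons.IH)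
  from dir_deriv_cong_ev(2)[OF this, of "s *\<^sub>R v"]
  have "iter_deriv (map ((*\<^sub>R) s) (v # vs)) f a = dir_deriv (s *\<^sub>R v) (\<lambda>x. s ^ length vs *\<^sub>R iter_deriv vs f x) a"
    by (simp add: iter_deriv_Cons' del: iter_deriv.simps)
  also have "\<dots> = s ^ length vs *\<^sub>R dir_deriv (s *\<^sub>R v) (iter_deriv vs f) a"
    by (rule dir_deriv_compose_linear[OF bounded_linear_scaleR_right smooth_at_differentiable[OF smooth_at_iter_deriv[OF Cons.prems]]])
  also have "dir_deriv (s *\<^sub>R v) (iter_deriv vs f) a = s *\<^sub>R dir_deriv v (iter_deriv vs f) a"
    by (rule dir_deriv_scaleR_direction[OF smooth_at_differentiable[OF smooth_at_iter_deriv[OF Cons.prems]]])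
  finally show ?case by (simp add: iter_deriv_Cons' del: iter_deriv.simps)
qed auto

lemma sum_list_norm_scaleR: "0 \<le> s \<Longrightarrow> (\<Sum>w\<leftarrow>map ((*\<^sub>R) s) vs. norm w) = s * (\<Sum>w\<leftarrow>vs. norm w)"
  by (induction vs) (auto simp: algebra_simps)

lemma finite_difference_quotient_tendsto:
  assumes "smooth_at f a"
  shows "((\<lambda>s. finite_difference (map ((*\<^sub>R) s) vs) f a / s ^ length vs) \<longlongrightarrow> iter_deriv (rev vs) f a) (at_right 0)"
proof -
  obtain r where r: "0 < r" "smooth (ball a r) f"
    using assms unfolding smooth_at_def by (meson openE smooth_subset)
  have "isCont (iter_deriv (rev vs) f) a" using smooth_at_isCont[OF smooth_at_iter_deriv[OF assms]] .
  define S where "S = (\<Sum>w\<leftarrow>vs. norm w)"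
  have S: "0 \<le> S" unfolding S_def by (induction vs) auto
  show ?thesis
  proof (rule tendstoI)
    fix e :: real assume "0 < e"
    obtain d where d: "0 < d" "\<And>y. dist y a < d \<Longrightarrow> dist (iter_deriv (rev vs) f y) (iter_deriv (rev vs) f a) < e"
      using \<open>isCont _ a\<close> \<open>0 < e\<close> unfolding continuous_at_eps_delta by blast
    \<comment> \<open>\<open>S\<close> is the total length of the increments. Scaled by
      \<open>s\<close> below this bound they stay within both the radius \<open>r\<close> of
      smoothness and the radius \<open>d\<close> of continuity; adding 1 covers
      \<open>S = 0\<close>.\<close>
    have "0 < min r d / (S + 1)" using r d S by auto
    then show "\<forall>\<^sub>F s in at_right 0. dist (finite_difference (map ((*\<^sub>R) s) vs) f a / s ^ length vs) (iter_deriv (rev vs) f a) < e"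
      unfolding eventually_at_right_field
    proof (intro exI[of _ "min r d / (S + 1)"] conjI allI impI)
      fix s :: real assume s: "0 < s" "s < min r d / (S + 1)"
      then have "s * S + s < min r d" using S by (simp add: pos_less_divide_eq algebra_simps)
      then have sS: "s * S < min r d" using s by linarith
      obtain y where y: "dist a y \<le> s * S" "finite_difference (map ((*\<^sub>R) s) vs) f a = iter_deriv (rev (map ((*\<^sub>R) s) vs)) f y"
        using finite_difference_mean_value[OF r(2), of a "map ((*\<^sub>R) s) vs"] s sS sum_list_norm_scaleR[of s vs] unfolding S_def by auto
      have "smooth_at f y" using r(2) y(1) sS by (intro smooth_atI[OF r(2)]) auto
      then have "finite_difference (map ((*\<^sub>R) s) vs) f a / s ^ length vs = iter_deriv (rev vs) f y"
        using y(2) s iter_deriv_scaleR_directions[of f y s "rev vs"] by (simp add: rev_map)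
      then show "dist (finite_difference (map ((*\<^sub>R) s) vs) f a / s ^ length vs) (iter_deriv (rev vs) f a) < e"
        using d(2)[of y] y(1) sS by (simp add: dist_commute)
    qed
  qed
qed

text \<open>Both mixed derivatives are limits of the same second difference quotient. Differences
  are real valued, so the argument runs by components.\<close>

lemma dir_deriv_commute:
  fixes f :: "'x::real_normed_vector \<Rightarrow> 'y::euclidean_space"
  assumes "smooth_at f a"
  shows "dir_deriv u (dir_deriv v f) a = dir_deriv v (dir_deriv u f) a"
proof (rule euclidean_eqI)
  fix b :: 'y
  let ?f = "\<lambda>x. f x \<bullet> b"
  have f: "smooth_at ?f a" by (rule smooth_at_compose_linear[OF bounded_linear_inner_left assms])
  have "finite_difference (map ((*\<^sub>R) s) [u, v]) ?f a / s ^ length [u, v] = finite_difference (map ((*\<^sub>R) s) [v, u]) ?f a / s ^ length [v, u]" for s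
    by (simp add: algebra_simps)
  then have "((\<lambda>s. finite_difference (map ((*\<^sub>R) s) [v, u]) ?f a / s ^ length [v, u]) \<longlongrightarrow> iter_deriv (rev [u, v]) ?f a) (at_right 0)"
    using finite_difference_quotient_tendsto[OF f, of "[u, v]"] by presburger
  from tendsto_unique[OF _ this finite_difference_quotient_tendsto[OF f, of "[v, u]"]]
  have "iter_deriv (rev [u, v]) ?f a = iter_deriv (rev [v, u]) ?f a"
    by (simp add: trivial_limit_at_right_real)
  then have "iter_deriv [v, u] f a \<bullet> b = iter_deriv [u, v] f a \<bullet> b"
    using iter_deriv_compose_linear[OF bounded_linear_inner_left[of b] assms, of "[v, u]"]
      iter_deriv_compose_linear[OF bounded_linear_inner_left[of b] assms, of "[u, v]"] by simp
  then show "dir_deriv u (dir_deriv v f) a \<bullet> b = dir_deriv v (dir_deriv u f) a \<bullet> b"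
    by (simp add: dir_deriv_def)
qed

section \<open>Growth estimates and vanishing derivatives\<close>

lemma finite_difference_bound:
  assumes "\<And>y. dist x y \<le> (\<Sum>w\<leftarrow>vs. norm w) \<Longrightarrow> \<bar>f y\<bar> \<le> M"
  shows "\<bar>finite_difference vs f x\<bar> \<le> 2 ^ length vs * M"
  using assms
proof (induction vs arbitrary: x)
  case (Cons v vs)
  have "dist x y \<le> dist (x + v) y + norm v" for y
    using dist_triangle[of x y "x + v"] by (simp add: dist_norm)
  then have "\<bar>finite_difference vs f (x + v)\<bar> \<le> 2 ^ length vs * M"
    using Cons.prems by (intro Cons.IH) (smt (verit) list.simps(9) sum_list.Cons)
  moreover have "\<bar>finite_difference vs f x\<bar> \<le> 2 ^ length vs * M"
    by (intro Cons.IH Cons.prems) (simp add: add_increasing)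
  ultimately show ?case by simp
qed auto

text \<open>At scale \<open>s\<close> the iterated difference is of order s^(m+1), being a signed
  sum of 2 ^ \<open>length vs\<close> values of \<open>f\<close>. Division by
  \<open>s ^ length vs\<close> leaves order \<open>s\<close>, since
  \<open>length vs \<le> m\<close>.\<close>

lemma iter_deriv_eq_0_if_bigo_real:
  fixes f :: "'x::real_normed_vector \<Rightarrow> real"
  assumes "smooth_at f a" "\<forall>\<^sub>F x in nhds a. \<bar>f x\<bar> \<le> C * dist a x ^ Suc m" "length vs \<le> m"
  shows "iter_deriv vs f a = 0"
proof -
  define S where "S = (\<Sum>w\<leftarrow>rev vs. norm w)"
  have S: "0 \<le> S" unfolding S_def by (induction vs) auto
  obtain d where d: "0 < d" "\<And>x. dist x a < d \<Longrightarrow> \<bar>f x\<bar> \<le> C * dist a x ^ Suc m"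
    using assms(2) unfolding eventually_nhds_metric by blast
  define K where "K = 2 ^ length vs * (\<bar>C\<bar> * S ^ Suc m)"
  have "\<forall>\<^sub>F s in at_right 0. norm (finite_difference (map ((*\<^sub>R) s) (rev vs)) f a / s ^ length (rev vs)) \<le> K * s"
    unfolding eventually_at_right_field
  proof (intro exI[of _ "min 1 (d / (S + 1))"] conjI allI impI)
    fix s :: real assume s: "0 < s" "s < min 1 (d / (S + 1))"
    then have "s * S + s < d" using S by (simp add: pos_less_divide_eq algebra_simps)
    then have sS: "s * S < d" using s by linarith
    have "\<bar>finite_difference (map ((*\<^sub>R) s) (rev vs)) f a\<bar> \<le> 2 ^ length (map ((*\<^sub>R) s) (rev vs)) * (\<bar>C\<bar> * (s * S) ^ Suc m)"
    proof (rule finite_difference_bound)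
      fix y assume "dist a y \<le> (\<Sum>w\<leftarrow>map ((*\<^sub>R) s) (rev vs). norm w)"
      then have y: "dist a y \<le> s * S" using sum_list_norm_scaleR[of s "rev vs"] s by (simp add: S_def)
      then have "\<bar>f y\<bar> \<le> C * dist a y ^ Suc m" using d(2)[of y] sS by (simp add: dist_commute)
      also have "\<dots> \<le> \<bar>C\<bar> * (s * S) ^ Suc m" using y by (intro mult_mono power_mono) auto
      finally show "\<bar>f y\<bar> \<le> \<bar>C\<bar> * (s * S) ^ Suc m" .
    qed
    also have "\<dots> = K * s ^ Suc m" by (simp add: K_def power_mult_distrib)
    finally have "\<bar>finite_difference (map ((*\<^sub>R) s) (rev vs)) f a\<bar> \<le> K * s ^ Suc m" .
    also have "K * s ^ Suc m \<le> K * (s ^ length vs * s)"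
      using s assms(3) power_decreasing[of "length vs" m s] by (intro mult_left_mono) (auto simp: K_def S)
    finally show "norm (finite_difference (map ((*\<^sub>R) s) (rev vs)) f a / s ^ length (rev vs)) \<le> K * s"
      using s by (simp add: pos_divide_le_eq mult_ac)
  qed (use d S in auto)
  moreover have "((\<lambda>s. K * s) \<longlongrightarrow> K * 0) (at_right 0)" by (intro tendsto_intros)
  then have "((\<lambda>s. K * s) \<longlongrightarrow> 0) (at_right 0)" by simp
  ultimately have "((\<lambda>s. finite_difference (map ((*\<^sub>R) s) (rev vs)) f a / s ^ length (rev vs)) \<longlongrightarrow> 0) (at_right 0)"
    by (rule Lim_null_comparison)
  from tendsto_unique[OF _ this finite_difference_quotient_tendsto[OF assms(1), of "rev vs"]] show ?thesis
    by (simp add: trivial_limit_at_right_real)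
qed

text \<open>Turns an estimate back into an equality of jets. It serves for the flow, which is
  controlled by estimates on integral curves.\<close>

lemma jets_agree_if_bigo:
  fixes f g :: "'x::real_normed_vector \<Rightarrow> 'y::euclidean_space"
  assumes "smooth_at f a" "smooth_at g a" "\<forall>\<^sub>F x in nhds a. norm (f x - g x) \<le> C * dist a x ^ Suc m"
  shows "jets_agree m f g a"
  unfolding jets_agree_def
proof (intro allI impI)
  fix vs :: "'x list" assume l: "length vs \<le> m"
  have s: "smooth_at (\<lambda>x. f x - g x) a" by (rule smooth_at_diff[OF assms(1,2)])
  have "iter_deriv vs (\<lambda>x. f x - g x) a = 0"
  proof (rule euclidean_eqI)
    fix b :: 'y assume b: "b \<in> Basis"
    have "\<forall>\<^sub>F x in nhds a. \<bar>(f x - g x) \<bullet> b\<bar> \<le> C * dist a x ^ Suc m"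
      using assms(3) by eventually_elim (use Basis_le_norm[OF b] order_trans in blast)
    from iter_deriv_eq_0_if_bigo_real[OF smooth_at_compose_linear[OF bounded_linear_inner_left s] this l]
    show "iter_deriv vs (\<lambda>x. f x - g x) a \<bullet> b = 0 \<bullet> b"
      using iter_deriv_compose_linear[OF bounded_linear_inner_left[of b] s, of vs] by simp
  qed
  then show "iter_deriv vs f a = iter_deriv vs g a" using iter_deriv_diff[OF assms(1,2)] by simp
qed

text \<open>Taylor's estimate by induction: the first derivatives are of order r^m, and the mean
  value inequality on the closed ball of radius \<open>dist a x\<close>, which contains both
  \<open>a\<close> and \<open>x\<close>, gains one more factor.\<close>

lemma bigo_if_iter_deriv_eq_0:
  fixes f :: "'x::euclidean_space \<Rightarrow> 'y::real_normed_vector"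
  assumes "smooth_at f a" "\<And>vs. length vs < m \<Longrightarrow> iter_deriv vs f a = 0"
  shows "\<exists>C. \<forall>\<^sub>F x in nhds a. norm (f x) \<le> C * dist a x ^ m"
  using assms
proof (induction m arbitrary: f)
  case 0
  have "\<forall>\<^sub>F y in nhds (f a). dist y (f a) < 1"
    unfolding eventually_nhds_metric by (intro exI[of _ "1::real"]) auto
  then have "\<forall>\<^sub>F x in nhds a. dist (f x) (f a) < 1"
    by (rule eventually_compose_isCont[OF smooth_at_isCont[OF 0(1)]])
  then have "\<forall>\<^sub>F x in nhds a. norm (f x) \<le> (norm (f a) + 1) * dist a x ^ 0"
    by eventually_elim (simp add: dist_norm, smt (verit) norm_triangle_sub)
  then show ?case by blast
next
  case (Suc m)
  have "\<exists>C. \<forall>\<^sub>F x in nhds a. norm (dir_deriv b f x) \<le> C * dist a x ^ m" for b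
    using Suc.prems by (intro Suc.IH smooth_at_dir_deriv) (auto simp: iter_deriv_snoc[symmetric])
  then obtain C where C: "\<And>b. \<forall>\<^sub>F x in nhds a. norm (dir_deriv b f x) \<le> C b * dist a x ^ m" by metis
  have "\<forall>\<^sub>F x in nhds a. \<forall>b\<in>Basis. norm (dir_deriv b f x) \<le> C b * dist a x ^ m"
    using C by (simp add: eventually_ball_finite_distrib)
  moreover have "\<forall>\<^sub>F x in nhds a. smooth_at f x" by (rule smooth_at_eventually[OF Suc.prems(1)])
  ultimately have "\<forall>\<^sub>F x in nhds a. (\<forall>b\<in>Basis. norm (dir_deriv b f x) \<le> C b * dist a x ^ m) \<and> smooth_at f x"
    by eventually_elim auto
  then obtain d where d: "0 < d" "\<And>x b. dist x a < d \<Longrightarrow> b \<in> Basis \<Longrightarrow> norm (dir_deriv b f x) \<le> C b * dist a x ^ m"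
    "\<And>x. dist x a < d \<Longrightarrow> smooth_at f x"
    unfolding eventually_nhds_metric by blast
  define K where "K = (\<Sum>b\<in>Basis. \<bar>C b\<bar>)"
  have fa: "f a = 0" using Suc.prems(2)[of "[]"] by simp
  have "norm (f x) \<le> K * dist a x ^ Suc m" if x: "dist x a < d" for x
  proof -
    have "norm (f x - f a) \<le> (\<Sum>b\<in>Basis. \<bar>C b\<bar> * dist a x ^ m) * norm (x - a)"
    proof (rule norm_diff_le_dir_deriv_bound[OF convex_cball[of a "dist a x"]])
      fix y assume y: "y \<in> cball a (dist a x)"
      then have yd: "dist y a < d" using x by (auto simp: dist_commute)
      show "f differentiable (at y)" by (rule smooth_at_differentiable[OF d(3)[OF yd]])
      fix b :: 'x assume b: "b \<in> Basis"
      have "norm (dir_deriv b f y) \<le> C b * dist a y ^ m" by (rule d(2)[OF yd b])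
      also have "\<dots> \<le> \<bar>C b\<bar> * dist a x ^ m" using y by (intro mult_mono power_mono) auto
      finally show "norm (dir_deriv b f y) \<le> \<bar>C b\<bar> * dist a x ^ m" .
    qed auto
    then show ?thesis by (simp add: fa K_def dist_norm norm_minus_commute sum_distrib_right mult_ac)
  qed
  then show ?case using d(1) unfolding eventually_nhds_metric by blast
qed

section \<open>The smooth inverse function theorem\<close>

lemma dir_deriv_cong:
  "open U \<Longrightarrow> x \<in> U \<Longrightarrow> (\<And>y. y \<in> U \<Longrightarrow> f y = g y) \<Longrightarrow> dir_deriv v f x = dir_deriv v g x"
  unfolding dir_deriv_def using frechet_derivative_cong by metis

text \<open>\<open>A y\<close> stands for the derivative of a map at the preimage of
  \<open>y\<close>, and \<open>B y\<close> for its inverse, the derivative of the inverse map at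
  \<open>y\<close>. The bound keeps the inverses uniformly bounded; the factor 2 is what a
  derivative within 1/2 of the identity allows.\<close>

locale inverse_family =
  fixes V :: "'y::real_normed_vector set" and A B :: "'y \<Rightarrow> 'e::euclidean_space \<Rightarrow> 'e"
  assumes V: "open V"
    and lin: "y \<in> V \<Longrightarrow> linear (A y)"
    and bound: "y \<in> V \<Longrightarrow> norm v \<le> 2 * norm (A y v)"
    and inv: "y \<in> V \<Longrightarrow> A y (B y w) = w"
begin

lemma inj: "y \<in> V \<Longrightarrow> A y v = A y v' \<Longrightarrow> v = v'"
  using bound[of y "v - v'"] lin[of y] by (simp add: linear_diff)

lemma linear_B: "y \<in> V \<Longrightarrow> linear (B y)"
  by (rule linearI; rule inj) (auto simp: linear_add[OF lin] linear_scale[OF lin] inv)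

lemma norm_B: "y \<in> V \<Longrightarrow> norm (B y w) \<le> 2 * norm w"
  using bound[of y "B y w"] inv[of y w] by simp

text \<open>The error of a trial solution \<open>v\<close> of \<open>A y v = w\<close> is the
  inverse applied to the residual. Both error terms in \<open>has_derivative_B\<close> are estimated
  in this way.\<close>

lemma B_diff: "y \<in> V \<Longrightarrow> B y w - v = - B y (A y v - w)"
  by (rule inj[of y]) (simp_all add: linear_diff[OF lin] linear_neg[OF lin] inv)

text \<open>The rule d(A^-1) = - A^-1 dA A^-1, applied to \<open>w\<close>. Differentiability of
  \<open>A\<close> is given on each vector separately; smallness of \<open>A y - A y0\<close> as an
  operator comes from the finitely many basis vectors.\<close>

lemma has_derivative_B:
  assumes diff: "\<And>v. (\<lambda>y. A y v) differentiable (at y0)" and y0: "y0 \<in> V"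
  shows "((\<lambda>y. B y w) has_derivative (\<lambda>u. - B y0 (dir_deriv u (\<lambda>y. A y (B y0 w)) y0))) (at y0)"
proof -
  define v0 where "v0 = B y0 w"
  define D where "D u = dir_deriv u (\<lambda>y. A y v0) y0" for u
  have D: "bounded_linear D" using bounded_linear_dir_deriv[OF diff[of v0]] by (simp add: D_def[symmetric])
  have B: "bounded_linear (B y0)" using linear_B[OF y0] linear_conv_bounded_linear by blast
  obtain K where K: "0 < K" "\<And>h. norm (D h) \<le> norm h * K" using bounded_linear.pos_bounded[OF D] by blast
  show ?thesis
    unfolding has_derivative_at_alt v0_def[symmetric] D_def[symmetric]
  proof (intro conjI allI impI)
    show "bounded_linear (\<lambda>u. - B y0 (D u))"
      by (rule bounded_linear_minus[OF bounded_linear_compose[OF B D]])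
    fix e :: real assume e: "0 < e"
    \<comment> \<open>With this \<open>c\<close> the term from \<open>B y q - B y0 q\<close> is at
      most half of \<open>e * norm (y - y0)\<close>; the choice of \<open>e / 4\<close> for
      \<open>d1\<close> gives the other half.\<close>
    define c where "c = e / (8 * K * DIM('e))"
    have c: "0 < c" using e K by (simp add: c_def)
    have "((\<lambda>y. A y v0) has_derivative D) (at y0)" using has_derivative_dir_deriv[OF diff[of v0]] by (simp add: D_def[symmetric])
    then obtain d1 where d1: "0 < d1" "\<And>y. norm (y - y0) < d1 \<Longrightarrow> norm (A y v0 - A y0 v0 - D (y - y0)) \<le> e / 4 * norm (y - y0)"
      unfolding has_derivative_at_alt using e by (meson divide_pos_pos zero_less_numeral)
    have "\<exists>d>0. \<forall>y. norm (y - y0) < d \<longrightarrow> norm (A y b - A y0 b) \<le> c" for b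
      using differentiable_imp_continuous_within[OF diff[of b]] c unfolding continuous_at_eps_delta dist_norm
      by (meson less_imp_le)
    then obtain dd where dd: "\<And>b. 0 < dd b" "\<And>b y. norm (y - y0) < dd b \<Longrightarrow> norm (A y b - A y0 b) \<le> c" by metis
    define d2 where "d2 = Min (dd ` (Basis::'e set))"
    have d2: "0 < d2" "\<And>b. b \<in> Basis \<Longrightarrow> d2 \<le> dd b" unfolding d2_def using dd(1) by (auto simp: Min_gr_iff)
    obtain d3 where d3: "0 < d3" "ball y0 d3 \<subseteq> V" using V y0 openE by blast
    show "\<exists>d>0. \<forall>y. norm (y - y0) < d \<longrightarrow> norm (B y w - v0 - - B y0 (D (y - y0))) \<le> e * norm (y - y0)"
    proof (intro exI[of _ "min d1 (min d2 d3)"] conjI allI impI)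
      fix y assume y: "norm (y - y0) < min d1 (min d2 d3)"
      have yV: "y \<in> V" using y d3(2) by (auto simp: dist_norm norm_minus_commute)
      define q where "q = D (y - y0)"
      have small: "norm (A y v - A y0 v) \<le> DIM('e) * c * norm v" for v
      proof -
        have "A y v - A y0 v = (\<Sum>b\<in>Basis. (v \<bullet> b) *\<^sub>R (A y b - A y0 b))"
          using linear_sum_Basis[OF lin[OF yV], of v] linear_sum_Basis[OF lin[OF y0], of v]
          by (simp add: sum_subtractf scaleR_diff_right)
        also have "norm \<dots> \<le> (\<Sum>b\<in>(Basis::'e set). norm v * c)"
        proof (rule order_trans[OF norm_sum sum_mono])
          fix b :: 'e assume b: "b \<in> Basis"
          have "norm (A y b - A y0 b) \<le> c" using dd(2) d2(2)[OF b] y by auto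
          then show "norm ((v \<bullet> b) *\<^sub>R (A y b - A y0 b)) \<le> norm v * c"
            using Basis_le_norm[OF b, of v] by (simp add: mult_mono)
        qed
        finally show ?thesis by (simp add: mult_ac)
      qed
      have w: "A y0 v0 = w" unfolding v0_def by (rule inv[OF y0])
      have "B y w - v0 - - B y0 q = - B y (A y v0 - w - q) - (B y q - B y0 q)"
        unfolding B_diff[OF yV, of w v0] by (simp add: linear_diff[OF linear_B[OF yV]])
      also have "norm \<dots> \<le> norm (B y (A y v0 - w - q)) + norm (B y q - B y0 q)"
        using norm_triangle_ineq4[of "- B y (A y v0 - w - q)" "B y q - B y0 q"] by simp
      also have "norm (B y q - B y0 q) \<le> 2 * norm (A y (B y0 q) - A y0 (B y0 q))"
        using norm_B[OF yV] by (simp add: B_diff[OF yV] inv[OF y0])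
      also have "\<dots> \<le> 2 * (DIM('e) * c * (2 * (norm (y - y0) * K)))"
      proof -
        have "norm (B y0 q) \<le> 2 * (norm (y - y0) * K)"
          using norm_B[OF y0, of q] K(2)[of "y - y0"] unfolding q_def by linarith
        then have "DIM('e) * c * norm (B y0 q) \<le> DIM('e) * c * (2 * (norm (y - y0) * K))"
          using c by (intro mult_left_mono) auto
        then show ?thesis using small[of "B y0 q"] by linarith
      qed
      also have "\<dots> = e / 2 * norm (y - y0)" using K by (simp add: c_def)
      also have "norm (B y (A y v0 - w - q)) \<le> 2 * (e / 4 * norm (y - y0))"
        using norm_B[OF yV, of "A y v0 - w - q"] d1(2)[of y] y w unfolding q_def by auto
      finally show "norm (B y w - v0 - - B y0 (D (y - y0))) \<le> e * norm (y - y0)"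
        unfolding q_def by simp
    qed (use d1 d2 d3 in auto)
  qed
qed

text \<open>In basis coordinates the derivative of \<open>B y w\<close> is a polynomial in values of
  \<open>B\<close> and first derivatives of \<open>A\<close>. If these have order \<open>m\<close>,
  then \<open>B\<close> has order \<open>m + 1\<close>.\<close>

lemma differentiable_upto_B:
  assumes "\<And>v. differentiable_upto m V (\<lambda>y. A y v)"
  shows "differentiable_upto m V (\<lambda>y. B y w)"
  using assms
proof (induction m arbitrary: w)
  case 0
  then show ?case using has_derivative_B unfolding differentiable_upto_0 differentiable_def by blast
next
  case (Suc m)
  note A = differentiable_upto_SucD[OF Suc.prems]
  have "(\<lambda>y. A y v) differentiable (at y)" if "y \<in> V" for v y using A(1) that by blast
  note d = has_derivative_B[OF this]
  define c where "c u b y = dir_deriv u (\<lambda>y. A y b) y" for u b y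
  define h where "h u y = - (\<Sum>b\<in>Basis. \<Sum>b'\<in>Basis. ((B y w \<bullet> b) * (c u b y \<bullet> b')) *\<^sub>R B y b')" for u y
  have IH: "differentiable_upto m V (\<lambda>y. B y w)" for w by (rule Suc.IH[OF A(3)])
  show ?case
  proof (rule differentiable_upto_SucI[OF V, where h = h])
    show "(\<lambda>y. B y w) differentiable (at y)" if "y \<in> V" for y using d[OF that] that unfolding differentiable_def by blast
    show "dir_deriv u (\<lambda>y. B y w) y = h u y" if y: "y \<in> V" for u y
    proof -
      let ?v = "B y w"
      have "dir_deriv u (\<lambda>y. A y ?v) y = dir_deriv u (\<lambda>y. \<Sum>b\<in>Basis. (?v \<bullet> b) *\<^sub>R A y b) y"
        by (rule dir_deriv_cong[OF V y]) (rule linear_sum_Basis[OF lin])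
      also have "\<dots> = (\<Sum>b\<in>Basis. (?v \<bullet> b) *\<^sub>R c u b y)"
      proof -
        have "((\<lambda>y. \<Sum>b\<in>Basis. (?v \<bullet> b) *\<^sub>R A y b) has_derivative (\<lambda>u. \<Sum>b\<in>Basis. (?v \<bullet> b) *\<^sub>R dir_deriv u (\<lambda>y. A y b) y)) (at y)"
          by (intro has_derivative_sum has_derivative_scaleR_right has_derivative_dir_deriv A(1)[OF y])
        then show ?thesis unfolding c_def by (rule dir_deriv_eq)
      qed
      finally have "dir_deriv u (\<lambda>y. B y w) y = - B y (\<Sum>b\<in>Basis. (?v \<bullet> b) *\<^sub>R c u b y)"
        using dir_deriv_eq[OF d[OF y y]] by simp
      also have "\<dots> = - (\<Sum>b\<in>Basis. (?v \<bullet> b) *\<^sub>R B y (c u b y))"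
        by (simp add: linear_sum[OF linear_B[OF y]] linear_scale[OF linear_B[OF y]])
      also have "\<dots> = h u y"
        unfolding h_def linear_sum_Basis[OF linear_B[OF y], of "c u _ y"] by (simp add: scaleR_sum_right)
      finally show ?thesis .
    qed
    show "differentiable_upto m V (h u)" for u
    proof -
      have "differentiable_upto m V (\<lambda>y. (B y w \<bullet> b) *\<^sub>R (c u b y \<bullet> b'))" for b b'
        unfolding c_def using A(2)[of u b]
        by (intro differentiable_upto_scaleR[OF V] differentiable_upto_compose_linear[OF V bounded_linear_inner_left] IH)
      then have "differentiable_upto m V (\<lambda>y. ((B y w \<bullet> b) * (c u b y \<bullet> b')) *\<^sub>R B y b')" for b b'
        using differentiable_upto_scaleR[OF V _ IH] by simp
      then show ?thesis
        unfolding h_def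
        by (intro differentiable_upto_compose_linear[OF V bounded_linear_minus[OF bounded_linear_ident]] differentiable_upto_sum[OF V])
    qed
  qed
qed

end

text \<open>The identity as derivative at \<open>a\<close> fits the later use for maps id plus terms
  of higher order. The classical theorem yields a differentiable inverse \<open>g\<close>; its
  higher derivatives follow from the formula for its first derivative.\<close>

theorem smooth_inverse_function:
  fixes f :: "'e::euclidean_space \<Rightarrow> 'e"
  assumes "smooth_at f a" "\<And>v. dir_deriv v f a = v"
  obtains U V g where "open U" "a \<in> U" "open V" "f a \<in> V" "homeomorphism U V f g" "smooth U f" "smooth V g"
proof -
  obtain W where W: "open W" "a \<in> W" "smooth W f" using assms(1) unfolding smooth_at_def by blast
  have cont: "continuous_on W (dir_deriv v f)" for v
    by (rule smooth_continuous_on[OF smooth_dir_deriv[OF W(3)]])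
  have bl: "bounded_linear (\<lambda>v. dir_deriv v f x)" if "x \<in> W" for x
    by (rule bounded_linear_dir_deriv[OF smooth_differentiable[OF W(3) that]])
  define f' where "f' x = Blinfun (\<lambda>v. dir_deriv v f x)" for x
  have f': "blinfun_apply (f' x) v = dir_deriv v f x" if "x \<in> W" for x v
    unfolding f'_def using bounded_linear_Blinfun_apply[OF bl[OF that]] by simp
  have contf: "continuous_on W f'"
    by (rule continuous_on_blinfun_componentwise) (use cont f' in \<open>simp cong: continuous_on_cong\<close>)
  have "isCont f' a" using contf W(1,2) continuous_on_eq_continuous_at by blast
  moreover have "f' a = id_blinfun" by (rule blinfun_eqI) (simp add: f'[OF W(2)] assms(2))
  \<comment> \<open>A derivative within distance 1/2 of the identity satisfies the lower bound of
    \<open>inverse_family\<close>.\<close>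
  ultimately obtain d where d: "0 < d" "\<And>x. dist x a < d \<Longrightarrow> dist (f' x) id_blinfun < 1/2"
    unfolding continuous_at_eps_delta by (metis half_gt_zero zero_less_one)
  define W' where "W' = W \<inter> ball a d"
  have W': "open W'" "a \<in> W'" "W' \<subseteq> W" unfolding W'_def using W d(1) by auto
  have lower: "norm v \<le> 2 * norm (dir_deriv v f x)" if "x \<in> W'" for x v
  proof -
    have "norm (blinfun_apply (f' x - id_blinfun) v) \<le> norm (f' x - id_blinfun) * norm v" by (rule norm_blinfun)
    also have "\<dots> \<le> 1/2 * norm v"
      using d(2)[of x] that by (intro mult_right_mono) (auto simp: W'_def dist_norm norm_minus_commute)
    finally have "norm (dir_deriv v f x - v) \<le> norm v / 2"
      using f'[of x v] that W' by (auto simp: blinfun.diff_left)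
    then show ?thesis using norm_triangle_sub[of v "dir_deriv v f x"] by (simp add: norm_minus_commute)
  qed
  have 1: "(f has_derivative blinfun_apply (f' x)) (at x)" if "x \<in> W'" for x
  proof -
    have "blinfun_apply (f' x) = (\<lambda>v. dir_deriv v f x)" using f'[of x] W' that by auto
    then show ?thesis using has_derivative_dir_deriv[OF smooth_differentiable[OF W(3)], of x] that W' by auto
  qed
  have inv: "id_blinfun o\<^sub>L f' a = id_blinfun"
    unfolding \<open>f' a = id_blinfun\<close> by (rule blinfun_eqI) simp
  obtain U V g g' where *: "open U" "U \<subseteq> W'" "a \<in> U" "open V" "f a \<in> V" "homeomorphism U V f g"
    "\<And>y. y \<in> V \<Longrightarrow> (g has_derivative (g' y)) (at y)"
    "\<And>y. y \<in> V \<Longrightarrow> g' y = Hilbert_Choice.inv (blinfun_apply (f'(g y)))"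
    "\<And>y. y \<in> V \<Longrightarrow> bij (blinfun_apply (f'(g y)))"
    by (rule inverse_function_theorem[OF W'(1) 1 continuous_on_subset[OF contf W'(3)] W'(2) inv]) (assumption, rule that)
  have gU: "g y \<in> U" if "y \<in> V" for y using *(6) that unfolding homeomorphism_def by blast
  have gW: "g y \<in> W'" "g y \<in> W" if "y \<in> V" for y using gU[OF that] *(2) W' by auto
  interpret inverse_family V "\<lambda>y v. dir_deriv v f (g y)" "\<lambda>y w. dir_deriv w g y"
  proof (rule inverse_family.intro)
    fix y v w assume y: "y \<in> V"
    show "linear (\<lambda>v. dir_deriv v f (g y))" using bl[OF gW(2)[OF y]] bounded_linear.linear by blast
    show "norm v \<le> 2 * norm (dir_deriv v f (g y))" by (rule lower[OF gW(1)[OF y]])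
    have "dir_deriv w g y = Hilbert_Choice.inv (blinfun_apply (f' (g y))) w"
      using dir_deriv_eq[OF *(7)[OF y], of w] *(8)[OF y] by simp
    then show "dir_deriv (dir_deriv w g y) f (g y) = w"
      using f'[OF gW(2)[OF y], of "dir_deriv w g y"] surj_f_inv_f[OF bij_is_surj[OF *(9)[OF y]], of w] by simp
  qed (rule *(4))
  \<comment> \<open>If \<open>g\<close> has order \<open>m\<close>, so has the derivative of
    \<open>f\<close> taken at \<open>g y\<close>, hence also the inverse of that derivative, which
    is the derivative of \<open>g\<close>: one order is gained.\<close>
  have "differentiable_upto m V g" for m
  proof (induction m)
    case 0
    then show ?case using *(7) unfolding differentiable_upto_0 differentiable_def by blast
  next
    case (Suc m)
    have "differentiable_upto m V (\<lambda>y. dir_deriv v f (g y))" for v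
      by (rule differentiable_upto_compose[OF V finite_coordinates_euclidean Suc _ smooth_imp_upto[OF smooth_dir_deriv[OF W(3)]]])
        (use gW in blast)
    then have "differentiable_upto m V (\<lambda>y. dir_deriv w g y)" for w by (rule differentiable_upto_B)
    then show ?case using *(7) unfolding differentiable_upto_Suc differentiable_def by blast
  qed
  then have "smooth V g" by (simp add: smooth_iff_upto)
  moreover have "smooth U f" using smooth_subset[OF W(3)] *(2) W' by blast
  ultimately show thesis using that *(1,3,4,5,6) by blast
qed

section \<open>Partial maps, charts and local diffeomorphisms\<close>

lemma map_comp_assoc: "f \<circ>\<^sub>m (g \<circ>\<^sub>m h) = (f \<circ>\<^sub>m g) \<circ>\<^sub>m h"
  by (rule ext) (auto simp: map_comp_def split: option.splits)

lemma map_comp_Some_right [simp]: "f \<circ>\<^sub>m Some = f"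
  by (rule ext) (auto simp: map_comp_def)

lemma map_comp_Some_left [simp]: "Some \<circ>\<^sub>m f = f"
  by (rule ext) (auto simp: map_comp_def split: option.splits)

lemma map_comp_eq_Some: "(f \<circ>\<^sub>m g) x = Some y \<longleftrightarrow> (\<exists>z. g x = Some z \<and> f z = Some y)"
  by (auto simp: map_comp_def split: option.splits)

definition pinj :: "('x \<rightharpoonup> 'y) \<Rightarrow> bool" where
  "pinj f \<longleftrightarrow> (\<forall>x x' y. f x = Some y \<longrightarrow> f x' = Some y \<longrightarrow> x = x')"

lemma pinj_iff_inj_on: "pinj f \<longleftrightarrow> inj_on f (dom f)"
  unfolding pinj_def inj_on_def dom_def by force

text \<open>Removes the \<open>THE\<close> from \<open>pinv\<close>: the inverse has the converse
  graph. Identities between partial maps then become first-order statements about graphs.\<close>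

lemma pinv_eq_Some:
  assumes p: "pinj f" shows "pinv f y = Some x \<longleftrightarrow> f x = Some y"
proof
  assume "f x = Some y"
  then have "(THE x. f x = Some y) = x" using p unfolding pinj_def by blast
  then show "pinv f y = Some x" using \<open>f x = Some y\<close> by (auto simp: pinv_def ran_def)
next
  assume "pinv f y = Some x"
  then obtain x' where x': "f x' = Some y" "x = (THE x. f x = Some y)" by (auto simp: pinv_def ran_def split: if_splits)
  moreover have "(THE x. f x = Some y) = x'" using p x'(1) unfolding pinj_def by blast
  ultimately show "f x = Some y" by simp
qed

lemma dom_pinv: "dom (pinv f) = ran f"
  unfolding pinv_def by (auto split: if_splits)

lemma pinj_pinv: "pinj f \<Longrightarrow> pinj (pinv f)"
  unfolding pinj_def[of "pinv f"] by (auto simp: pinv_eq_Some)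

lemma partial_eqI: "(\<And>x y. f x = Some y \<longleftrightarrow> g x = Some y) \<Longrightarrow> f = g"
  by (rule ext) (metis not_Some_eq)

lemma pinv_pinv: "pinj f \<Longrightarrow> pinv (pinv f) = f"
  by (rule partial_eqI) (simp add: pinv_eq_Some pinj_pinv)

lemma pinj_comp: "pinj f \<Longrightarrow> pinj g \<Longrightarrow> pinj (f \<circ>\<^sub>m g)"
  unfolding pinj_def map_comp_eq_Some by blast

lemma pinv_comp: "pinj f \<Longrightarrow> pinj g \<Longrightarrow> pinv (f \<circ>\<^sub>m g) = pinv g \<circ>\<^sub>m pinv f"
  by (rule partial_eqI) (auto simp: pinv_eq_Some pinj_comp map_comp_eq_Some)

lemma pinj_Some: "pinj Some" by (simp add: pinj_def)

lemma pinv_Some: "pinv Some = Some"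
  by (rule partial_eqI) (auto simp: pinv_eq_Some pinj_Some)

section \<open>Smooth partial maps and charts\<close>

lemma psmooth_iff: "psmooth f \<longleftrightarrow> open (dom f) \<and> (\<forall>x\<in>dom f. smooth_at (the \<circ> f) x)"
  unfolding psmooth_def using smooth_iff_smooth_at by blast

lemma dom_map_comp: "dom (f \<circ>\<^sub>m g) = {x \<in> dom g. the (g x) \<in> dom f}"
  by (auto simp: map_comp_def split: option.splits)

lemma psmooth_comp:
  fixes f :: "'y::euclidean_space \<rightharpoonup> 'z::real_normed_vector" and g :: "'x::real_normed_vector \<rightharpoonup> 'y"
  assumes "psmooth f" "psmooth g"
  shows "psmooth (f \<circ>\<^sub>m g)"
proof -
  have g: "open (dom g)" "smooth (dom g) (the \<circ> g)" and f: "open (dom f)" "smooth (dom f) (the \<circ> f)"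
    using assms unfolding psmooth_def by auto
  have eq: "dom (f \<circ>\<^sub>m g) = dom g \<inter> (the \<circ> g) -` dom f" by (auto simp: dom_map_comp)
  have o: "open (dom (f \<circ>\<^sub>m g))" unfolding eq by (rule open_inter_vimage_smooth[OF g(2,1) f(1)])
  have "smooth (dom (f \<circ>\<^sub>m g)) (\<lambda>x. (the \<circ> f) ((the \<circ> g) x))"
    by (rule smooth_compose[OF o _ smooth_subset[OF g(2)] f(2)]) (auto simp: eq)
  then have "smooth (dom (f \<circ>\<^sub>m g)) (the \<circ> (f \<circ>\<^sub>m g))"
    by (subst smooth_cong[OF o, where g = "\<lambda>x. (the \<circ> f) ((the \<circ> g) x)"]) (auto simp: map_comp_def split: option.splits)
  then show ?thesis using o unfolding psmooth_def by blast
qed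

lemma is_chart_pinj: "is_chart c \<Longrightarrow> pinj c"
  unfolding is_chart_def homeomorphism_def pinj_def by (metis comp_apply domI option.sel)

lemma is_chartI:
  assumes "pinj c" "open (dom c)" "open (ran c)" "continuous_on (dom c) (the \<circ> c)" "continuous_on (ran c) (the \<circ> pinv c)"
  shows "is_chart c"
proof -
  have 1: "\<exists>y. c x = Some y \<and> pinv c y = Some x" if "x \<in> dom c" for x using that pinv_eq_Some[OF assms(1)] by auto
  have 2: "\<exists>x. c x = Some y \<and> pinv c y = Some x" if "y \<in> ran c" for y using that pinv_eq_Some[OF assms(1)] by (auto simp: ran_def)
  have "(the \<circ> c) ` dom c = ran c" using 1 2 by (force simp: ran_def)
  moreover have "(the \<circ> pinv c) ` ran c = dom c" using 1 2 by (force simp: ran_def)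
  ultimately show ?thesis unfolding is_chart_def homeomorphism_def using assms 1 2 by fastforce
qed

locale manifold =
  fixes A :: "('a::{t2_space,second_countable_topology} \<rightharpoonup> 'e::euclidean_space) set"
  assumes smooth_manifold: "smooth_manifold A"
begin

lemma is_chart: "c \<in> A \<Longrightarrow> is_chart c"
  using smooth_manifold unfolding smooth_manifold_def by blast

lemma chart_pinj: "c \<in> A \<Longrightarrow> pinj c"
  using is_chart is_chart_pinj by blast

lemma chart_open: "c \<in> A \<Longrightarrow> open (dom c)" "c \<in> A \<Longrightarrow> open (ran c)"
  using is_chart unfolding is_chart_def by auto

lemma chart_continuous: "c \<in> A \<Longrightarrow> continuous_on (dom c) (the \<circ> c)" "c \<in> A \<Longrightarrow> continuous_on (ran c) (the \<circ> pinv c)"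
  using is_chart unfolding is_chart_def homeomorphism_def by auto

lemma pinv_chart: "c \<in> A \<Longrightarrow> pinv c y = Some x \<longleftrightarrow> c x = Some y"
  by (rule pinv_eq_Some[OF chart_pinj])

lemma chart_inverse: "c \<in> A \<Longrightarrow> c z = Some x \<Longrightarrow> pinv c x = Some z"
  by (simp add: pinv_chart)

lemma chart_exists: obtains c where "c \<in> A" "z \<in> dom c"
  using smooth_manifold unfolding smooth_manifold_def by blast

lemma chart_transition: "c \<in> A \<Longrightarrow> d \<in> A \<Longrightarrow> psmooth (d \<circ>\<^sub>m pinv c)"
  using smooth_manifold unfolding smooth_manifold_def compatible_def by blast

lemma chartI:
  "is_chart c \<Longrightarrow> (\<And>d. d \<in> A \<Longrightarrow> psmooth (d \<circ>\<^sub>m pinv c)) \<Longrightarrow> (\<And>d. d \<in> A \<Longrightarrow> psmooth (c \<circ>\<^sub>m pinv d)) \<Longrightarrow> c \<in> A"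
  using smooth_manifold unfolding smooth_manifold_def compatible_def by blast

text \<open>A chart must be a homeomorphism, whereas \<open>local_diffeos\<close> expresses
  continuity only through smoothness in charts. The sets \<open>W k\<close> cover the domain, and on
  each of them \<open>F\<close> factors through the homeomorphism \<open>k\<close>.\<close>

lemma continuous_if_in_charts:
  assumes "\<And>k. k \<in> A \<Longrightarrow> open (dom (F \<circ>\<^sub>m pinv k))"
  shows "open (dom F)"
    and "(\<And>k. k \<in> A \<Longrightarrow> continuous_on (dom (F \<circ>\<^sub>m pinv k)) (the \<circ> (F \<circ>\<^sub>m pinv k))) \<Longrightarrow> continuous_on (dom F) (the \<circ> F)"
proof -
  define W where "W k = dom k \<inter> (the \<circ> k) -` (dom (F \<circ>\<^sub>m pinv k))" for k :: "'a \<rightharpoonup> 'e"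
  have W: "open (W k)" if "k \<in> A" for k
    unfolding W_def by (rule continuous_open_preimage[OF chart_continuous(1)[OF that] chart_open(1)[OF that] assms[OF that]])
  have Wdom: "x \<in> W k \<Longrightarrow> x \<in> dom F \<and> (the \<circ> F) x = (the \<circ> (F \<circ>\<^sub>m pinv k)) ((the \<circ> k) x)" if "k \<in> A" for k x
  proof -
    assume "x \<in> W k"
    then obtain y where y: "k x = Some y" "y \<in> dom (F \<circ>\<^sub>m pinv k)" unfolding W_def by force
    then have "pinv k y = Some x" by (simp add: pinv_chart[OF that])
    then show "x \<in> dom F \<and> (the \<circ> F) x = (the \<circ> (F \<circ>\<^sub>m pinv k)) ((the \<circ> k) x)" using y by (auto simp: map_comp_def)
  qed
  have cover: "\<exists>k\<in>A. x \<in> W k" if "x \<in> dom F" for x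
  proof -
    obtain k where k: "k \<in> A" "x \<in> dom k" by (rule chart_exists)
    then obtain y where y: "k x = Some y" by auto
    then have "pinv k y = Some x" by (simp add: pinv_chart[OF k(1)])
    then show ?thesis using k y that by (intro bexI[of _ k]) (auto simp: W_def map_comp_def)
  qed
  have eq: "dom F = (\<Union>k\<in>A. W k)" using Wdom cover by blast
  show "open (dom F)" unfolding eq using W by blast
  show "continuous_on (dom F) (the \<circ> F)"
    if c: "\<And>k. k \<in> A \<Longrightarrow> continuous_on (dom (F \<circ>\<^sub>m pinv k)) (the \<circ> (F \<circ>\<^sub>m pinv k))"
    unfolding eq
  proof (rule continuous_on_open_UN)
    fix k assume k: "k \<in> A"
    have "continuous_on (W k) ((the \<circ> (F \<circ>\<^sub>m pinv k)) \<circ> (the \<circ> k))"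
      by (rule continuous_on_compose[OF continuous_on_subset[OF chart_continuous(1)[OF k]] continuous_on_subset[OF c[OF k]]])
        (auto simp: W_def)
    moreover have "continuous_on (W k) ((the \<circ> (F \<circ>\<^sub>m pinv k)) \<circ> (the \<circ> k)) \<longleftrightarrow> continuous_on (W k) (the \<circ> F)"
      by (rule continuous_on_cong[OF refl]) (use Wdom[OF k] in auto)
    ultimately show "continuous_on (W k) (the \<circ> F)" by blast
  qed (use W in auto)
qed

lemma continuous_if_into_charts:
  assumes "\<And>k. k \<in> A \<Longrightarrow> open (dom (k \<circ>\<^sub>m F))"
  shows "open (dom F)"
    and "(\<And>k. k \<in> A \<Longrightarrow> continuous_on (dom (k \<circ>\<^sub>m F)) (the \<circ> (k \<circ>\<^sub>m F))) \<Longrightarrow> continuous_on (dom F) (the \<circ> F)"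
proof -
  have eq: "dom F = (\<Union>k\<in>A. dom (k \<circ>\<^sub>m F))"
  proof (intro equalityI subsetI)
    fix x assume "x \<in> dom F"
    obtain k where "k \<in> A" "the (F x) \<in> dom k" by (rule chart_exists)
    then show "x \<in> (\<Union>k\<in>A. dom (k \<circ>\<^sub>m F))" using \<open>x \<in> dom F\<close> by (auto simp: dom_map_comp)
  qed (auto simp: dom_map_comp)
  show "open (dom F)" unfolding eq using assms by blast
  show "continuous_on (dom F) (the \<circ> F)"
    if c: "\<And>k. k \<in> A \<Longrightarrow> continuous_on (dom (k \<circ>\<^sub>m F)) (the \<circ> (k \<circ>\<^sub>m F))"
    unfolding eq
  proof (rule continuous_on_open_UN)
    fix k assume k: "k \<in> A"
    have in_ran: "(the \<circ> (k \<circ>\<^sub>m F)) x \<in> ran k \<and> (the \<circ> pinv k) ((the \<circ> (k \<circ>\<^sub>m F)) x) = (the \<circ> F) x" if "x \<in> dom (k \<circ>\<^sub>m F)" for x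
    proof -
      from that obtain y w where y: "F x = Some y" "k y = Some w" by (auto simp: map_comp_def split: option.splits)
      then have "pinv k w = Some y" by (simp add: pinv_chart[OF k])
      then show ?thesis using y by (auto simp: map_comp_def ran_def)
    qed
    have "continuous_on (dom (k \<circ>\<^sub>m F)) ((the \<circ> pinv k) \<circ> (the \<circ> (k \<circ>\<^sub>m F)))"
      by (rule continuous_on_compose[OF c[OF k] continuous_on_subset[OF chart_continuous(2)[OF k]]]) (use in_ran in auto)
    moreover have "continuous_on (dom (k \<circ>\<^sub>m F)) ((the \<circ> pinv k) \<circ> (the \<circ> (k \<circ>\<^sub>m F))) \<longleftrightarrow> continuous_on (dom (k \<circ>\<^sub>m F)) (the \<circ> F)"
      by (rule continuous_on_cong[OF refl]) (use in_ran in auto)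
    ultimately show "continuous_on (dom (k \<circ>\<^sub>m F)) (the \<circ> F)" by blast
  qed (use assms in auto)
qed

lemma psmooth_open: "psmooth f \<Longrightarrow> open (dom f)" and psmooth_continuous: "psmooth f \<Longrightarrow> continuous_on (dom f) (the \<circ> f)"
  unfolding psmooth_def using smooth_continuous_on by blast+

lemma open_dom_if_psmooth:
  assumes "\<And>c d. c \<in> A \<Longrightarrow> d \<in> A \<Longrightarrow> psmooth (d \<circ>\<^sub>m F \<circ>\<^sub>m pinv c)"
  shows "open (dom F)"
  by (intro continuous_if_in_charts(1) continuous_if_into_charts(1))
     (use assms psmooth_open in \<open>auto simp: map_comp_assoc\<close>)

lemma local_diffeosI:
  assumes "pinj \<phi>" "\<And>c d. c \<in> A \<Longrightarrow> d \<in> A \<Longrightarrow> psmooth (d \<circ>\<^sub>m \<phi> \<circ>\<^sub>m pinv c)"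
    "\<And>c d. c \<in> A \<Longrightarrow> d \<in> A \<Longrightarrow> psmooth (c \<circ>\<^sub>m pinv \<phi> \<circ>\<^sub>m pinv d)"
  shows "\<phi> \<in> local_diffeos A"
  unfolding local_diffeos_def
  using open_dom_if_psmooth[of \<phi>, OF assms(2)] open_dom_if_psmooth[of "pinv \<phi>", OF assms(3)] assms
  by (auto simp: dom_pinv pinj_iff_inj_on)

lemma local_diffeosD:
  assumes "\<phi> \<in> local_diffeos A"
  shows "pinj \<phi>" "open (dom \<phi>)" "open (ran \<phi>)"
    "c \<in> A \<Longrightarrow> d \<in> A \<Longrightarrow> psmooth (d \<circ>\<^sub>m \<phi> \<circ>\<^sub>m pinv c)" "c \<in> A \<Longrightarrow> d \<in> A \<Longrightarrow> psmooth (c \<circ>\<^sub>m pinv \<phi> \<circ>\<^sub>m pinv d)"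
  using assms unfolding local_diffeos_def pinj_iff_inj_on by auto

lemma local_diffeos_pinv: "\<phi> \<in> local_diffeos A \<Longrightarrow> pinv \<phi> \<in> local_diffeos A"
  by (rule local_diffeosI) (simp_all add: pinv_pinv pinj_pinv local_diffeosD)

lemma local_diffeos_Some: "Some \<in> local_diffeos A"
  by (rule local_diffeosI) (auto simp: pinj_Some pinv_Some chart_transition)

text \<open>This rests on the maximality of the atlas. It provides slice charts of image
  submanifolds as well as reparametrized slice charts.\<close>

lemma chart_comp_local_diffeo:
  assumes "c \<in> A" "\<phi> \<in> local_diffeos A"
  shows "c \<circ>\<^sub>m \<phi> \<in> A"
proof -
  note \<phi> = local_diffeosD[OF assms(2)] and c = chart_pinj[OF assms(1)]
  have inv: "pinv (c \<circ>\<^sub>m \<phi>) = pinv \<phi> \<circ>\<^sub>m pinv c" by (rule pinv_comp[OF c \<phi>(1)])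
  have 1: "psmooth (c \<circ>\<^sub>m \<phi> \<circ>\<^sub>m pinv k)" if "k \<in> A" for k by (rule \<phi>(4)[OF that assms(1)])
  have 2: "psmooth (k \<circ>\<^sub>m pinv (c \<circ>\<^sub>m \<phi>))" if "k \<in> A" for k
    unfolding inv map_comp_assoc by (rule \<phi>(5)[OF that assms(1)])
  show ?thesis
  proof (rule chartI[OF is_chartI])
    show "pinj (c \<circ>\<^sub>m \<phi>)" by (rule pinj_comp[OF c \<phi>(1)])
    show "open (dom (c \<circ>\<^sub>m \<phi>))" "continuous_on (dom (c \<circ>\<^sub>m \<phi>)) (the \<circ> (c \<circ>\<^sub>m \<phi>))"
      using continuous_if_in_charts[of "c \<circ>\<^sub>m \<phi>"] psmooth_open[OF 1] psmooth_continuous[OF 1] by auto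
    show "open (ran (c \<circ>\<^sub>m \<phi>))" "continuous_on (ran (c \<circ>\<^sub>m \<phi>)) (the \<circ> pinv (c \<circ>\<^sub>m \<phi>))"
      using continuous_if_into_charts[of "pinv (c \<circ>\<^sub>m \<phi>)"] psmooth_open[OF 2] psmooth_continuous[OF 2]
      by (auto simp: dom_pinv)
  qed (use 1 2 in auto)
qed

text \<open>A smooth coordinate change becomes a local diffeomorphism of the manifold, which
  \<open>chart_comp_local_diffeo\<close> can then absorb into a chart.\<close>

lemma local_diffeo_from_charts:
  assumes "c \<in> A" "d \<in> A" "pinj h" "psmooth h" "psmooth (pinv h)"
  shows "pinv d \<circ>\<^sub>m h \<circ>\<^sub>m c \<in> local_diffeos A"
proof (rule local_diffeosI)
  note i = chart_pinj[OF assms(1)] chart_pinj[OF assms(2)]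
  show "pinj (pinv d \<circ>\<^sub>m h \<circ>\<^sub>m c)" by (intro pinj_comp pinj_pinv i assms)
  have inv: "pinv (pinv d \<circ>\<^sub>m h \<circ>\<^sub>m c) = pinv c \<circ>\<^sub>m pinv h \<circ>\<^sub>m d"
    by (simp add: pinv_comp pinj_comp pinj_pinv i assms pinv_pinv map_comp_assoc)
  fix c' d' assume c': "c' \<in> A" and d': "d' \<in> A"
  have "psmooth ((d' \<circ>\<^sub>m pinv d) \<circ>\<^sub>m (h \<circ>\<^sub>m (c \<circ>\<^sub>m pinv c')))"
    by (intro psmooth_comp chart_transition assms c' d')
  then show "psmooth (d' \<circ>\<^sub>m (pinv d \<circ>\<^sub>m h \<circ>\<^sub>m c) \<circ>\<^sub>m pinv c')" by (simp add: map_comp_assoc)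
  have "psmooth ((c' \<circ>\<^sub>m pinv c) \<circ>\<^sub>m (pinv h \<circ>\<^sub>m (d \<circ>\<^sub>m pinv d')))"
    by (intro psmooth_comp chart_transition assms c' d')
  then show "psmooth (c' \<circ>\<^sub>m pinv (pinv d \<circ>\<^sub>m h \<circ>\<^sub>m c) \<circ>\<^sub>m pinv d')" by (simp add: map_comp_assoc inv)
qed

section \<open>Coordinate expressions and jets of local diffeomorphisms\<close>

lemma in_charts_eq: "c \<in> A \<Longrightarrow> c z = Some x \<Longrightarrow> \<phi> z = Some y \<Longrightarrow> in_charts c d \<phi> x = the (d y)"
  by (simp add: in_charts_def map_comp_def chart_inverse)

lemma smooth_at_in_charts:
  assumes "c \<in> A" "d \<in> A" "\<phi> \<in> local_diffeos A" "c z = Some x" "\<phi> z = Some y" "y \<in> dom d"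
  shows "smooth_at (in_charts c d \<phi>) x"
proof -
  have "x \<in> dom (d \<circ>\<^sub>m \<phi> \<circ>\<^sub>m pinv c)" using assms chart_inverse[OF assms(1,4)] by (auto simp: dom_map_comp map_comp_def)
  then have "smooth_at (the \<circ> (d \<circ>\<^sub>m \<phi> \<circ>\<^sub>m pinv c)) x"
    using local_diffeosD(4)[OF assms(3,1,2)] unfolding psmooth_iff by blast
  then show ?thesis by (simp add: in_charts_def comp_def)
qed

lemma eventually_in_charts:
  assumes "c \<in> A" "d \<in> A" "\<phi> \<in> local_diffeos A" "c z = Some x" "\<phi> z = Some y" "y \<in> dom d"
  shows "\<forall>\<^sub>F x' in nhds x. \<exists>z' y'. c z' = Some x' \<and> \<phi> z' = Some y' \<and> d y' = Some (in_charts c d \<phi> x')"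
proof -
  have "x \<in> dom (d \<circ>\<^sub>m \<phi> \<circ>\<^sub>m pinv c)" using assms chart_inverse[OF assms(1,4)] by (auto simp: dom_map_comp map_comp_def)
  then have "\<forall>\<^sub>F x' in nhds x. x' \<in> dom (d \<circ>\<^sub>m \<phi> \<circ>\<^sub>m pinv c)"
    using psmooth_open[OF local_diffeosD(4)[OF assms(3,1,2)]] by (rule eventually_nhds_in_open[rotated])
  then show ?thesis
  proof eventually_elim
    case (elim x')
    then obtain z' y' v where "c z' = Some x'" "\<phi> z' = Some y'" "d y' = Some v"
      by (auto simp: map_comp_eq_Some pinv_chart[OF assms(1)])
    then show ?case using in_charts_eq[of c z' x' \<phi> y' d] assms(1) by auto
  qed
qed

text \<open>Only an equality near \<open>x\<close>: the right-hand side passes through the chart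
  \<open>e\<close>, whose domain the intermediate point may leave farther away.\<close>

lemma in_charts_comp:
  assumes "c \<in> A" "e \<in> A" "d \<in> A" "\<psi> \<in> local_diffeos A" "\<phi> \<in> local_diffeos A"
    "c z = Some x" "\<phi> z = Some y" "\<psi> y = Some w" "y \<in> dom e" "w \<in> dom d"
  shows "\<forall>\<^sub>F x' in nhds x. in_charts c d (\<psi> \<circ>\<^sub>m \<phi>) x' = in_charts e d \<psi> (in_charts c e \<phi> x')"
proof -
  obtain u where u: "e y = Some u" using assms(9) by auto
  have "in_charts c e \<phi> x = u" using in_charts_eq[of c z x \<phi> y e] assms u by simp
  moreover have "isCont (in_charts c e \<phi>) x"
    by (rule smooth_at_isCont[OF smooth_at_in_charts[OF assms(1,2,5,6,7,9)]])
  ultimately have "\<forall>\<^sub>F x' in nhds x. \<exists>z' y'. e z' = Some (in_charts c e \<phi> x') \<and> \<psi> z' = Some y' \<and> d y' = Some (in_charts e d \<psi> (in_charts c e \<phi> x'))"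
    using eventually_compose_isCont[OF \<open>isCont _ _\<close>] eventually_in_charts[OF assms(2,3,4) u assms(8,10)] by auto
  with eventually_in_charts[OF assms(1,2,5,6,7,9)] show ?thesis
  proof eventually_elim
    case (elim x')
    then obtain z' y' z'' y'' where *: "c z' = Some x'" "\<phi> z' = Some y'" "e y' = Some (in_charts c e \<phi> x')"
      "e z'' = Some (in_charts c e \<phi> x')" "\<psi> z'' = Some y''" "d y'' = Some (in_charts e d \<psi> (in_charts c e \<phi> x'))"
      by blast
    have "z'' = y'" using chart_pinj[OF assms(2)] *(3,4) unfolding pinj_def by blast
    then have "(\<psi> \<circ>\<^sub>m \<phi>) z' = Some y''" using * by (simp add: map_comp_def)
    then show ?case using in_charts_eq[of c z' x' "\<psi> \<circ>\<^sub>m \<phi>" y'' d] assms(1) * by simp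
  qed
qed

lemma in_charts_Some_id:
  assumes "c \<in> A" "c z = Some x"
  shows "\<forall>\<^sub>F x' in nhds x. in_charts c c Some x' = x'"
  using eventually_in_charts[OF assms(1,1) local_diffeos_Some assms(2) refl domI[of c, OF assms(2)]]
  by eventually_elim auto

text \<open>Near \<open>x'\<close> either map in the new charts is its old expression between the
  transition maps \<open>T1\<close> and \<open>T2\<close>, which are common to both; the chain rule
  for jets does the rest.\<close>

lemma jets_agree_change_charts:
  assumes "c \<in> A" "d \<in> A" "c' \<in> A" "d' \<in> A" "\<phi> \<in> local_diffeos A" "\<psi> \<in> local_diffeos A"
    and z: "c z = Some x" "c' z = Some x'" "\<phi> z = Some y" "\<psi> z = Some y" "y \<in> dom d" "y \<in> dom d'"
    and "jets_agree n (in_charts c d \<phi>) (in_charts c d \<psi>) x"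
  shows "jets_agree n (in_charts c' d' \<phi>) (in_charts c' d' \<psi>) x'"
proof -
  define T1 where "T1 = in_charts c' c Some"
  define T2 where "T2 = in_charts d d' Some"
  have T1: "smooth_at T1 x'" "T1 x' = x"
    using smooth_at_in_charts[OF assms(3,1) local_diffeos_Some z(2)] in_charts_eq[of c' z x' Some z c] assms(3) z by (auto simp: T1_def)
  obtain u where u: "d y = Some u" using z(5) by auto
  have T2: "smooth_at T2 u" using smooth_at_in_charts[OF assms(2,4) local_diffeos_Some u _ z(6)] by (simp add: T2_def)
  have decompose: "\<forall>\<^sub>F v in nhds x'. T2 (in_charts c d \<theta> (T1 v)) = in_charts c' d' \<theta> v"
    and smooth: "smooth_at (\<lambda>v. in_charts c d \<theta> (T1 v)) x'" and val: "in_charts c d \<theta> (T1 x') = u"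
    if \<theta>: "\<theta> \<in> local_diffeos A" "\<theta> z = Some y" for \<theta>
  proof -
    have 1: "\<forall>\<^sub>F v in nhds x'. in_charts c' d \<theta> v = in_charts c d \<theta> (T1 v)"
      using in_charts_comp[OF assms(3,1,2) \<theta>(1) local_diffeos_Some z(2) _ \<theta>(2)] z by (auto simp: T1_def)
    have 2: "\<forall>\<^sub>F v in nhds x'. in_charts c' d' \<theta> v = T2 (in_charts c' d \<theta> v)"
      using in_charts_comp[OF assms(3,2,4) local_diffeos_Some \<theta>(1) z(2) \<theta>(2)] z by (auto simp: T2_def)
    show "\<forall>\<^sub>F v in nhds x'. T2 (in_charts c d \<theta> (T1 v)) = in_charts c' d' \<theta> v"
      using 1 2 by eventually_elim simp
    show "in_charts c d \<theta> (T1 x') = u" using in_charts_eq[of c z x \<theta> y d] assms(1) z(1) \<theta>(2) u T1(2) by simp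
    show "smooth_at (\<lambda>v. in_charts c d \<theta> (T1 v)) x'"
      by (rule smooth_at_compose[OF T1(1)]) (use smooth_at_in_charts[OF assms(1,2) \<theta>(1) z(1) \<theta>(2) z(5)] T1(2) in simp)
  qed
  have "jets_agree n (\<lambda>v. in_charts c d \<phi> (T1 v)) (\<lambda>v. in_charts c d \<psi> (T1 v)) x'"
    by (rule jets_agree_compose[where f = T1 and f' = T1, OF jets_agree_refl _ T1(1) T1(1)])
      (use assms(13) smooth_at_in_charts[OF assms(1,2,5) z(1) z(3,5)] smooth_at_in_charts[OF assms(1,2,6) z(1) z(4,5)] T1(2) in simp_all)
  then have "jets_agree n (\<lambda>v. T2 (in_charts c d \<phi> (T1 v))) (\<lambda>v. T2 (in_charts c d \<psi> (T1 v))) x'"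
    by (rule jets_agree_compose[where g = T2 and g' = T2, OF _ jets_agree_refl])
      (use T2 smooth[OF assms(5) z(3)] smooth[OF assms(6) z(4)] val[OF assms(5) z(3)] in simp_all)
  then show ?thesis
    using jets_agree_cong_ev[OF decompose[OF assms(5) z(3)]] jets_agree_cong_ev[OF decompose[OF assms(6) z(4)]]
    by (meson jets_agree_sym jets_agree_trans)
qed

text \<open>\<open>same_jet\<close> speaks of all charts around source and target; the change of
  charts reduces it to one pair.\<close>

lemma same_jetI:
  assumes "c \<in> A" "d \<in> A" "\<phi> \<in> local_diffeos A" "\<psi> \<in> local_diffeos A"
    and z: "c z = Some x" "\<phi> z = Some y" "\<psi> z = Some y" "y \<in> dom d"
    and "jets_agree n (in_charts c d \<phi>) (in_charts c d \<psi>) x"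
  shows "same_jet A n z \<phi> \<psi>"
  unfolding same_jet_def
proof (intro conjI ballI impI)
  show "\<phi> z = \<psi> z" using z by simp
  fix c' d' bs assume *: "c' \<in> A" "d' \<in> A" "z \<in> dom c' \<and> the (\<phi> z) \<in> dom d'" and bs: "bs \<in> (indices n :: 'e list set)"
  then obtain x' where x': "c' z = Some x'" by auto
  have "jets_agree n (in_charts c' d' \<phi>) (in_charts c' d' \<psi>) x'"
    using jets_agree_change_charts[OF assms(1,2) *(1,2) assms(3,4) z(1) x' z(2,3,4) _ assms(9)] * z(2) by auto
  then show "iter_deriv bs (in_charts c' d' \<phi>) (the (c' z)) = iter_deriv bs (in_charts c' d' \<psi>) (the (c' z))"
    using bs x' unfolding jets_agree_def indices_def by auto
qed

lemma same_jetD: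
  assumes "same_jet A n z \<phi> \<psi>" "c \<in> A" "d \<in> A" "\<phi> \<in> local_diffeos A" "\<psi> \<in> local_diffeos A"
    and z: "c z = Some x" "\<phi> z = Some y" "y \<in> dom d"
  shows "\<psi> z = Some y" "jets_agree n (in_charts c d \<phi>) (in_charts c d \<psi>) x"
proof -
  show y: "\<psi> z = Some y" using assms(1) z unfolding same_jet_def by simp
  show "jets_agree n (in_charts c d \<phi>) (in_charts c d \<psi>) x"
  proof (rule jets_agree_Basis)
    fix bs assume "bs \<in> (indices n :: 'e list set)"
    then show "iter_deriv bs (in_charts c d \<phi>) x = iter_deriv bs (in_charts c d \<psi>) x"
      using assms(1,2,3) z unfolding same_jet_def by force
  qed (use smooth_at_in_charts[OF assms(2,3) _ z(1) _ z(3)] assms(4,5) z(2) y in auto)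
qed

lemma same_jet_refl: "same_jet A n z \<phi> \<phi>"
  unfolding same_jet_def by simp

lemma same_jet_sym: "same_jet A n z \<phi> \<psi> \<Longrightarrow> same_jet A n z \<psi> \<phi>"
  unfolding same_jet_def by simp

lemma same_jet_trans: "same_jet A n z \<phi> \<psi> \<Longrightarrow> same_jet A n z \<psi> \<theta> \<Longrightarrow> same_jet A n z \<phi> \<theta>"
  unfolding same_jet_def by simp

lemma jet_eq_iff:
  assumes "\<phi> \<in> local_diffeos A" "z \<in> dom \<phi>"
  shows "jet A n \<phi> z = jet A n \<psi> z \<longleftrightarrow> same_jet A n z \<phi> \<psi>"
proof
  assume "jet A n \<phi> z = jet A n \<psi> z"
  moreover have "\<phi> \<in> snd (jet A n \<phi> z)" using assms same_jet_refl by (simp add: jet_def)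
  ultimately have "\<phi> \<in> snd (jet A n \<psi> z)" by simp
  then have "same_jet A n z \<psi> \<phi>" by (simp add: jet_def)
  then show "same_jet A n z \<phi> \<psi>" by (rule same_jet_sym)
next
  assume s: "same_jet A n z \<phi> \<psi>"
  have "same_jet A n z \<phi> \<theta> \<longleftrightarrow> same_jet A n z \<psi> \<theta>" for \<theta> using s same_jet_trans same_jet_sym by blast
  then show "jet A n \<phi> z = jet A n \<psi> z" by (simp add: jet_def)
qed

lemma jet_rep:
  assumes "\<phi> \<in> local_diffeos A" "z \<in> dom \<phi>"
  shows "jet_rep (jet A n \<phi> z) \<in> local_diffeos A" "z \<in> dom (jet_rep (jet A n \<phi> z))"
    "same_jet A n z \<phi> (jet_rep (jet A n \<phi> z))"
proof -
  have "\<phi> \<in> snd (jet A n \<phi> z)" using assms same_jet_refl by (simp add: jet_def)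
  then have "jet_rep (jet A n \<phi> z) \<in> snd (jet A n \<phi> z)" unfolding jet_rep_def by (rule someI[where P = "\<lambda>\<phi>'. \<phi>' \<in> snd (jet A n \<phi> z)"])
  then show "jet_rep (jet A n \<phi> z) \<in> local_diffeos A" "z \<in> dom (jet_rep (jet A n \<phi> z))"
    "same_jet A n z \<phi> (jet_rep (jet A n \<phi> z))" by (auto simp: jet_def)
qed

lemma jet_source_jet: "jet_source (jet A n \<phi> z) = z"
  by (simp add: jet_source_def jet_def)

lemma jet_target_jet: "\<phi> \<in> local_diffeos A \<Longrightarrow> z \<in> dom \<phi> \<Longrightarrow> jet_target (jet A n \<phi> z) = the (\<phi> z)"
  using jet_rep(3)[of \<phi> z n] by (simp add: jet_target_def jet_source_jet same_jet_def)

end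

section \<open>Contact of submanifolds\<close>

text \<open>Any linear retraction onto \<open>L\<close> serves. Composing with it extends a
  parametrization defined along \<open>L\<close> to a map on the whole coordinate space, to which
  \<open>jets_agree\<close> and its chain rule apply.\<close>

definition projection :: "'e::euclidean_space set \<Rightarrow> 'e \<Rightarrow> 'e" where
  "projection L = (SOME f. bounded_linear f \<and> range f \<subseteq> L \<and> (\<forall>x\<in>L. f x = x))"

lemma projection:
  assumes "subspace L"
  shows "bounded_linear (projection L)" "projection L x \<in> L" "x \<in> L \<Longrightarrow> projection L x = x"
proof -
  obtain g where "range g \<subseteq> L" "linear g" "\<forall>v\<in>L. g (id v) = v"
    using linear_exists_left_inverse_on[OF linear_id assms, of] by (auto simp: inj_on_id)
  then have "\<exists>f. bounded_linear f \<and> range f \<subseteq> L \<and> (\<forall>x\<in>L. f x = x)"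
    using linear_conv_bounded_linear by (intro exI[of _ g]) auto
  from someI_ex[OF this] show "bounded_linear (projection L)" "projection L x \<in> L" "x \<in> L \<Longrightarrow> projection L x = x"
    unfolding projection_def[symmetric] by auto
qed

text \<open>Differentiating after the retraction in direction \<open>v\<close> is differentiating in
  direction \<open>projection L v\<close>, and these directions exhaust \<open>L\<close>.\<close>

lemma jets_agree_along_subspace:
  assumes L: "subspace L" "a \<in> L" and s: "smooth_at f a" "smooth_at g a"
  shows "jets_agree n (\<lambda>x. f (projection L x)) (\<lambda>x. g (projection L x)) a \<longleftrightarrow>
    (\<forall>vs. set vs \<subseteq> L \<and> length vs \<le> n \<longrightarrow> iter_deriv vs f a = iter_deriv vs g a)"
proof -
  note p = projection[OF L(1)]
  have pa: "projection L a = a" using p(3) L(2) by simp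
  have eq: "iter_deriv vs (\<lambda>x. h (projection L x)) a = iter_deriv (map (projection L) vs) h a"
    if "smooth_at h a" for vs and h :: "'a \<Rightarrow> 'b"
    using iter_deriv_precompose_linear[OF p(1), of h a vs] that pa by simp
  have "map (projection L) vs = vs" if "set vs \<subseteq> L" for vs using that p(3) by (induction vs) auto
  moreover have "set (map (projection L) vs) \<subseteq> L" for vs using p(2) by auto
  ultimately show ?thesis unfolding jets_agree_def eq[OF s(1)] eq[OF s(2)]
    by (metis length_map)
qed

context manifold
begin

lemma slice_chartD: "slice_chart A L S c \<Longrightarrow> c \<in> A" "slice_chart A L S c \<Longrightarrow> c x = Some y \<Longrightarrow> x \<in> S \<longleftrightarrow> y \<in> L"
  unfolding slice_chart_def by force+

lemma psmooth_Some: "psmooth (Some :: 'e \<rightharpoonup> 'e)"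
  unfolding psmooth_def using smooth_bounded_linear[OF bounded_linear_ident open_UNIV] by (simp add: comp_def dom_def)

lemma contactD:
  assumes "contact A p n z S T"
  obtains L c d a where "subspace L" "dim L = p" "slice_chart A L S c" "slice_chart A L T d" "c z = Some a" "d z = Some a" "a \<in> L"
    "\<And>k. k \<in> A \<Longrightarrow> z \<in> dom k \<Longrightarrow>
       jets_agree n (\<lambda>x. in_charts c k Some (projection L x)) (\<lambda>x. in_charts d k Some (projection L x)) a"
proof -
  obtain L c d where *: "subspace L" "dim L = p" "slice_chart A L S c" "slice_chart A L T d" "z \<in> dom c" "z \<in> dom d" "c z = d z" "z \<in> S"
    and ag: "\<And>k vs. k \<in> A \<Longrightarrow> z \<in> dom k \<Longrightarrow> set vs \<subseteq> L \<Longrightarrow> length vs \<le> n \<Longrightarrow>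
              iter_deriv vs (in_charts c k Some) (the (c z)) = iter_deriv vs (in_charts d k Some) (the (d z))"
    using assms unfolding contact_def by blast
  obtain a where a: "c z = Some a" using *(5) by auto
  then have a: "c z = Some a" "d z = Some a" using *(7) by auto
  have aL: "a \<in> L" using slice_chartD(2)[OF *(3) a(1)] *(8) by simp
  show thesis
  proof (rule that[OF *(1-4) a aL])
    fix k assume k: "k \<in> A" "z \<in> dom k"
    show "jets_agree n (\<lambda>x. in_charts c k Some (projection L x)) (\<lambda>x. in_charts d k Some (projection L x)) a"
      using ag[OF k] a smooth_at_in_charts[OF slice_chartD(1)[OF *(3)] k(1) local_diffeos_Some a(1) refl k(2)]
        smooth_at_in_charts[OF slice_chartD(1)[OF *(4)] k(1) local_diffeos_Some a(2) refl k(2)]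
      by (subst jets_agree_along_subspace[OF *(1) aL]) auto
  qed
qed

lemma smooth_at_in_charts_projection:
  assumes "subspace L" "a \<in> L" "c \<in> A" "k \<in> A" "\<phi> \<in> local_diffeos A" "c z = Some a" "\<phi> z = Some y" "y \<in> dom k"
  shows "smooth_at (\<lambda>x. in_charts c k \<phi> (projection L x)) a"
  using smooth_at_precompose_linear[OF projection(1)[OF assms(1)], of "in_charts c k \<phi>" a]
    smooth_at_in_charts[OF assms(3-)] projection(3)[OF assms(1,2)] by simp

lemma eventually_projection:
  assumes "subspace L" "a \<in> L" "\<forall>\<^sub>F x in nhds a. Q x"
  shows "\<forall>\<^sub>F x in nhds a. Q (projection L x)"
  using eventually_compose_isCont[where f = "projection L" and a = a and P = Q] projection[OF assms(1)] assms(2,3)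
    linear_continuous_at[OF projection(1)[OF assms(1)]] by simp

text \<open>\<open>contact\<close> speaks of all charts \<open>k\<close> around \<open>z\<close>.
  Composing both parametrizations with the same transition map shows that one of them
  decides.\<close>

lemma contactI:
  assumes L: "subspace L" "dim L = p" and c: "slice_chart A L S c" and d: "slice_chart A L T d"
    and a: "c z = Some a" "d z = Some a" "a \<in> L"
    and k: "k \<in> A" "z \<in> dom k"
    and agree: "jets_agree n (\<lambda>x. in_charts c k Some (projection L x)) (\<lambda>x. in_charts d k Some (projection L x)) a"
  shows "contact A p n z S T"
proof -
  note cA = slice_chartD(1)[OF c] and dA = slice_chartD(1)[OF d]
  have zS: "z \<in> S" "z \<in> T" using slice_chartD(2)[OF c a(1)] slice_chartD(2)[OF d a(2)] a(3) by auto
  have "\<forall>k'\<in>A. z \<in> dom k' \<longrightarrow> (\<forall>vs. set vs \<subseteq> L \<and> length vs \<le> n \<longrightarrow>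
        iter_deriv vs (in_charts c k' Some) (the (c z)) = iter_deriv vs (in_charts d k' Some) (the (d z)))"
  proof (intro ballI impI)
    fix k' assume k': "k' \<in> A" "z \<in> dom k'"
    obtain u where u: "k z = Some u" using k(2) by auto
    have T: "smooth_at (in_charts k k' Some) u"
      by (rule smooth_at_in_charts[OF k(1) k'(1) local_diffeos_Some u refl k'(2)])
    have dec: "\<forall>\<^sub>F x in nhds a. in_charts e k' Some (projection L x) = in_charts k k' Some (in_charts e k Some (projection L x))"
      if "e \<in> A" "e z = Some a" for e
      using in_charts_comp[OF that(1) k(1) k'(1) local_diffeos_Some local_diffeos_Some that(2) refl refl k(2) k'(2)]
      by (intro eventually_projection L a) simp
    have val: "in_charts e k Some (projection L a) = u" if "e \<in> A" "e z = Some a" for e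
      using in_charts_eq[of e z a Some z k] that u projection(3)[OF L(1) a(3)] by simp
    note sm = smooth_at_in_charts_projection[OF L(1) a(3) _ k(1) local_diffeos_Some _ refl k(2)]
    have "jets_agree n (\<lambda>x. in_charts k k' Some (in_charts c k Some (projection L x)))
            (\<lambda>x. in_charts k k' Some (in_charts d k Some (projection L x))) a"
      by (rule jets_agree_compose[where g = "in_charts k k' Some" and g' = "in_charts k k' Some", OF agree jets_agree_refl sm[OF cA a(1)] sm[OF dA a(2)]])
        (use T val[OF cA a(1)] in simp_all)
    then have "jets_agree n (\<lambda>x. in_charts c k' Some (projection L x)) (\<lambda>x. in_charts d k' Some (projection L x)) a"
      using jets_agree_cong_ev[OF dec[OF cA a(1)]] jets_agree_cong_ev[OF dec[OF dA a(2)]]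
      by (meson jets_agree_sym jets_agree_trans)
    then show "\<forall>vs. set vs \<subseteq> L \<and> length vs \<le> n \<longrightarrow>
        iter_deriv vs (in_charts c k' Some) (the (c z)) = iter_deriv vs (in_charts d k' Some) (the (d z))"
      using jets_agree_along_subspace[OF L(1) a(3) smooth_at_in_charts[OF cA k'(1) local_diffeos_Some a(1) refl k'(2)]
          smooth_at_in_charts[OF dA k'(1) local_diffeos_Some a(2) refl k'(2)], of n] a by simp
  qed
  then show ?thesis unfolding contact_def using zS L c d a domI[of c z] domI[of d z] by metis
qed

lemma contact_refl: "submanifold A p S \<Longrightarrow> z \<in> S \<Longrightarrow> contact A p n z S S"
  unfolding submanifold_def contact_def by blast

lemma contact_sym: "contact A p n z S T \<Longrightarrow> contact A p n z T S"
  unfolding contact_def by metis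

lemma contact_mono: "contact A p n z S T \<Longrightarrow> m \<le> n \<Longrightarrow> contact A p m z S T"
  unfolding contact_def using le_trans[of _ m n] by blast

text \<open>The slice charts \<open>d\<close> and \<open>d'\<close> of the middle submanifold may differ; the chart \<open>e\<close> of \<open>R\<close> is corrected by
  the change of coordinates \<open>d \<circ> d'\<inverse>\<close>, which maps the slice \<open>L'\<close> to \<open>L\<close>.\<close>

lemma contact_trans:
  assumes "contact A p n z S T" "contact A p n z T R"
  shows "contact A p n z S R"
proof -
  obtain L c d a where L: "subspace L" "dim L = p" and c: "slice_chart A L S c" and d: "slice_chart A L T d"
    and a: "c z = Some a" "d z = Some a" "a \<in> L"
    and ag1: "\<And>k. k \<in> A \<Longrightarrow> z \<in> dom k \<Longrightarrow>
       jets_agree n (\<lambda>x. in_charts c k Some (projection L x)) (\<lambda>x. in_charts d k Some (projection L x)) a"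
    using contactD[OF assms(1)] by metis
  obtain L' d' e a' where L': "subspace L'" "dim L' = p" and d': "slice_chart A L' T d'" and e: "slice_chart A L' R e"
    and a': "d' z = Some a'" "e z = Some a'" "a' \<in> L'"
    and ag2: "\<And>k. k \<in> A \<Longrightarrow> z \<in> dom k \<Longrightarrow>
       jets_agree n (\<lambda>x. in_charts d' k Some (projection L' x)) (\<lambda>x. in_charts e k Some (projection L' x)) a'"
    using contactD[OF assms(2)] by metis
  note cA = slice_chartD(1)[OF c] and dA = slice_chartD(1)[OF d] and d'A = slice_chartD(1)[OF d'] and eA = slice_chartD(1)[OF e]
  define e' where "e' = d \<circ>\<^sub>m (pinv d' \<circ>\<^sub>m Some \<circ>\<^sub>m e)"
  have e'A: "e' \<in> A" unfolding e'_def
    by (intro chart_comp_local_diffeo dA local_diffeo_from_charts eA d'A)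
      (simp_all add: pinj_Some pinv_Some psmooth_Some)
  have e': "e' x = Some v \<longleftrightarrow> (\<exists>u y. e x = Some u \<and> d' y = Some u \<and> d y = Some v)" for x v
    by (auto simp: e'_def map_comp_eq_Some pinv_chart[OF d'A])
  have e'z: "e' z = Some a" using e' a a' by blast
  have e'_slice: "slice_chart A L R e'"
    unfolding slice_chart_def
  proof (intro conjI ballI e'A)
    fix x assume "x \<in> dom e'"
    then obtain v u y where *: "e' x = Some v" "e x = Some u" "d' y = Some u" "d y = Some v" using e' by blast
    show "x \<in> R \<longleftrightarrow> the (e' x) \<in> L"
      using slice_chartD(2)[OF e *(2)] slice_chartD(2)[OF d' *(3)] slice_chartD(2)[OF d *(4)] *(1) by simp
  qed
  obtain k where k: "k \<in> A" "z \<in> dom k" by (rule chart_exists)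
  \<comment> \<open>The change of parameter from \<open>L\<close> to \<open>L'\<close>. Near
    \<open>a\<close> the parametrizations over \<open>L\<close> are those over \<open>L'\<close>
    precomposed with \<open>t\<close>, so agreement over \<open>L'\<close> carries over.\<close>
  define t where "t = in_charts d d' Some"
  have zd': "z \<in> dom d'" using a' by auto
  have t: "smooth_at (\<lambda>x. t (projection L x)) a" unfolding t_def
    by (rule smooth_at_in_charts_projection[OF L(1) a(3) dA d'A local_diffeos_Some a(2) refl zd'])
  have ta: "t (projection L a) = a'"
    using in_charts_eq[of d z a Some z d'] dA a a' projection(3)[OF L(1) a(3)] by (simp add: t_def)
  have "\<forall>\<^sub>F x in nhds a. \<exists>y y'. d y = Some x \<and> Some y = Some y' \<and> d' y' = Some (t x)"
    unfolding t_def by (rule eventually_in_charts[OF dA d'A local_diffeos_Some a(2) refl zd'])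
  then have ev: "\<forall>\<^sub>F x in nhds a. \<exists>y. d y = Some (projection L x) \<and> d' y = Some (t (projection L x))"
    by (intro eventually_projection L a) simp
  have dec1: "\<forall>\<^sub>F x in nhds a. in_charts d k Some (projection L x) = in_charts d' k Some (projection L' (t (projection L x)))"
    using ev
  proof eventually_elim
    case (elim x)
    then obtain y where y: "d y = Some (projection L x)" "d' y = Some (t (projection L x))" by blast
    have "t (projection L x) \<in> L'" using slice_chartD(2)[OF d y(1)] slice_chartD(2)[OF d' y(2)] projection(2)[OF L(1)] by simp
    then show ?case using in_charts_eq[of d y _ Some y k] in_charts_eq[of d' y _ Some y k] y dA d'A projection(3)[OF L'(1)] by simp
  qed
  have dec2: "\<forall>\<^sub>F x in nhds a. in_charts e' k Some (projection L x) = in_charts e k Some (projection L' (t (projection L x)))"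
    using ev
  proof eventually_elim
    case (elim x)
    then obtain y where y: "d y = Some (projection L x)" "d' y = Some (t (projection L x))" by blast
    have "t (projection L x) \<in> L'" using slice_chartD(2)[OF d y(1)] slice_chartD(2)[OF d' y(2)] projection(2)[OF L(1)] by simp
    moreover have "pinv e' (projection L x) = pinv e (t (projection L x))"
    proof -
      have "e' = d \<circ>\<^sub>m (pinv d' \<circ>\<^sub>m e)" by (simp add: e'_def)
      then have "pinv e' = pinv e \<circ>\<^sub>m d' \<circ>\<^sub>m pinv d"
        by (simp add: pinv_comp pinj_comp pinj_pinv chart_pinj dA d'A eA pinv_pinv map_comp_assoc)
      then show ?thesis using y chart_inverse[OF dA y(1)] by (simp add: map_comp_def)
    qed
    ultimately show ?case using projection(3)[OF L'(1)] by (simp add: in_charts_def map_comp_def)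
  qed
  have "jets_agree n (\<lambda>x. in_charts d' k Some (projection L' (t (projection L x)))) (\<lambda>x. in_charts e k Some (projection L' (t (projection L x)))) a"
    by (rule jets_agree_compose[where g = "\<lambda>x. in_charts d' k Some (projection L' x)" and g' = "\<lambda>x. in_charts e k Some (projection L' x)",
          OF jets_agree_refl _ t t])
      (use ag2[OF k] ta smooth_at_in_charts_projection[OF L'(1) a'(3) d'A k(1) local_diffeos_Some a'(1) refl k(2)]
        smooth_at_in_charts_projection[OF L'(1) a'(3) eA k(1) local_diffeos_Some a'(2) refl k(2)] in simp_all)
  then have "jets_agree n (\<lambda>x. in_charts d k Some (projection L x)) (\<lambda>x. in_charts e' k Some (projection L x)) a"
    using jets_agree_cong_ev[OF dec1] jets_agree_cong_ev[OF dec2] by (meson jets_agree_sym jets_agree_trans)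
  from contactI[OF L c e'_slice a(1) e'z a(3) k jets_agree_trans[OF ag1[OF k] this]] show ?thesis .
qed

lemma slice_chart_image:
  assumes "slice_chart A L S c" "\<phi> \<in> local_diffeos A"
  shows "slice_chart A L (ran (\<phi> |` S)) (c \<circ>\<^sub>m pinv \<phi>)"
  unfolding slice_chart_def
proof (intro conjI ballI)
  note i = local_diffeosD(1)[OF assms(2)]
  show "c \<circ>\<^sub>m pinv \<phi> \<in> A" by (intro chart_comp_local_diffeo local_diffeos_pinv assms slice_chartD(1)[OF assms(1)])
  fix y assume "y \<in> dom (c \<circ>\<^sub>m pinv \<phi>)"
  then obtain x v where x: "\<phi> x = Some y" "c x = Some v" "(c \<circ>\<^sub>m pinv \<phi>) y = Some v"
    by (auto simp: map_comp_eq_Some pinv_eq_Some[OF i])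
  have "y \<in> ran (\<phi> |` S) \<longleftrightarrow> x \<in> S"
    using x(1) i unfolding ran_def restrict_map_def pinj_def by (auto split: if_splits)
  then show "y \<in> ran (\<phi> |` S) \<longleftrightarrow> the ((c \<circ>\<^sub>m pinv \<phi>) y) \<in> L"
    using slice_chartD(2)[OF assms(1) x(2)] x(3) by simp
qed

text \<open>The inverse of the transported chart is \<phi> after the inverse of \<open>c\<close>:
  images of parametrizations are the parametrizations of the image.\<close>

lemma in_charts_image_chart:
  assumes "c \<in> A" "\<phi> \<in> local_diffeos A"
  shows "in_charts (c \<circ>\<^sub>m pinv \<phi>) k Some = in_charts c k \<phi>"
  using pinv_comp[OF chart_pinj[OF assms(1)] pinj_pinv[OF local_diffeosD(1)[OF assms(2)]]] pinv_pinv[OF local_diffeosD(1)[OF assms(2)]]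
  unfolding in_charts_def by (simp add: map_comp_assoc)

text \<open>The chain rule for jets makes the action independent of the representatives of both
  jets, which in \<open>jet_action\<close> are picked by choice.\<close>

lemma contact_image:
  assumes \<phi>: "\<phi> \<in> local_diffeos A" "\<psi> \<in> local_diffeos A" "same_jet A n z \<phi> \<psi>" "\<phi> z = Some y" and "contact A p n z S T"
  shows "contact A p n y (ran (\<phi> |` S)) (ran (\<psi> |` T))"
proof -
  obtain L c d a where L: "subspace L" "dim L = p" and c: "slice_chart A L S c" and d: "slice_chart A L T d"
    and a: "c z = Some a" "d z = Some a" "a \<in> L"
    and ag1: "\<And>k. k \<in> A \<Longrightarrow> z \<in> dom k \<Longrightarrow>
       jets_agree n (\<lambda>x. in_charts c k Some (projection L x)) (\<lambda>x. in_charts d k Some (projection L x)) a"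
    using contactD[OF assms(5)] by metis
  note cA = slice_chartD(1)[OF c] and dA = slice_chartD(1)[OF d]
  obtain k where k: "k \<in> A" "y \<in> dom k" by (rule chart_exists)
  obtain k0 where k0: "k0 \<in> A" "z \<in> dom k0" by (rule chart_exists)
  obtain u where u: "k0 z = Some u" using k0(2) by auto
  from same_jetD[OF \<phi>(3) k0(1) k(1) \<phi>(1,2) u \<phi>(4) k(2)]
  have \<psi>: "\<psi> z = Some y" "jets_agree n (in_charts k0 k \<phi>) (in_charts k0 k \<psi>) u" by auto
  have dec: "\<forall>\<^sub>F x in nhds a. in_charts e k \<theta> (projection L x) = in_charts k0 k \<theta> (in_charts e k0 Some (projection L x))"
    if "e \<in> A" "e z = Some a" "\<theta> \<in> local_diffeos A" "\<theta> z = Some y" for e \<theta>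
    using in_charts_comp[OF that(1) k0(1) k(1) that(3) local_diffeos_Some that(2) refl that(4) k0(2) k(2)]
    by (intro eventually_projection L a) simp
  have val: "in_charts e k0 Some (projection L a) = u" if "e \<in> A" "e z = Some a" for e
    using in_charts_eq[of e z a Some z k0] that u projection(3)[OF L(1) a(3)] by simp
  note sm = smooth_at_in_charts_projection[OF L(1) a(3) _ k0(1) local_diffeos_Some _ refl k0(2)]
  have "jets_agree n (\<lambda>x. in_charts k0 k \<phi> (in_charts c k0 Some (projection L x)))
            (\<lambda>x. in_charts k0 k \<psi> (in_charts d k0 Some (projection L x))) a"
    by (rule jets_agree_compose[where g = "in_charts k0 k \<phi>" and g' = "in_charts k0 k \<psi>", OF ag1[OF k0] _ sm[OF cA a(1)] sm[OF dA a(2)]])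
      (use \<psi>(2) smooth_at_in_charts[OF k0(1) k(1) \<phi>(1) u \<phi>(4) k(2)] smooth_at_in_charts[OF k0(1) k(1) \<phi>(2) u \<psi>(1) k(2)] val[OF cA a(1)] in simp_all)
  then have "jets_agree n (\<lambda>x. in_charts c k \<phi> (projection L x)) (\<lambda>x. in_charts d k \<psi> (projection L x)) a"
    using jets_agree_cong_ev[OF dec[OF cA a(1) \<phi>(1,4)]] jets_agree_cong_ev[OF dec[OF dA a(2) \<phi>(2) \<psi>(1)]]
    by (meson jets_agree_sym jets_agree_trans)
  then have "jets_agree n (\<lambda>x. in_charts (c \<circ>\<^sub>m pinv \<phi>) k Some (projection L x)) (\<lambda>x. in_charts (d \<circ>\<^sub>m pinv \<psi>) k Some (projection L x)) a"
    unfolding in_charts_image_chart[OF cA \<phi>(1)] in_charts_image_chart[OF dA \<phi>(2)] .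
  moreover have "(c \<circ>\<^sub>m pinv \<phi>) y = Some a" "(d \<circ>\<^sub>m pinv \<psi>) y = Some a"
    using a \<phi>(4) \<psi>(1) by (auto simp: map_comp_eq_Some pinv_eq_Some[OF local_diffeosD(1)[OF \<phi>(1)]] pinv_eq_Some[OF local_diffeosD(1)[OF \<phi>(2)]])
  ultimately show ?thesis
    using contactI[OF L slice_chart_image[OF c \<phi>(1)] slice_chart_image[OF d \<phi>(2)] _ _ a(3) k] by blast
qed

section \<open>Jets of submanifolds and the isotropy group\<close>

lemma sub_jet_eq_iff:
  assumes "submanifold A p T" "z \<in> T"
  shows "sub_jet A p n S z = sub_jet A p n T z \<longleftrightarrow> contact A p n z S T"
proof
  assume "sub_jet A p n S z = sub_jet A p n T z"
  moreover have "T \<in> snd (sub_jet A p n T z)" using assms contact_refl by (simp add: sub_jet_def)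
  ultimately have "T \<in> snd (sub_jet A p n S z)" by simp
  then show "contact A p n z S T" by (simp add: sub_jet_def)
next
  assume "contact A p n z S T"
  then have "contact A p n z S R \<longleftrightarrow> contact A p n z T R" for R using contact_trans contact_sym by blast
  then show "sub_jet A p n S z = sub_jet A p n T z" by (simp add: sub_jet_def)
qed

lemma sub_jet_rep:
  assumes "submanifold A p S" "z \<in> S"
  shows "submanifold A p (sub_jet_rep (sub_jet A p n S z))" "z \<in> sub_jet_rep (sub_jet A p n S z)"
    "contact A p n z S (sub_jet_rep (sub_jet A p n S z))"
proof -
  have "S \<in> snd (sub_jet A p n S z)" using assms contact_refl by (simp add: sub_jet_def)
  then have "sub_jet_rep (sub_jet A p n S z) \<in> snd (sub_jet A p n S z)" unfolding sub_jet_rep_def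
    by (rule someI[where P = "\<lambda>T. T \<in> snd (sub_jet A p n S z)"])
  then show "submanifold A p (sub_jet_rep (sub_jet A p n S z))" "z \<in> sub_jet_rep (sub_jet A p n S z)"
    "contact A p n z S (sub_jet_rep (sub_jet A p n S z))" by (auto simp: sub_jet_def)
qed

lemma sub_jet_base_sub_jet: "sub_jet_base (sub_jet A p n S z) = z"
  by (simp add: sub_jet_base_def sub_jet_def)

text \<open>The representative chosen in \<open>sub_jet_proj\<close> has contact of order
  \<open>n\<close> with \<open>S\<close>, hence also of order \<open>m\<close>.\<close>

lemma sub_jet_proj_sub_jet:
  assumes "submanifold A p S" "z \<in> S" "m \<le> n"
  shows "sub_jet_proj A p m (sub_jet A p n S z) = sub_jet A p m S z"
  using sub_jet_rep[OF assms(1,2), of n] contact_mono[OF _ assms(3)] assms(1,2)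
  by (simp add: sub_jet_proj_def sub_jet_base_sub_jet sub_jet_eq_iff contact_sym)

text \<open>Frees the isotropy group from chosen representatives: it is described by elements of
  \<open>G\<close> and one submanifold \<open>S\<close> with the given jet.\<close>

lemma isotropy_iff:
  assumes "G \<subseteq> local_diffeos A" "submanifold A p S" "z \<in> S"
  shows "g \<in> isotropy A G p n (sub_jet A p n S z) \<longleftrightarrow>
    (\<exists>\<phi>\<in>G. \<phi> z = Some z \<and> g = jet A n \<phi> z \<and> contact A p n z (ran (\<phi> |` S)) S)"
proof -
  define S' where "S' = sub_jet_rep (sub_jet A p n S z)"
  note S' = sub_jet_rep[OF assms(2,3), of n, folded S'_def]
  have *: "jet_action A p n (jet A n \<phi> z) (sub_jet A p n S z) = sub_jet A p n S z \<longleftrightarrow> contact A p n z (ran (\<phi> |` S)) S"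
    if \<phi>: "\<phi> \<in> local_diffeos A" "\<phi> z = Some z" for \<phi>
  proof -
    have zd: "z \<in> dom \<phi>" using \<phi>(2) by auto
    note r = jet_rep[OF \<phi>(1) zd, of n]
    have "jet_action A p n (jet A n \<phi> z) (sub_jet A p n S z) = sub_jet A p n (ran (jet_rep (jet A n \<phi> z) |` S')) z"
      using jet_target_jet[OF \<phi>(1) zd] \<phi>(2) by (simp add: jet_action_def S'_def)
    moreover have "contact A p n z (ran (\<phi> |` S)) (ran (jet_rep (jet A n \<phi> z) |` S'))"
      by (rule contact_image[OF \<phi>(1) r(1,3) \<phi>(2) S'(3)])
    ultimately show ?thesis using sub_jet_eq_iff[OF assms(2,3)] contact_trans contact_sym by metis
  qed
  show ?thesis
  proof
    assume g: "g \<in> isotropy A G p n (sub_jet A p n S z)"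
    then obtain \<phi> z' where \<phi>: "\<phi> \<in> G" "z' \<in> dom \<phi>" "g = jet A n \<phi> z'" unfolding isotropy_def jets_def by blast
    have "\<phi> \<in> local_diffeos A" using \<phi>(1) assms(1) by blast
    have z': "z' = z" using g \<phi>(3) by (simp add: isotropy_def sub_jet_base_sub_jet jet_source_jet)
    have "the (\<phi> z) = z" using g \<phi>(3) jet_target_jet[OF \<open>\<phi> \<in> local_diffeos A\<close> \<phi>(2)] z'
      by (simp add: isotropy_def sub_jet_base_sub_jet)
    then have "\<phi> z = Some z" using \<phi>(2) z' by auto
    then show "\<exists>\<phi>\<in>G. \<phi> z = Some z \<and> g = jet A n \<phi> z \<and> contact A p n z (ran (\<phi> |` S)) S"
      using g \<phi> z' *[OF \<open>\<phi> \<in> local_diffeos A\<close>] by (auto simp: isotropy_def)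
  next
    assume "\<exists>\<phi>\<in>G. \<phi> z = Some z \<and> g = jet A n \<phi> z \<and> contact A p n z (ran (\<phi> |` S)) S"
    then obtain \<phi> where \<phi>: "\<phi> \<in> G" "\<phi> z = Some z" "g = jet A n \<phi> z" "contact A p n z (ran (\<phi> |` S)) S" by blast
    have "\<phi> \<in> local_diffeos A" using \<phi>(1) assms(1) by blast
    moreover have "g \<in> jets A n G" using \<phi> unfolding jets_def by blast
    ultimately show "g \<in> isotropy A G p n (sub_jet A p n S z)"
      using \<phi> *[of \<phi>] jet_target_jet[of \<phi> z n] by (auto simp: isotropy_def sub_jet_base_sub_jet jet_source_jet)
  qed
qed

end

section \<open>Coordinates of jets\<close>

text \<open>The family \<open>E\<close> may repeat vectors; the coefficients are collected over its
  fibres to fit the set of vectors in \<open>finite_coordinates\<close>.\<close>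

lemma finite_coordinatesI:
  assumes "finite I" "\<And>i. i \<in> I \<Longrightarrow> bounded_linear (l i :: 'y::real_normed_vector \<Rightarrow> real)"
    "\<And>y. y \<in> S \<Longrightarrow> y = (\<Sum>i\<in>I. l i y *\<^sub>R E i)"
  shows "finite_coordinates S"
  unfolding finite_coordinates_def
proof (intro exI[of _ "E ` I"] exI[of _ "\<lambda>b y. \<Sum>i\<in>{i \<in> I. E i = b}. l i y"] conjI ballI)
  show "finite (E ` I)" using assms(1) by simp
  show "bounded_linear (\<lambda>y. \<Sum>i\<in>{i \<in> I. E i = b}. l i y)" for b
    using assms(2) by (intro bounded_linear_sum) auto
  fix y assume "y \<in> S"
  then have "y = (\<Sum>i\<in>I. l i y *\<^sub>R E i)" by (rule assms(3))
  also have "\<dots> = (\<Sum>b\<in>E ` I. \<Sum>i\<in>{i \<in> I. E i = b}. l i y *\<^sub>R E i)" by (rule sum.image_gen[OF assms(1)])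
  also have "\<dots> = (\<Sum>b\<in>E ` I. (\<Sum>i\<in>{i \<in> I. E i = b}. l i y) *\<^sub>R b)"
    unfolding scaleR_sum_left by (intro sum.cong) auto
  finally show "y = (\<Sum>b\<in>E ` I. (\<Sum>i\<in>{i \<in> I. E i = b}. l i y) *\<^sub>R b)" .
qed

section \<open>The normed space of derivative arrays\<close>

lemma norm_lookup_le: "norm (Poly_Mapping.lookup Z i) \<le> norm Z"
proof (cases "i \<in> Poly_Mapping.keys Z")
  case True
  have "norm Z = (\<Sum>n\<in>Poly_Mapping.keys Z. norm (Poly_Mapping.lookup Z n))"
    by (simp add: norm_poly_mapping_def dist_poly_mapping_def)
  then show ?thesis using member_le_sum[OF True, of "\<lambda>n. norm (Poly_Mapping.lookup Z n)"] by simp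
qed (simp add: in_keys_iff)

lemma lookup_scaleR: "Poly_Mapping.lookup (r *\<^sub>R Z) i = r *\<^sub>R Poly_Mapping.lookup (Z :: 'i \<Rightarrow>\<^sub>0 'v::real_vector) i"
proof -
  have "finite {i. r *\<^sub>R Poly_Mapping.lookup Z i \<noteq> 0}"
    by (rule finite_subset[OF _ finite_keys[of Z]]) (auto simp: in_keys_iff)
  then show ?thesis by (simp add: scaleR_poly_mapping_def Abs_poly_mapping_inverse)
qed

lemma bounded_linear_lookup: "bounded_linear (\<lambda>Z. Poly_Mapping.lookup (Z :: 'i \<Rightarrow>\<^sub>0 'v::real_normed_vector) i)"
  by (rule bounded_linear_intro[where K = 1]) (auto simp: lookup_add lookup_scaleR norm_lookup_le)

lemma bounded_linear_single: "bounded_linear (Poly_Mapping.single i :: 'v::real_normed_vector \<Rightarrow> _)"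
proof (rule bounded_linear_intro[where K = 1])
  show "Poly_Mapping.single i (r *\<^sub>R x) = r *\<^sub>R Poly_Mapping.single i x" for r and x :: 'v
    by (rule poly_mapping_eqI) (simp add: lookup_scaleR lookup_single when_def)
  show "norm (Poly_Mapping.single i x) \<le> norm x * 1" for x :: 'v
    by (cases "x = 0") (simp_all add: norm_poly_mapping_def dist_poly_mapping_def)
qed (simp add: single_add)

lemma finite_indices: "finite (indices n :: 'e::euclidean_space list set)"
  using finite_lists_length_le[OF finite_Basis, of n] by (simp add: indices_def)

lemma lookup_deriv_array:
  "Poly_Mapping.lookup (deriv_array n f x) bs = (if bs \<in> indices n then iter_deriv bs f x else 0)"
  by (simp add: deriv_array_def lookup_sum lookup_single when_def finite_indices)

lemma keys_deriv_array: "Poly_Mapping.keys (deriv_array n f x) \<subseteq> indices n"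
  by (auto simp: in_keys_iff lookup_deriv_array split: if_splits)

lemma deriv_array_eq_iff:
  "deriv_array n f x = deriv_array n g y \<longleftrightarrow> (\<forall>bs\<in>indices n. iter_deriv bs f x = iter_deriv bs g y)"
  by (auto simp: poly_mapping_eq_iff fun_eq_iff lookup_deriv_array split: if_splits)

text \<open>Coordinates of jets of one fixed order lie in such a set, which permits the composition
  of smooth maps on jet charts with curves of jets.\<close>

lemma finite_coordinates_jets:
  assumes "finite K"
  shows "finite_coordinates {p :: 'e::euclidean_space \<times> ('e list \<Rightarrow>\<^sub>0 'e). Poly_Mapping.keys (snd p) \<subseteq> K}"
proof (rule finite_coordinatesI)
  let ?I = "(Basis :: 'e set) <+> K \<times> (Basis :: 'e set)"
  let ?l = "\<lambda>i (p :: 'e \<times> ('e list \<Rightarrow>\<^sub>0 'e)). case i of Inl b \<Rightarrow> fst p \<bullet> b | Inr (bs, b) \<Rightarrow> Poly_Mapping.lookup (snd p) bs \<bullet> b"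
  let ?E = "\<lambda>i. case i of Inl b \<Rightarrow> (b, 0) | Inr (bs, b) \<Rightarrow> (0, Poly_Mapping.single bs b)"
  show "finite ?I" using assms by simp
  show "bounded_linear (?l i)" for i
  proof (cases i)
    case (Inl b)
    then show ?thesis using bounded_linear_compose[OF bounded_linear_inner_left bounded_linear_fst] by simp
  next
    case (Inr q)
    obtain bs b where "q = (bs, b)" by (cases q)
    then show ?thesis
      using Inr bounded_linear_compose[OF bounded_linear_inner_left[of b] bounded_linear_compose[OF bounded_linear_lookup[of bs] bounded_linear_snd]]
      by simp
  qed
  fix p :: "'e \<times> ('e list \<Rightarrow>\<^sub>0 'e)"
  assume p: "p \<in> {p. Poly_Mapping.keys (snd p) \<subseteq> K}"
  have "(\<Sum>i\<in>?I. ?l i p *\<^sub>R ?E i) = (\<Sum>b\<in>Basis. (fst p \<bullet> b) *\<^sub>R (b, 0)) +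
      (\<Sum>(bs, b)\<in>K \<times> Basis. (Poly_Mapping.lookup (snd p) bs \<bullet> b) *\<^sub>R (0, Poly_Mapping.single bs b))"
    using assms by (simp add: sum.Plus case_prod_unfold)
  also have "\<dots> = p"
  proof (rule prod_eqI)
    have "Poly_Mapping.lookup (\<Sum>(bs, b)\<in>K \<times> Basis. (Poly_Mapping.lookup (snd p) bs \<bullet> b) *\<^sub>R Poly_Mapping.single bs b) i
        = Poly_Mapping.lookup (snd p) i" for i
    proof -
      have "Poly_Mapping.lookup (\<Sum>(bs, b)\<in>K \<times> Basis. (Poly_Mapping.lookup (snd p) bs \<bullet> b) *\<^sub>R Poly_Mapping.single bs b) i
          = (\<Sum>bs\<in>K. \<Sum>b\<in>Basis. (Poly_Mapping.lookup (snd p) bs \<bullet> b) *\<^sub>R (b when bs = i))"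
        by (simp add: lookup_sum lookup_scaleR lookup_single case_prod_unfold sum.cartesian_product)
      also have "\<dots> = (\<Sum>bs\<in>K. if bs = i then Poly_Mapping.lookup (snd p) i else 0)"
        by (intro sum.cong) (auto simp: euclidean_representation)
      also have "\<dots> = Poly_Mapping.lookup (snd p) i"
        using p assms by (auto simp: in_keys_iff)
      finally show ?thesis .
    qed
    then have "(\<Sum>(bs, b)\<in>K \<times> Basis. (Poly_Mapping.lookup (snd p) bs \<bullet> b) *\<^sub>R Poly_Mapping.single bs b) = snd p"
      by (rule poly_mapping_eqI)
    then show "snd ((\<Sum>b\<in>Basis. (fst p \<bullet> b) *\<^sub>R (b, 0)) +
      (\<Sum>(bs, b)\<in>K \<times> Basis. (Poly_Mapping.lookup (snd p) bs \<bullet> b) *\<^sub>R (0, Poly_Mapping.single bs b))) = snd p"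
      by (simp add: snd_sum case_prod_unfold)
  qed (simp add: fst_sum case_prod_unfold euclidean_representation)
  finally show "p = (\<Sum>i\<in>?I. ?l i p *\<^sub>R ?E i)" by simp
qed

text \<open>Submanifolds are parametrized by open subsets of such spans. The arrays in a span are
  supported on the finitely many indices that occur in \<open>B\<close>.\<close>

lemma finite_coordinates_span:
  fixes B :: "('e::euclidean_space \<times> ('e list \<Rightarrow>\<^sub>0 'e)) set"
  assumes "finite B" shows "finite_coordinates (span B)"
proof (rule finite_coordinates_subset[OF finite_coordinates_jets])
  let ?K = "\<Union>b\<in>B. Poly_Mapping.keys (snd b)"
  show "finite ?K" using assms by simp
  have "subspace {p :: 'e \<times> ('e list \<Rightarrow>\<^sub>0 'e). Poly_Mapping.keys (snd p) \<subseteq> ?K}"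
    unfolding subspace_def
  proof (intro conjI ballI allI)
    show "x + y \<in> {p. Poly_Mapping.keys (snd p) \<subseteq> ?K}"
      if "x \<in> {p. Poly_Mapping.keys (snd p) \<subseteq> ?K}" "y \<in> {p. Poly_Mapping.keys (snd p) \<subseteq> ?K}"
      for x y :: "'e \<times> ('e list \<Rightarrow>\<^sub>0 'e)"
      using that Poly_Mapping.keys_add[of "snd x" "snd y"] by auto
    show "r *\<^sub>R x \<in> {p. Poly_Mapping.keys (snd p) \<subseteq> ?K}"
      if "x \<in> {p. Poly_Mapping.keys (snd p) \<subseteq> ?K}" for r and x :: "'e \<times> ('e list \<Rightarrow>\<^sub>0 'e)"
    proof -
      have "Poly_Mapping.keys (r *\<^sub>R snd x) \<subseteq> Poly_Mapping.keys (snd x)" by (auto simp: in_keys_iff lookup_scaleR)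
      then show ?thesis using that by auto
    qed
  qed simp
  then show "span B \<subseteq> {p. Poly_Mapping.keys (snd p) \<subseteq> ?K}" by (intro span_minimal) auto
qed

lemma smooth_at_deriv_array: "smooth_at f x \<Longrightarrow> smooth_at (deriv_array n f) x"
  unfolding deriv_array_def[abs_def]
  by (intro smooth_at_sum smooth_at_compose_linear[OF bounded_linear_single] smooth_at_iter_deriv)

lemma has_derivative_deriv_array:
  assumes "smooth_at f x"
  shows "(deriv_array n f has_derivative (\<lambda>w. \<Sum>bs\<in>indices n. Poly_Mapping.single bs (dir_deriv w (iter_deriv bs f) x))) (at x)"
  unfolding deriv_array_def[abs_def]
  by (intro has_derivative_sum bounded_linear.has_derivative[OF bounded_linear_single] has_derivative_dir_deriv
      smooth_at_differentiable smooth_at_iter_deriv assms)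

lemma eventually_eventually_nhds: "\<forall>\<^sub>F x in nhds a. P x \<Longrightarrow> \<forall>\<^sub>F x in nhds a. \<forall>\<^sub>F y in nhds x. P y"
  by (simp add: eventually_eventually)

lemma eventually_fst:
  fixes p :: "'x::real_normed_vector \<times> 'y::real_normed_vector"
  shows "\<forall>\<^sub>F x in nhds (fst p). P x \<Longrightarrow> \<forall>\<^sub>F q in nhds p. P (fst q)"
  using eventually_compose_isCont[where f = fst and a = p and P = P] by (simp add: continuous_fst)

text \<open>The formula for the derivatives of \<open>T2 \<circ> \<phi> \<circ> T1\<close> in terms of those of \<open>\<phi>\<close>: as for total
  derivatives, differentiating a function of the array of derivatives of \<open>\<phi>\<close> yields a function of the
  array of derivatives of one order more.\<close>

lemma iter_deriv_change_coordinates: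
  fixes T T1 :: "'e::euclidean_space \<Rightarrow> 'e" and T2 :: "'e \<Rightarrow> 'e" and Z0 :: "'e list \<Rightarrow>\<^sub>0 'e"
  assumes T: "smooth_at T x0" and T1: "smooth_at T1 (T x0)" and T2: "smooth_at T2 (Poly_Mapping.lookup Z0 [])"
    and ev1: "\<forall>\<^sub>F x in nhds x0. T1 (T x) = x" and ev2: "\<forall>\<^sub>F y in nhds (T x0). T (T1 y) = y"
  shows "\<exists>\<Psi>. smooth_at \<Psi> (x0, Z0) \<and> (\<forall>\<^sub>F p in nhds (x0, Z0). \<forall>\<phi>. smooth_at \<phi> (fst p) \<longrightarrow>
      (\<forall>bs\<in>indices (length vs). Poly_Mapping.lookup (snd p) bs = iter_deriv bs \<phi> (fst p)) \<longrightarrow>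
      iter_deriv vs (\<lambda>y. T2 (\<phi> (T1 y))) (T (fst p)) = \<Psi> p)"
proof (induction vs)
  case Nil
  let ?\<Psi> = "\<lambda>p :: 'e \<times> ('e list \<Rightarrow>\<^sub>0 'e). T2 (Poly_Mapping.lookup (snd p) [])"
  have "smooth_at ?\<Psi> (x0, Z0)"
    by (rule smooth_at_precompose_linear[OF bounded_linear_compose[OF bounded_linear_lookup bounded_linear_snd]]) (use T2 in simp)
  moreover have "\<forall>\<^sub>F p in nhds (x0, Z0). T1 (T (fst p)) = fst p" by (rule eventually_fst) (use ev1 in simp)
  then have "\<forall>\<^sub>F p in nhds (x0, Z0). \<forall>\<phi>. smooth_at \<phi> (fst p) \<longrightarrow>
      (\<forall>bs\<in>indices (length []). Poly_Mapping.lookup (snd p) bs = iter_deriv bs \<phi> (fst p)) \<longrightarrow>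
      iter_deriv [] (\<lambda>y. T2 (\<phi> (T1 y))) (T (fst p)) = ?\<Psi> p"
    by eventually_elim (simp add: indices_def)
  ultimately show ?case by blast
next
  case (Cons v vs)
  define m where "m = length vs"
  define Q where "Q \<Psi> p \<longleftrightarrow> (\<forall>\<phi>. smooth_at \<phi> (fst p) \<longrightarrow>
      (\<forall>bs\<in>indices m. Poly_Mapping.lookup (snd p) bs = iter_deriv bs \<phi> (fst p)) \<longrightarrow>
      iter_deriv vs (\<lambda>y. T2 (\<phi> (T1 y))) (T (fst p)) = \<Psi> p)" for \<Psi> and p :: "'e \<times> ('e list \<Rightarrow>\<^sub>0 'e)"
  obtain \<Psi> where \<Psi>: "smooth_at \<Psi> (x0, Z0)" "\<forall>\<^sub>F p in nhds (x0, Z0). Q \<Psi> p"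
    using Cons.IH unfolding Q_def m_def by blast
  \<comment> \<open>The total derivative of \<Psi> in direction \<open>b\<close>: its explicit
    dependence on the point, and for each entry \<open>bs\<close> the rate at which that entry
    changes, which is the entry \<open>b # bs\<close>. Here the array of one order more comes
    in.\<close>
  define h where "h b p = dir_deriv (b, 0) \<Psi> p + (\<Sum>bs\<in>indices m. \<Sum>b'\<in>Basis.
      (Poly_Mapping.lookup (snd p) (b # bs) \<bullet> b') *\<^sub>R dir_deriv (0, Poly_Mapping.single bs b') \<Psi> p)"
    for b and p :: "'e \<times> ('e list \<Rightarrow>\<^sub>0 'e)"
  define \<Psi>' where "\<Psi>' p = (\<Sum>b\<in>Basis. (dir_deriv v T1 (T (fst p)) \<bullet> b) *\<^sub>R h b p)" for p :: "'e \<times> ('e list \<Rightarrow>\<^sub>0 'e)"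
  have l: "bounded_linear (\<lambda>p :: 'e \<times> ('e list \<Rightarrow>\<^sub>0 'e). Poly_Mapping.lookup (snd p) bs \<bullet> b')" for bs and b' :: 'e
    by (rule bounded_linear_compose[OF bounded_linear_inner_left bounded_linear_compose[OF bounded_linear_lookup bounded_linear_snd]])
  have "smooth_at (\<lambda>x. dir_deriv v T1 (T x)) x0" by (rule smooth_at_compose[OF T smooth_at_dir_deriv[OF T1]])
  then have c: "smooth_at (\<lambda>p :: 'e \<times> ('e list \<Rightarrow>\<^sub>0 'e). dir_deriv v T1 (T (fst p)) \<bullet> b) (x0, Z0)" for b
    using smooth_at_precompose_linear[OF bounded_linear_fst, of "\<lambda>x. dir_deriv v T1 (T x) \<bullet> b" "(x0, Z0)"]
      smooth_at_compose_linear[OF bounded_linear_inner_left[of b] \<open>smooth_at (\<lambda>x. dir_deriv v T1 (T x)) x0\<close>] by simp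
  have "smooth_at (\<lambda>p. h b p) (x0, Z0)" for b
    unfolding h_def
    by (intro smooth_at_add smooth_at_sum smooth_at_scaleR smooth_at_dir_deriv \<Psi>(1) smooth_at_bounded_linear[OF l])
  then have s: "smooth_at \<Psi>' (x0, Z0)"
    unfolding \<Psi>'_def[abs_def] by (intro smooth_at_sum smooth_at_scaleR c)
  have ev: "\<forall>\<^sub>F x in nhds x0. smooth_at T1 (T x) \<and> (\<forall>\<^sub>F y in nhds (T x). T (T1 y) = y) \<and> T1 (T x) = x"
    using eventually_compose_isCont[OF smooth_at_isCont[OF T] smooth_at_eventually[OF T1]]
      eventually_compose_isCont[OF smooth_at_isCont[OF T] eventually_eventually_nhds[OF ev2]] ev1
    by eventually_elim simp
  have "\<forall>\<^sub>F p in nhds (x0, Z0). smooth_at T1 (T (fst p)) \<and> (\<forall>\<^sub>F y in nhds (T (fst p)). T (T1 y) = y) \<and> T1 (T (fst p)) = fst p"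
    by (rule eventually_fst) (use ev in simp)
  with smooth_at_eventually[OF \<Psi>(1)] eventually_eventually_nhds[OF \<Psi>(2)]
  have "\<forall>\<^sub>F p in nhds (x0, Z0). \<forall>\<phi>. smooth_at \<phi> (fst p) \<longrightarrow>
      (\<forall>bs\<in>indices (length (v # vs)). Poly_Mapping.lookup (snd p) bs = iter_deriv bs \<phi> (fst p)) \<longrightarrow>
      iter_deriv (v # vs) (\<lambda>y. T2 (\<phi> (T1 y))) (T (fst p)) = \<Psi>' p"
  proof eventually_elim
    case (elim p)
    show ?case
    proof (intro allI impI)
      fix \<phi> assume \<phi>: "smooth_at \<phi> (fst p)"
        and arr: "\<forall>bs\<in>indices (length (v # vs)). Poly_Mapping.lookup (snd p) bs = iter_deriv bs \<phi> (fst p)"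
      obtain x Z where p: "p = (x, Z)" by (cases p)
      note e = elim[unfolded p fst_conv]
      have e3: "smooth_at T1 (T x)" "\<forall>\<^sub>F y in nhds (T x). T (T1 y) = y" "T1 (T x) = x" using e by auto
      have \<phi>x: "smooth_at \<phi> x" using \<phi> p by simp
      have arrx: "Poly_Mapping.lookup Z bs = iter_deriv bs \<phi> x" if "bs \<in> indices (Suc m)" for bs
        using arr that p by (simp add: m_def)
      have sub: "bs \<in> indices m \<Longrightarrow> bs \<in> indices (Suc m)" for bs :: "'e list" by (auto simp: indices_def)
      \<comment> \<open>Moves the entries of order at most \<open>m\<close> along \<phi> and keeps
        all others. Adding the increment to \<open>Z\<close>, instead of taking the array of \<phi>
        itself, makes \<open>q\<close> pass through \<open>(x, Z)\<close> whatever further entries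
        \<open>Z\<close> has.\<close>
      define q where "q x' = (x', Z + (deriv_array m \<phi> x' - deriv_array m \<phi> x))" for x'
      define D where "D w = (\<Sum>bs\<in>indices m. Poly_Mapping.single bs (dir_deriv w (iter_deriv bs \<phi>) x))" for w
      have dq: "(q has_derivative (\<lambda>w. (w, D w))) (at x)"
      proof -
        have "(deriv_array m \<phi> has_derivative D) (at x)"
          using has_derivative_deriv_array[OF \<phi>x, of m] unfolding D_def .
        then have "((\<lambda>x'. Z + (deriv_array m \<phi> x' - deriv_array m \<phi> x)) has_derivative D) (at x)"
          by (auto intro!: derivative_eq_intros)
        then show ?thesis unfolding q_def[abs_def] by (intro has_derivative_Pair has_derivative_ident)
      qed
      have qx: "q x = (x, Z)" by (simp add: q_def)
      have "isCont q x" using has_derivative_continuous[OF dq] .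
      then have "\<forall>\<^sub>F x' in nhds x. Q \<Psi> (q x')"
        using eventually_compose_isCont[where f = q and a = x and P = "Q \<Psi>"] e qx by simp
      with smooth_at_eventually[OF \<phi>x]
      have 1: "\<forall>\<^sub>F x' in nhds x. iter_deriv vs (\<lambda>y. T2 (\<phi> (T1 y))) (T x') = \<Psi> (q x')"
      proof eventually_elim
        case (elim x')
        then show ?case
          using arrx sub unfolding Q_def q_def by (simp add: lookup_add lookup_minus lookup_deriv_array)
      qed
      have "\<forall>\<^sub>F y in nhds (T x). iter_deriv vs (\<lambda>y. T2 (\<phi> (T1 y))) (T (T1 y)) = \<Psi> (q (T1 y))"
        using eventually_compose_isCont[OF smooth_at_isCont[OF e3(1)], of "\<lambda>x'. iter_deriv vs (\<lambda>y. T2 (\<phi> (T1 y))) (T x') = \<Psi> (q x')"] 1 e3(3) by simp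
      then have "\<forall>\<^sub>F y in nhds (T x). iter_deriv vs (\<lambda>y. T2 (\<phi> (T1 y))) y = \<Psi> (q (T1 y))"
        using e3(2) by eventually_elim simp
      then have eq: "iter_deriv (v # vs) (\<lambda>y. T2 (\<phi> (T1 y))) (T x) = dir_deriv v (\<lambda>y. \<Psi> (q (T1 y))) (T x)"
        unfolding iter_deriv_Cons' by (rule dir_deriv_cong_ev(2))
      define F where "F w = dir_deriv (w, D w) \<Psi> (x, Z)" for w
      have d\<Psi>: "(\<Psi> has_derivative (\<lambda>u. dir_deriv u \<Psi> (x, Z))) (at (q x))"
        unfolding qx by (rule has_derivative_dir_deriv[OF smooth_at_differentiable]) (use e in simp)
      have dF: "((\<lambda>x'. \<Psi> (q x')) has_derivative F) (at x)"
        using has_derivative_compose[OF dq d\<Psi>] by (simp add: F_def[abs_def])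
      have dF1: "((\<lambda>x'. \<Psi> (q x')) has_derivative F) (at (T1 (T x)))" using dF e3(3) by simp
      have "dir_deriv v (\<lambda>y. \<Psi> (q (T1 y))) (T x) = F (dir_deriv v T1 (T x))"
        by (rule dir_deriv_eq[OF has_derivative_compose[OF has_derivative_dir_deriv[OF smooth_at_differentiable[OF e3(1)]] dF1]])
      also have "\<dots> = (\<Sum>b\<in>Basis. (dir_deriv v T1 (T x) \<bullet> b) *\<^sub>R F b)"
        by (rule linear_sum_Basis[OF has_derivative_linear[OF dF]])
      also have "\<dots> = (\<Sum>b\<in>Basis. (dir_deriv v T1 (T x) \<bullet> b) *\<^sub>R h b (x, Z))"
      proof (rule sum.cong[OF refl])
        fix b :: 'e assume b: "b \<in> Basis"
        interpret L: bounded_linear "\<lambda>u. dir_deriv u \<Psi> (x, Z)"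
          by (rule bounded_linear_dir_deriv[OF smooth_at_differentiable]) (use e in simp)
        have "dir_deriv b (iter_deriv bs \<phi>) x = Poly_Mapping.lookup Z (b # bs)" if "bs \<in> indices m" for bs
          using arrx[of "b # bs"] that b by (simp add: indices_def dir_deriv_def)
        then have "D b = (\<Sum>bs\<in>indices m. Poly_Mapping.single bs (Poly_Mapping.lookup Z (b # bs)))"
          by (simp add: D_def)
        also have "\<dots> = (\<Sum>bs\<in>indices m. \<Sum>b'\<in>Basis. (Poly_Mapping.lookup Z (b # bs) \<bullet> b') *\<^sub>R Poly_Mapping.single bs b')"
          by (intro sum.cong refl linear_sum_Basis bounded_linear.linear bounded_linear_single)
        finally have D: "D b = \<dots>" .
        have "(b, D b) = (b, 0) + (\<Sum>bs\<in>indices m. \<Sum>b'\<in>Basis. (Poly_Mapping.lookup Z (b # bs) \<bullet> b') *\<^sub>R (0, Poly_Mapping.single bs b'))"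
          unfolding D by (rule prod_eqI) (simp_all add: fst_sum snd_sum)
        then have "F b = dir_deriv ((b, 0) + (\<Sum>bs\<in>indices m. \<Sum>b'\<in>Basis. (Poly_Mapping.lookup Z (b # bs) \<bullet> b') *\<^sub>R (0, Poly_Mapping.single bs b'))) \<Psi> (x, Z)"
          unfolding F_def by simp
        also have "\<dots> = h b (x, Z)" by (simp only: L.add L.sum L.scaleR h_def snd_conv)
        finally show "(dir_deriv v T1 (T x) \<bullet> b) *\<^sub>R F b = (dir_deriv v T1 (T x) \<bullet> b) *\<^sub>R h b (x, Z)" by simp
      qed
      finally show "iter_deriv (v # vs) (\<lambda>y. T2 (\<phi> (T1 y))) (T (fst p)) = \<Psi>' p"
        unfolding p fst_conv eq by (simp add: \<Psi>'_def)
    qed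
  qed
  with s show ?case by blast
qed

lemma iter_deriv_dir_deriv_commute:
  fixes f :: "'x::real_normed_vector \<Rightarrow> 'y::euclidean_space"
  assumes "smooth_at f a"
  shows "iter_deriv vs (dir_deriv u f) a = dir_deriv u (iter_deriv vs f) a"
  using assms
proof (induction vs arbitrary: a)
  case (Cons v vs)
  have "\<forall>\<^sub>F x in nhds a. iter_deriv vs (dir_deriv u f) x = dir_deriv u (iter_deriv vs f) x"
    using smooth_at_eventually[OF Cons.prems] by eventually_elim (rule Cons.IH)
  from dir_deriv_cong_ev(2)[OF this, of v] show ?case
    unfolding iter_deriv_Cons' using dir_deriv_commute[OF smooth_at_iter_deriv[OF Cons.prems, of vs], of v u] by simp
qed simp

section \<open>Charts of the jet bundle, curves of jets and tangent vectors\<close>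

context manifold
begin

lemma jet_chart_jet:
  assumes "c \<in> A" "d \<in> A" "\<phi> \<in> local_diffeos A" "c z = Some x" "\<phi> z = Some y" "y \<in> dom d"
  shows "jet_chart A n c d (jet A n \<phi> z) = Some (x, deriv_array n (in_charts c d \<phi>) x)"
proof -
  have z: "z \<in> dom \<phi>" using assms by auto
  note r = jet_rep[OF assms(3) z, of n]
  have "jet A n \<phi> z \<in> jets A n (local_diffeos A)" using assms(3) z unfolding jets_def by blast
  moreover have "jets_agree n (in_charts c d \<phi>) (in_charts c d (jet_rep (jet A n \<phi> z))) x"
    by (rule same_jetD(2)[OF r(3) assms(1,2,3) r(1) assms(4,5,6)])
  then have "deriv_array n (in_charts c d (jet_rep (jet A n \<phi> z))) x = deriv_array n (in_charts c d \<phi>) x"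
    unfolding deriv_array_eq_iff jets_agree_def indices_def by auto
  ultimately show ?thesis
    using assms jet_target_jet[OF assms(3) z] by (auto simp: jet_chart_def jet_source_jet)
qed

lemma jet_chartD:
  assumes "jet_chart A n c d j = Some p"
  obtains \<phi> z x y where "\<phi> \<in> local_diffeos A" "j = jet A n \<phi> z" "c z = Some x" "\<phi> z = Some y" "y \<in> dom d"
proof -
  have j: "j \<in> jets A n (local_diffeos A)" "jet_source j \<in> dom c" "jet_target j \<in> dom d"
    using assms unfolding jet_chart_def by (auto split: if_splits)
  then obtain \<phi> z where \<phi>: "\<phi> \<in> local_diffeos A" "z \<in> dom \<phi>" "j = jet A n \<phi> z" unfolding jets_def by blast
  have "z \<in> dom c" "the (\<phi> z) \<in> dom d" using j \<phi> by (simp_all add: jet_source_jet jet_target_jet)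
  moreover obtain x where "c z = Some x" using \<open>z \<in> dom c\<close> by blast
  moreover obtain y where "\<phi> z = Some y" using \<phi>(2) by blast
  ultimately show thesis using that[of \<phi> z x y] \<phi> by simp
qed

lemma keys_jet_chart: "jet_chart A n c d j = Some p \<Longrightarrow> Poly_Mapping.keys (snd p) \<subseteq> indices n"
  unfolding jet_chart_def by (auto simp: Let_def split: if_splits dest: subsetD[OF keys_deriv_array])

text \<open>The transition map is exhibited as the restriction of a map \<open>K\<close> that is
  smooth on an open set of the ambient space of arrays: arrays of actual jets are symmetric, and
  derivatives are defined only for maps on open sets.\<close>

lemma jet_chart_change:
  assumes A: "c \<in> A" "d \<in> A" "c' \<in> A" "d' \<in> A" and j0: "jet_chart A n c d j0 = Some p0" "j0 \<in> dom (jet_chart A n c' d')"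
  obtains K where "smooth_at K p0" "\<forall>\<^sub>F p in nhds p0. \<forall>j. jet_chart A n c d j = Some p \<longrightarrow> jet_chart A n c' d' j = Some (K p)"
proof -
  obtain \<phi>0 z0 x0 y0 where \<phi>0: "\<phi>0 \<in> local_diffeos A" "j0 = jet A n \<phi>0 z0" "c z0 = Some x0" "\<phi>0 z0 = Some y0" "y0 \<in> dom d"
    by (rule jet_chartD[OF j0(1)])
  have zd: "z0 \<in> dom \<phi>0" using \<phi>0 by auto
  have z0: "z0 \<in> dom c'" "y0 \<in> dom d'"
    using j0(2) \<phi>0 jet_target_jet[OF \<phi>0(1) zd] unfolding jet_chart_def dom_def by (auto simp: jet_source_jet split: if_splits)
  obtain x0' where x0': "c' z0 = Some x0'" using z0 by auto
  obtain u0 where u0: "d y0 = Some u0" using \<phi>0 by auto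
  define Z0 where "Z0 = deriv_array n (in_charts c d \<phi>0) x0"
  have p0: "p0 = (x0, Z0)" using jet_chart_jet[OF A(1,2) \<phi>0(1,3,4,5)] j0(1) \<phi>0(2) by (simp add: Z0_def)
  have Z0: "Poly_Mapping.lookup Z0 [] = u0"
    using in_charts_eq[of c z0 x0 \<phi>0 y0 d] A \<phi>0 u0 by (simp add: Z0_def lookup_deriv_array indices_def)
  define T where "T = in_charts c c' Some"
  define T1 where "T1 = in_charts c' c Some"
  define T2 where "T2 = in_charts d d' Some"
  have Tx0: "T x0 = x0'" using in_charts_eq[of c z0 x0 Some z0 c'] A \<phi>0(3) x0' by (simp add: T_def)
  have T: "smooth_at T x0" unfolding T_def by (rule smooth_at_in_charts[OF A(1,3) local_diffeos_Some \<phi>0(3) refl z0(1)])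
  have T1: "smooth_at T1 (T x0)" unfolding T1_def Tx0
    by (rule smooth_at_in_charts[OF A(3,1) local_diffeos_Some x0' refl]) (use \<phi>0 in auto)
  have T2: "smooth_at T2 u0" unfolding T2_def by (rule smooth_at_in_charts[OF A(2,4) local_diffeos_Some u0 refl z0(2)])
  have evT: "\<forall>\<^sub>F x in nhds x0. \<exists>z. c z = Some x \<and> c' z = Some (T x)"
    using eventually_in_charts[OF A(1,3) local_diffeos_Some \<phi>0(3) refl z0(1)] unfolding T_def by eventually_elim auto
  have evT1: "\<forall>\<^sub>F y in nhds (T x0). \<exists>z. c' z = Some y \<and> c z = Some (T1 y)"
    using eventually_in_charts[OF A(3,1) local_diffeos_Some x0' refl] \<phi>0(3) unfolding T1_def Tx0 by (auto elim!: eventually_mono)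
  have ev1: "\<forall>\<^sub>F x in nhds x0. T1 (T x) = x"
    using evT
  proof eventually_elim
    case (elim x)
    then obtain z where "c z = Some x" "c' z = Some (T x)" by blast
    then show ?case using in_charts_eq[of c' z "T x" Some z c] A by (simp add: T1_def)
  qed
  have ev2: "\<forall>\<^sub>F y in nhds (T x0). T (T1 y) = y"
    using evT1
  proof eventually_elim
    case (elim y)
    then obtain z where "c' z = Some y" "c z = Some (T1 y)" by blast
    then show ?case using in_charts_eq[of c z "T1 y" Some z c'] A by (simp add: T_def)
  qed
  define P where "P vs \<Psi> \<longleftrightarrow> smooth_at \<Psi> (x0, Z0) \<and> (\<forall>\<^sub>F p in nhds (x0, Z0). \<forall>\<phi>. smooth_at \<phi> (fst p) \<longrightarrow>
      (\<forall>bs\<in>indices (length vs). Poly_Mapping.lookup (snd p) bs = iter_deriv bs \<phi> (fst p)) \<longrightarrow>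
      iter_deriv vs (\<lambda>y. T2 (\<phi> (T1 y))) (T (fst p)) = \<Psi> p)" for vs \<Psi>
  have "\<forall>vs. \<exists>\<Psi>. P vs \<Psi>"
    unfolding P_def by (rule allI, rule iter_deriv_change_coordinates[OF T T1 _ ev1 ev2]) (simp add: Z0 T2)
  from choice[OF this] obtain \<Psi> where "\<forall>vs. P vs (\<Psi> vs)" by blast
  then have \<Psi>: "\<And>vs. smooth_at (\<Psi> vs) (x0, Z0)" "\<And>vs. \<forall>\<^sub>F p in nhds (x0, Z0). \<forall>\<phi>. smooth_at \<phi> (fst p) \<longrightarrow>
      (\<forall>bs\<in>indices (length vs). Poly_Mapping.lookup (snd p) bs = iter_deriv bs \<phi> (fst p)) \<longrightarrow>
      iter_deriv vs (\<lambda>y. T2 (\<phi> (T1 y))) (T (fst p)) = \<Psi> vs p"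
    unfolding P_def by simp_all
  define K where "K p = (T (fst p), \<Sum>bs\<in>indices n. Poly_Mapping.single bs (\<Psi> bs p))" for p
  show thesis
  proof (rule that[of K])
    have "smooth_at (\<lambda>p. T (fst p)) (x0, Z0)"
      using smooth_at_precompose_linear[OF bounded_linear_fst, of T "(x0, Z0)"] T by simp
    then show "smooth_at K p0" unfolding K_def[abs_def] p0
      by (intro smooth_at_Pair smooth_at_sum smooth_at_compose_linear[OF bounded_linear_single] \<Psi>(1))
    have 1: "\<forall>\<^sub>F p in nhds p0. \<exists>z. c z = Some (fst p) \<and> c' z = Some (T (fst p))"
      by (rule eventually_fst) (simp add: p0 evT)
    have "isCont (\<lambda>p :: 'e \<times> ('e list \<Rightarrow>\<^sub>0 'e). Poly_Mapping.lookup (snd p) []) p0"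
      by (rule linear_continuous_at[OF bounded_linear_compose[OF bounded_linear_lookup bounded_linear_snd]])
    moreover have "\<forall>\<^sub>F u in nhds u0. \<exists>z. d z = Some u \<and> z \<in> dom d'"
      using eventually_in_charts[OF A(2,4) local_diffeos_Some u0 refl z0(2)] by eventually_elim auto
    ultimately have 2: "\<forall>\<^sub>F p in nhds p0. \<exists>z. d z = Some (Poly_Mapping.lookup (snd p) []) \<and> z \<in> dom d'"
      using eventually_compose_isCont[where f = "\<lambda>p :: 'e \<times> ('e list \<Rightarrow>\<^sub>0 'e). Poly_Mapping.lookup (snd p) []" and a = p0
          and P = "\<lambda>u. \<exists>z. d z = Some u \<and> z \<in> dom d'"] by (simp add: p0 Z0)
    have 3: "\<forall>\<^sub>F p in nhds p0. \<forall>bs\<in>indices n. \<forall>\<phi>. smooth_at \<phi> (fst p) \<longrightarrow>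
      (\<forall>bs'\<in>indices (length bs). Poly_Mapping.lookup (snd p) bs' = iter_deriv bs' \<phi> (fst p)) \<longrightarrow>
      iter_deriv bs (\<lambda>y. T2 (\<phi> (T1 y))) (T (fst p)) = \<Psi> bs p"
      unfolding p0 by (rule eventually_ball_finite[OF finite_indices]) (use \<Psi>(2) in blast)
    show "\<forall>\<^sub>F p in nhds p0. \<forall>j. jet_chart A n c d j = Some p \<longrightarrow> jet_chart A n c' d' j = Some (K p)"
      using 1 2 3
    proof eventually_elim
      case (elim p)
      show ?case
      proof (intro allI impI)
        fix j assume j: "jet_chart A n c d j = Some p"
        obtain \<phi> z x y where \<phi>: "\<phi> \<in> local_diffeos A" "j = jet A n \<phi> z" "c z = Some x" "\<phi> z = Some y" "y \<in> dom d"
          by (rule jet_chartD[OF j])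
        have p: "p = (x, deriv_array n (in_charts c d \<phi>) x)" using jet_chart_jet[OF A(1,2) \<phi>(1,3,4,5)] j \<phi>(2) by simp
        have fp: "fst p = x" by (simp add: p)
        have zx: "c' z = Some (T x)"
          using elim(1) \<phi>(3) chart_pinj[OF A(1)] unfolding fp pinj_def by blast
        obtain u where u: "d y = Some u" using \<phi>(5) by auto
        have "Poly_Mapping.lookup (snd p) [] = u"
          using in_charts_eq[of c z x \<phi> y d] A \<phi> u by (simp add: p lookup_deriv_array indices_def)
        then have y: "y \<in> dom d'" using elim(2) u chart_pinj[OF A(2)] unfolding pinj_def by auto
        have C': "jet_chart A n c' d' j = Some (T x, deriv_array n (in_charts c' d' \<phi>) (T x))"
          unfolding \<phi>(2) by (rule jet_chart_jet[OF A(3,4) \<phi>(1) zx \<phi>(4) y])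
        have "\<forall>\<^sub>F v in nhds (T x). in_charts c' d \<phi> v = in_charts c d \<phi> (T1 v)"
          using in_charts_comp[OF A(3,1,2) \<phi>(1) local_diffeos_Some zx refl \<phi>(4) _ \<phi>(5)] \<phi>(3) by (auto simp: T1_def)
        moreover have "\<forall>\<^sub>F v in nhds (T x). in_charts c' d' \<phi> v = T2 (in_charts c' d \<phi> v)"
          using in_charts_comp[OF A(3,2,4) local_diffeos_Some \<phi>(1) zx \<phi>(4) refl \<phi>(5) y] by (simp add: T2_def)
        ultimately have "\<forall>\<^sub>F v in nhds (T x). in_charts c' d' \<phi> v = T2 (in_charts c d \<phi> (T1 v))"
          by eventually_elim simp
        note dec = iter_deriv_cong_ev(2)[OF this]
        have "iter_deriv bs (in_charts c' d' \<phi>) (T x) = \<Psi> bs p" if bs: "bs \<in> indices n" for bs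
        proof -
          have "\<forall>bs'\<in>indices (length bs). Poly_Mapping.lookup (snd p) bs' = iter_deriv bs' (in_charts c d \<phi>) (fst p)"
            using bs by (auto simp: p lookup_deriv_array indices_def)
          moreover have "smooth_at (in_charts c d \<phi>) (fst p)"
            unfolding fp by (rule smooth_at_in_charts[OF A(1,2) \<phi>(1,3,4,5)])
          ultimately show ?thesis using elim(3) bs dec fp by metis
        qed
        then show "jet_chart A n c' d' j = Some (K p)"
          unfolding C' K_def fp by (simp add: deriv_array_def)
      qed
    qed
  qed
qed

text \<open>All charts around the starting point are included because those supplied by the
  parametrization of a submanifold are not known in advance.\<close>

definition smooth_jet_curve :: "nat \<Rightarrow> (real \<Rightarrow> 'a diffeo_jet) \<Rightarrow> bool" where
  "smooth_jet_curve n \<gamma> \<longleftrightarrow> (\<forall>c\<in>A. \<forall>d\<in>A. \<gamma> 0 \<in> dom (jet_chart A n c d) \<longrightarrow>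
     (\<exists>\<sigma>. smooth_at \<sigma> 0 \<and> (\<forall>\<^sub>F t in nhds 0. jet_chart A n c d (\<gamma> t) = Some (\<sigma> t))))"

text \<open>The tangent vectors of \<open>R\<close> at \<open>j0\<close> are closed under differences: in a parametrization of \<open>R\<close> the curves
  can be subtracted. The charts in which the parametrization is smooth need not be the given ones.\<close>

lemma jet_tangent_diff:
  assumes R: "embedded_submanifold (jet_atlas A n) dm R"
    and k: "k \<in> A" "l \<in> A" "j0 \<in> dom (jet_chart A n k l)" "j0 \<in> R"
    and \<gamma>: "\<And>i. smooth_jet_curve n (\<gamma> i)" "\<And>i. \<gamma> i 0 = j0" "\<And>i. \<forall>\<^sub>F t in nhds 0. \<gamma> i t \<in> R"
    and \<tau>: "\<And>i. \<forall>\<^sub>F t in nhds 0. jet_chart A n k l (\<gamma> i t) = Some (\<tau> i t)" "\<And>i. (\<tau> i has_vector_derivative v i) (at 0)"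
  shows "v True - v False \<in> jet_tangent A n k l R j0"
proof -
  let ?X = "jet_atlas A n"
  from R[unfolded embedded_submanifold_def, rule_format, OF k(4)]
  obtain c1 where c1: "c1 \<in> ?X" "j0 \<in> dom c1" and "\<exists>U (B :: ('e \<times> ('e list \<Rightarrow>\<^sub>0 'e)) set) W f g. open U \<and> the (c1 j0) \<in> U \<and>
           finite B \<and> independent B \<and> card B = dm \<and> openin (top_of_set (span B)) W \<and>
           diffeo_between ?X {Some} {i \<in> R \<inter> dom c1. the (c1 i) \<in> U} W f g"
    by blast
  then obtain U and B :: "('e \<times> ('e list \<Rightarrow>\<^sub>0 'e)) set" and W f g where U: "open U" "the (c1 j0) \<in> U" and B: "finite B" "openin (top_of_set (span B)) W"
    and fg: "diffeo_between ?X {Some} {i \<in> R \<inter> dom c1. the (c1 i) \<in> U} W f g"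
    by blast
  define S where "S = {i \<in> R \<inter> dom c1. the (c1 i) \<in> U}"
  have j0S: "j0 \<in> S" using k(4) c1(2) U(2) by (simp add: S_def)
  have f: "\<And>i. i \<in> S \<Longrightarrow> f i \<in> W \<and> g (f i) = i" and g: "\<And>w. w \<in> W \<Longrightarrow> g w \<in> S"
    and sf: "smooth_map ?X {Some} S f" and sg: "smooth_map {Some} ?X W g"
    using fg unfolding diffeo_between_def S_def[symmetric] by auto
  obtain V where V: "open V" "W = V \<inter> span B" using B(2) unfolding openin_open by blast
  define w0 where "w0 = f j0"
  have w0: "w0 \<in> W" "g w0 = j0" using f[OF j0S] by (auto simp: w0_def)
  from sf[unfolded smooth_map_def, rule_format, OF j0S] obtain c2 U2 F where
    c2: "c2 \<in> ?X" "j0 \<in> dom c2" "open U2" "the (c2 j0) \<in> U2" "smooth U2 F"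
    and F': "\<forall>i\<in>S \<inter> dom c2. the (c2 i) \<in> U2 \<longrightarrow> f i \<in> dom Some \<and> the (Some (f i)) = F (the (c2 i))"
    by (elim bexE exE conjE, unfold singleton_iff, hypsubst_thin) blast
  have F: "f i = F (the (c2 i))" if "i \<in> S \<inter> dom c2" "the (c2 i) \<in> U2" for i using F' that by simp
  from sg[unfolded smooth_map_def, rule_format, OF w0(1)] obtain c3 U3 Gm where
    c3: "c3 \<in> ?X" "g w0 \<in> dom c3" "open U3" "the (Some w0) \<in> U3" "smooth U3 Gm"
    and G': "\<forall>w\<in>W \<inter> dom Some. the (Some w) \<in> U3 \<longrightarrow> g w \<in> dom c3 \<and> the (c3 (g w)) = Gm (the (Some w))"
    by (elim bexE exE conjE, unfold singleton_iff, hypsubst_thin) blast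
  note c3 = c3(1-3) c3(4)[unfolded option.sel] c3(5)
  have Gm: "g w \<in> dom c3 \<and> the (c3 (g w)) = Gm w" if "w \<in> W" "w \<in> U3" for w
    using G' that by auto
  have GmS: "c3 (g w) = Some (Gm w)" if "w \<in> W" "w \<in> U3" for w
    using Gm[OF that] by auto
  have chart_curve: "\<exists>\<sigma>. smooth_at \<sigma> 0 \<and> \<sigma> 0 = the (c j0) \<and> (\<forall>\<^sub>F t in nhds 0. c (\<gamma> i t) = Some (\<sigma> t))"
    if c: "c \<in> ?X" "j0 \<in> dom c" for c i
  proof -
    obtain c' d' where c': "c' \<in> A" "d' \<in> A" "c = jet_chart A n c' d'" using c(1) unfolding jet_atlas_def by blast
    have "\<gamma> i 0 \<in> dom (jet_chart A n c' d')" using c(2) \<gamma>(2)[of i] c'(3) by simp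
    from \<gamma>(1)[of i, unfolded smooth_jet_curve_def, rule_format, OF c'(1,2) this]
    obtain \<sigma> where \<sigma>: "smooth_at \<sigma> 0" "\<forall>\<^sub>F t in nhds 0. c (\<gamma> i t) = Some (\<sigma> t)"
      unfolding c'(3)[symmetric] by blast
    then have "\<sigma> 0 = the (c j0)" using eventually_nhds_x_imp_x[OF \<sigma>(2)] \<gamma>(2) by simp
    then show ?thesis using \<sigma> by blast
  qed
  have in_open: "\<forall>\<^sub>F t in nhds 0. \<sigma> t \<in> O'" if "smooth_at \<sigma> 0" "\<sigma> 0 \<in> O'" "open O'"
    for \<sigma> :: "real \<Rightarrow> 'e \<times> ('e list \<Rightarrow>\<^sub>0 'e)" and O'
    by (rule eventually_compose_isCont[OF smooth_at_isCont[OF that(1)] eventually_nhds_in_open[OF that(3,2)]])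
  have "\<forall>i. \<exists>\<sigma>. smooth_at \<sigma> 0 \<and> \<sigma> 0 = the (c2 j0) \<and> (\<forall>\<^sub>F t in nhds 0. c2 (\<gamma> i t) = Some (\<sigma> t))"
    using chart_curve[OF c2(1,2)] by blast
  from choice[OF this] obtain \<rho> where "\<forall>i. smooth_at (\<rho> i) 0 \<and> \<rho> i 0 = the (c2 j0) \<and> (\<forall>\<^sub>F t in nhds 0. c2 (\<gamma> i t) = Some (\<rho> i t))"
    by blast
  then have \<rho>: "\<And>i. smooth_at (\<rho> i) 0" "\<And>i. \<rho> i 0 = the (c2 j0)" "\<And>i. \<forall>\<^sub>F t in nhds 0. c2 (\<gamma> i t) = Some (\<rho> i t)"
    by simp_all
  have \<gamma>S: "\<forall>\<^sub>F t in nhds 0. \<gamma> i t \<in> S" for i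
  proof -
    obtain \<sigma> where \<sigma>: "smooth_at \<sigma> 0" "\<sigma> 0 = the (c1 j0)" "\<forall>\<^sub>F t in nhds 0. c1 (\<gamma> i t) = Some (\<sigma> t)"
      using chart_curve[OF c1] by blast
    have "\<forall>\<^sub>F t in nhds 0. \<sigma> t \<in> U" by (rule in_open[OF \<sigma>(1) _ U(1)]) (simp add: \<sigma>(2) U(2))
    with \<sigma>(3) \<gamma>(3)[of i] show ?thesis by eventually_elim (auto simp: S_def)
  qed
  \<comment> \<open>The given curves, read in the parameter space of \<open>R\<close>.\<close>
  define \<omega> where "\<omega> i t = F (\<rho> i t)" for i t
  have \<omega>f: "\<forall>\<^sub>F t in nhds 0. f (\<gamma> i t) = \<omega> i t \<and> \<omega> i t \<in> W \<and> \<gamma> i t = g (\<omega> i t)" for i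
    using \<gamma>S[of i] \<rho>(3)[of i] in_open[OF \<rho>(1) _ c2(3), of i, unfolded \<rho>(2), OF c2(4)]
  proof eventually_elim
    case (elim t)
    then have "f (\<gamma> i t) = \<omega> i t" using F[of "\<gamma> i t"] by (auto simp: \<omega>_def)
    then show ?case using f[OF elim(1)] by auto
  qed
  have \<omega>0: "\<omega> i 0 = w0" for i using eventually_nhds_x_imp_x[OF \<omega>f[of i]] unfolding \<gamma>(2) w0_def by argo
  have K_jets: "c \<in> ?X \<Longrightarrow> c j = Some p \<Longrightarrow> p \<in> {p. Poly_Mapping.keys (snd p) \<subseteq> indices n}" for c j p
    unfolding jet_atlas_def by (auto dest: subsetD[OF keys_jet_chart])
  have \<omega>: "smooth_at (\<omega> i) 0" for i
    unfolding \<omega>_def[abs_def]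
  proof (rule smooth_at_compose_coordinates[OF \<rho>(1) _ _ finite_coordinates_jets[OF finite_indices[of n]]])
    show "smooth_at F (\<rho> i 0)" unfolding \<rho>(2) by (rule smooth_atI[OF c2(5,3,4)])
    show "\<forall>\<^sub>F t in nhds 0. \<rho> i t \<in> {p. Poly_Mapping.keys (snd p) \<subseteq> indices n}"
      using \<rho>(3)[of i] by eventually_elim (rule K_jets[OF c2(1)])
  qed
  \<comment> \<open>In the parameter space curves can be subtracted. Adding \<open>w0\<close> lets
    the difference start there; it stays in \<open>span B\<close> and, near 0, in the open set
    \<open>V\<close>, hence in \<open>W\<close>.\<close>
  define \<delta> where "\<delta> t = \<omega> True t - \<omega> False t + w0" for t
  have \<delta>: "smooth_at \<delta> 0" unfolding \<delta>_def[abs_def] by (intro smooth_at_add smooth_at_diff \<omega> smooth_at_const)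
  have \<delta>0: "\<delta> 0 = w0" by (simp add: \<delta>_def \<omega>0)
  have \<delta>span: "\<forall>\<^sub>F t in nhds 0. \<delta> t \<in> span B"
    using \<omega>f[of True] \<omega>f[of False]
    by eventually_elim (use w0(1) V(2) in \<open>auto simp: \<delta>_def intro!: span_add span_diff\<close>)
  have \<delta>W: "\<forall>\<^sub>F t in nhds 0. \<delta> t \<in> W"
  proof -
    have "w0 \<in> V" using w0(1) V(2) by blast
    from \<delta>span in_open[OF \<delta> _ V(1), unfolded \<delta>0, OF this] show ?thesis by eventually_elim (simp add: V(2))
  qed
  have GmU: "smooth_at Gm w0" by (rule smooth_atI[OF c3(5,3,4)])
  have \<delta>G: "\<forall>\<^sub>F t in nhds 0. c3 (g (\<delta> t)) = Some (Gm (\<delta> t)) \<and> g (\<delta> t) \<in> R"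
    using \<delta>W in_open[OF \<delta> _ c3(3), unfolded \<delta>0, OF c3(4)]
  proof eventually_elim
    case (elim t)
    then show ?case using Gm[of "\<delta> t"] g[of "\<delta> t"] by (auto simp: S_def)
  qed
  obtain c3' d3' where c3': "c3' \<in> A" "d3' \<in> A" "c3 = jet_chart A n c3' d3'" using c3(1) unfolding jet_atlas_def by blast
  have p0: "jet_chart A n c3' d3' j0 = Some (Gm w0)"
    using eventually_nhds_x_imp_x[OF \<delta>G] \<delta>0 w0(2) c3'(3) by simp
  obtain K where K: "smooth_at K (Gm w0)" "\<forall>\<^sub>F p in nhds (Gm w0). \<forall>j. jet_chart A n c3' d3' j = Some p \<longrightarrow> jet_chart A n k l j = Some (K p)"
    by (rule jet_chart_change[OF c3'(1,2) k(1,2) p0 k(3)])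
  have G\<delta>: "smooth_at (\<lambda>t. Gm (\<delta> t)) 0"
    by (rule smooth_at_compose_coordinates[OF \<delta> _ \<delta>span finite_coordinates_span[OF B(1)]]) (simp add: \<delta>0 GmU)
  define \<zeta> where "\<zeta> t = K (Gm (\<delta> t))" for t
  have \<zeta>: "smooth_at \<zeta> 0"
    unfolding \<zeta>_def[abs_def]
  proof (rule smooth_at_compose_coordinates[OF G\<delta> _ _ finite_coordinates_jets[OF finite_indices[of n]]])
    show "smooth_at K (Gm (\<delta> 0))" using K(1) \<delta>0 by simp
    show "\<forall>\<^sub>F t in nhds 0. Gm (\<delta> t) \<in> {p. Poly_Mapping.keys (snd p) \<subseteq> indices n}"
      using \<delta>G by eventually_elim (use K_jets[OF c3(1)] in blast)
  qed
  have transfer: "\<forall>\<^sub>F t in nhds 0. jet_chart A n k l (g (\<eta> t)) = Some (K (Gm (\<eta> t)))"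
    if "isCont \<eta> 0" "\<eta> 0 = w0" "\<forall>\<^sub>F t in nhds 0. c3 (g (\<eta> t)) = Some (Gm (\<eta> t))" for \<eta> :: "real \<Rightarrow> _"
  proof -
    have "isCont (\<lambda>t. Gm (\<eta> t)) 0"
      using isCont_o2[OF that(1), of Gm] smooth_at_isCont[OF GmU] that(2) by simp
    from eventually_compose_isCont[OF this, of "\<lambda>p. \<forall>j. jet_chart A n c3' d3' j = Some p \<longrightarrow> jet_chart A n k l j = Some (K p)"] K(2)
    have "\<forall>\<^sub>F t in nhds 0. \<forall>j. jet_chart A n c3' d3' j = Some (Gm (\<eta> t)) \<longrightarrow> jet_chart A n k l j = Some (K (Gm (\<eta> t)))"
      by (simp add: that(2))
    with that(3) show ?thesis unfolding c3'(3) by eventually_elim blast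
  qed
  have \<zeta>C: "\<forall>\<^sub>F t in nhds 0. jet_chart A n k l (g (\<delta> t)) = Some (\<zeta> t)"
    unfolding \<zeta>_def by (rule transfer[OF smooth_at_isCont[OF \<delta>] \<delta>0]) (use \<delta>G in eventually_elim, blast)
  have \<omega>C: "\<forall>\<^sub>F t in nhds 0. \<tau> i t = K (Gm (\<omega> i t))" for i
  proof -
    have "\<forall>\<^sub>F t in nhds 0. c3 (g (\<omega> i t)) = Some (Gm (\<omega> i t))"
      using \<omega>f[of i] in_open[OF \<omega> _ c3(3), of i, unfolded \<omega>0, OF c3(4)]
      by eventually_elim (blast intro: GmS)
    from transfer[OF smooth_at_isCont[OF \<omega>] \<omega>0 this] \<tau>(1)[of i] \<omega>f[of i]
    show ?thesis by eventually_elim simp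
  qed
  \<comment> \<open>\<open>K\<close> after \<open>Gm\<close> extends the parametrization as read in
    the charts \<open>k\<close> and \<open>l\<close>. All velocities are images under its one
    differential \<open>D\<close> at \<open>w0\<close>, and linearity of \<open>D\<close> gives the
    claim.\<close>
  have "(\<lambda>w. K (Gm w)) differentiable (at w0)"
    by (rule differentiable_compose_at[OF smooth_at_differentiable[OF GmU] smooth_at_differentiable[OF K(1)]])
  then obtain D where D: "((\<lambda>w. K (Gm w)) has_derivative D) (at w0)" unfolding differentiable_def by blast
  define a where "a i = vector_derivative (\<omega> i) (at 0)" for i
  have a: "(\<omega> i has_vector_derivative a i) (at 0)" for i
    unfolding a_def using smooth_at_differentiable[OF \<omega>, of i] vector_derivative_works by blast
  have chain: "((\<lambda>t. K (Gm (\<eta> t))) has_vector_derivative D u) (at 0)" if "(\<eta> has_vector_derivative u) (at 0)" "\<eta> 0 = w0" for \<eta> u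
  proof -
    have "((\<lambda>t. K (Gm (\<eta> t))) has_derivative (\<lambda>s. D (s *\<^sub>R u))) (at 0)"
      using has_derivative_compose[of \<eta> "\<lambda>s. s *\<^sub>R u" 0 UNIV "\<lambda>w. K (Gm w)" D] that D
      by (simp add: has_vector_derivative_def)
    then show ?thesis unfolding has_vector_derivative_def using linear_scale[OF has_derivative_linear[OF D]] by simp
  qed
  have vD: "v i = D (a i)" for i
  proof -
    have "((\<lambda>t. K (Gm (\<omega> i t))) has_vector_derivative v i) (at 0)"
    proof -
      have ev: "\<forall>\<^sub>F t in at 0. \<tau> i t = K (Gm (\<omega> i t))"
        using \<omega>C[of i] by (simp add: eventually_at_filter eventually_mono)
      show ?thesis
        using \<tau>(2)[of i] has_derivative_transform_eventually[OF _ ev] eventually_nhds_x_imp_x[OF \<omega>C[of i]]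
        unfolding has_vector_derivative_def by auto
    qed
    then show ?thesis using chain[OF a \<omega>0] vector_derivative_unique_at by blast
  qed
  have "(\<delta> has_vector_derivative (a True - a False)) (at 0)"
    unfolding \<delta>_def[abs_def]
    using has_vector_derivative_add[OF has_vector_derivative_diff[OF a[of True] a[of False]] has_vector_derivative_const[of w0]] by simp
  from chain[OF this \<delta>0] have "(\<zeta> has_vector_derivative D (a True - a False)) (at 0)" unfolding \<zeta>_def[abs_def] .
  moreover have "D (a True - a False) = v True - v False" using linear_diff[OF has_derivative_linear[OF D]] vD by simp
  ultimately have d\<zeta>: "(\<zeta> has_vector_derivative v True - v False) (at 0)" by simp
  obtain O1 where O1: "open O1" "0 \<in> O1" "smooth O1 \<zeta>" using \<zeta> unfolding smooth_at_def by blast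
  have "\<forall>\<^sub>F t in nhds 0. t \<in> O1 \<and> \<zeta> t \<in> (the \<circ> jet_chart A n k l) ` (R \<inter> dom (jet_chart A n k l))"
    using eventually_nhds_in_open[OF O1(1,2)] \<zeta>C \<delta>G
  proof eventually_elim
    case (elim t)
    then show ?case by (auto intro!: image_eqI[of _ _ "g (\<delta> t)"])
  qed
  then obtain e where e: "0 < e" "\<And>t. dist t 0 < e \<Longrightarrow> t \<in> O1 \<and> \<zeta> t \<in> (the \<circ> jet_chart A n k l) ` (R \<inter> dom (jet_chart A n k l))"
    unfolding eventually_nhds_metric by blast
  have "smooth {-e<..<e} \<zeta>" by (rule smooth_subset[OF O1(3)]) (use e(2) in \<open>auto simp: dist_real_def\<close>)
  moreover have "\<zeta> ` {-e<..<e} \<subseteq> (the \<circ> jet_chart A n k l) ` (R \<inter> dom (jet_chart A n k l))"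
    using e(2) by (auto simp: dist_real_def)
  moreover have "\<zeta> 0 = the (jet_chart A n k l j0)"
    using eventually_nhds_x_imp_x[OF \<zeta>C] \<delta>0 w0(2) by simp
  ultimately show ?thesis unfolding jet_tangent_def tangent_vectors_def using e(1) d\<zeta> by blast
qed

text \<open>The line is straight in \<open>k\<close> while the jets are read in arbitrary charts
  \<open>c\<close> and \<open>d\<close>, as \<open>smooth_jet_curve\<close> demands; hence the
  transition from \<open>k\<close> to \<open>c\<close> inside \<sigma>.\<close>

lemma smooth_jet_curve_line:
  fixes n :: nat and u :: 'e
  assumes \<phi>: "\<phi> \<in> local_diffeos A" "\<phi> z = Some z" and k: "k \<in> A" "k z = Some a"
    and c: "c \<in> A" "d \<in> A" "z \<in> dom c" "z \<in> dom d"
  defines "\<sigma> \<equiv> \<lambda>t. let x = in_charts k c Some (a + t *\<^sub>R u) in (x, deriv_array n (in_charts c d \<phi>) x)"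
  shows "smooth_at \<sigma> 0" "\<forall>\<^sub>F t in nhds 0. the (pinv k (a + t *\<^sub>R u)) \<in> dom \<phi> \<and> jet_chart A n c d (jet A n \<phi> (the (pinv k (a + t *\<^sub>R u)))) = Some (\<sigma> t)"
proof -
  have l: "smooth_at (\<lambda>t::real. a + t *\<^sub>R u) 0"
    by (intro smooth_at_add smooth_at_const smooth_at_bounded_linear bounded_linear_scaleR_left)
  define T where "T = in_charts k c Some"
  obtain x where x: "c z = Some x" using c(3) by auto
  have Ta: "T a = x" using in_charts_eq[of k z a Some z c] k x by (simp add: T_def)
  have T: "smooth_at T a" unfolding T_def by (rule smooth_at_in_charts[OF k(1) c(1) local_diffeos_Some k(2) refl c(3)])
  have Tl: "smooth_at (\<lambda>t. T (a + t *\<^sub>R u)) 0"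
    by (rule smooth_at_compose[OF l]) (simp add: T)
  have J: "smooth_at (\<lambda>x. (x, deriv_array n (in_charts c d \<phi>) x)) x"
    by (intro smooth_at_Pair smooth_at_id smooth_at_deriv_array smooth_at_in_charts[OF c(1,2) \<phi>(1) x \<phi>(2) c(4)])
  have "smooth_at (\<lambda>t. (T (a + t *\<^sub>R u), deriv_array n (in_charts c d \<phi>) (T (a + t *\<^sub>R u)))) 0"
    by (rule smooth_at_compose[where g = "\<lambda>x. (x, deriv_array n (in_charts c d \<phi>) x)", OF Tl]) (simp add: Ta J)
  then show "smooth_at \<sigma> 0" by (simp add: \<sigma>_def T_def[symmetric] Let_def)
  have "\<forall>\<^sub>F x' in nhds a. \<exists>z'. k z' = Some x' \<and> c z' = Some (T x')"
    using eventually_in_charts[OF k(1) c(1) local_diffeos_Some k(2) refl c(3)] unfolding T_def by eventually_elim auto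
  moreover have "\<forall>\<^sub>F x' in nhds a. \<exists>z' y'. k z' = Some x' \<and> \<phi> z' = Some y' \<and> d y' = Some (in_charts k d \<phi> x')"
    by (rule eventually_in_charts[OF k(1) c(2) \<phi>(1) k(2) \<phi>(2) c(4)])
  ultimately have "\<forall>\<^sub>F x' in nhds a. the (pinv k x') \<in> dom \<phi> \<and>
      jet_chart A n c d (jet A n \<phi> (the (pinv k x'))) = Some (T x', deriv_array n (in_charts c d \<phi>) (T x'))"
  proof eventually_elim
    case (elim x')
    then obtain z' y' z'' where *: "k z' = Some x'" "\<phi> z' = Some y'" "y' \<in> dom d" "k z'' = Some x'" "c z'' = Some (T x')" by blast
    have "z'' = z'" using * chart_pinj[OF k(1)] unfolding pinj_def by blast
    then show ?case using jet_chart_jet[OF c(1,2) \<phi>(1) _ *(2,3), of "T x'" n] * chart_inverse[OF k(1) *(1)] by auto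
  qed
  from eventually_compose_isCont[where f = "\<lambda>t::real. a + t *\<^sub>R u" and a = 0, OF smooth_at_isCont[OF l]] this
  show "\<forall>\<^sub>F t in nhds 0. the (pinv k (a + t *\<^sub>R u)) \<in> dom \<phi> \<and> jet_chart A n c d (jet A n \<phi> (the (pinv k (a + t *\<^sub>R u)))) = Some (\<sigma> t)"
    by (simp add: \<sigma>_def T_def[symmetric] Let_def)
qed

text \<open>Both \<theta> and \<open>e\<close> have the \<open>n\<close>-jet of the identity at
  \<open>z\<close>, so both curves of jets start at the identity jet. Their velocities share the
  source component \<open>u\<close>, which cancels and leaves the first component 0 required by
  \<open>inf_determining_eqs\<close>.\<close>

lemma dir_deriv_satisfies_inf_determining_eqs:
  assumes G: "G \<subseteq> local_diffeos A" and e: "e \<in> G" "same_jet A n z e Some" and emb: "embedded_submanifold (jet_atlas A n) dm (jets A n G)"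
    and \<theta>: "\<theta> \<in> G" "same_jet A n z \<theta> Some" and k: "k \<in> A" "k z = Some a"
  shows "inf_determining_eqs A G n k z (deriv_array n (dir_deriv u (\<lambda>x. in_charts k k \<theta> x - in_charts k k e x)) a)"
proof -
  have \<theta>L: "\<theta> \<in> local_diffeos A" using G \<theta>(1) by blast
  have eL: "e \<in> local_diffeos A" using G e(1) by blast
  have ez: "e z = Some z" using e(2) unfolding same_jet_def by simp
  have \<theta>z: "\<theta> z = Some z" using \<theta>(2) unfolding same_jet_def by simp
  have zk: "z \<in> dom k" using k by auto
  define ph where "ph i = (if i then \<theta> else e)" for i
  have ph: "ph i \<in> G" "ph i \<in> local_diffeos A" "ph i z = Some z" for i
    using e \<theta> \<theta>L \<theta>z eL ez by (auto simp: ph_def)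
  define \<gamma> where "\<gamma> i t = jet A n (ph i) (the (pinv k (a + t *\<^sub>R u)))" for i t
  have pk: "pinv k a = Some z" by (rule chart_inverse[OF k])
  have \<gamma>0: "\<gamma> i 0 = identity_jet A n z" for i
    using jet_eq_iff[OF \<theta>L, of z n Some] jet_eq_iff[OF eL, of z n Some] \<theta>(2) e(2) \<theta>z ez pk
    by (auto simp: \<gamma>_def ph_def identity_jet_def)
  have dom0: "z \<in> dom c \<and> z \<in> dom d" if "identity_jet A n z \<in> dom (jet_chart A n c d)" for c d
  proof -
    have "z \<in> dom (Some :: 'a \<Rightarrow> 'a option)" by auto
    from jet_target_jet[OF local_diffeos_Some this, of n] show ?thesis
      using that by (auto simp: identity_jet_def jet_chart_def jet_source_jet split: if_splits)
  qed
  have line: "smooth_at (\<lambda>t. let x = in_charts k c Some (a + t *\<^sub>R u) in (x, deriv_array n (in_charts c d (ph i)) x)) 0"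
     "\<forall>\<^sub>F t in nhds 0. the (pinv k (a + t *\<^sub>R u)) \<in> dom (ph i) \<and> jet_chart A n c d (\<gamma> i t) =
        Some (let x = in_charts k c Some (a + t *\<^sub>R u) in (x, deriv_array n (in_charts c d (ph i)) x))"
    if "c \<in> A" "d \<in> A" "z \<in> dom c" "z \<in> dom d" for c d i
    unfolding \<gamma>_def by (rule smooth_jet_curve_line[OF ph(2,3) k that])+
  have curve: "smooth_jet_curve n (\<gamma> i)" for i
    unfolding smooth_jet_curve_def \<gamma>0
  proof (intro ballI impI)
    fix c d assume c: "c \<in> A" "d \<in> A" "identity_jet A n z \<in> dom (jet_chart A n c d)"
    from line[OF c(1,2), of i] dom0[OF c(3)]
    show "\<exists>\<sigma>. smooth_at \<sigma> 0 \<and> (\<forall>\<^sub>F t in nhds 0. jet_chart A n c d (\<gamma> i t) = Some (\<sigma> t))"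
      by (intro exI[of _ "\<lambda>t. let x = in_charts k c Some (a + t *\<^sub>R u) in (x, deriv_array n (in_charts c d (ph i)) x)"])
        (auto elim: eventually_mono)
  qed
  have \<gamma>R: "\<forall>\<^sub>F t in nhds 0. \<gamma> i t \<in> jets A n G" for i
    using line(2)[OF k(1,1) zk zk, of i] by eventually_elim (use ph in \<open>auto simp: \<gamma>_def jets_def\<close>)
  define f where "f i = in_charts k k (ph i)" for i
  have f: "smooth_at (f i) a" for i unfolding f_def by (rule smooth_at_in_charts[OF k(1,1) ph(2) k(2) ph(3) zk])
  define \<tau> where "\<tau> i t = (a + t *\<^sub>R u, deriv_array n (f i) (a + t *\<^sub>R u))" for i t
  have \<tau>: "\<forall>\<^sub>F t in nhds 0. jet_chart A n k k (\<gamma> i t) = Some (\<tau> i t)" for i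
  proof -
    have l: "isCont (\<lambda>t::real. a + t *\<^sub>R u) 0" by (intro continuous_intros)
    have "\<forall>\<^sub>F t in nhds (0::real). in_charts k k Some (a + t *\<^sub>R u) = a + t *\<^sub>R u"
      using eventually_compose_isCont[OF l, of "\<lambda>x. in_charts k k Some x = x"] in_charts_Some_id[OF k] by simp
    with line(2)[OF k(1,1) zk zk, of i] show ?thesis
      by eventually_elim (simp add: \<tau>_def f_def Let_def)
  qed
  define v where "v i = (u, \<Sum>bs\<in>indices n. Poly_Mapping.single bs (dir_deriv u (iter_deriv bs (f i)) a))" for i
  have d\<tau>: "(\<tau> i has_vector_derivative v i) (at 0)" for i
  proof -
    have l: "((\<lambda>t::real. a + t *\<^sub>R u) has_derivative (\<lambda>s. s *\<^sub>R u)) (at 0)" by (auto intro!: derivative_eq_intros)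
    have fa: "smooth_at (f i) (a + 0 *\<^sub>R u)" using f by simp
    have "(\<tau> i has_derivative (\<lambda>s. (s *\<^sub>R u, \<Sum>bs\<in>indices n. Poly_Mapping.single bs (dir_deriv (s *\<^sub>R u) (iter_deriv bs (f i)) (a + 0 *\<^sub>R u))))) (at 0)"
      unfolding \<tau>_def[abs_def]
      by (rule has_derivative_Pair[OF l has_derivative_compose[OF l has_derivative_deriv_array[OF fa]]])
    moreover have "(s *\<^sub>R u, \<Sum>bs\<in>indices n. Poly_Mapping.single bs (dir_deriv (s *\<^sub>R u) (iter_deriv bs (f i)) (a + 0 *\<^sub>R u))) = s *\<^sub>R v i" for s
    proof -
      have "dir_deriv (s *\<^sub>R u) (iter_deriv bs (f i)) a = s *\<^sub>R dir_deriv u (iter_deriv bs (f i)) a" for bs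
        by (rule dir_deriv_scaleR_direction[OF smooth_at_differentiable[OF smooth_at_iter_deriv[OF f]]])
      then show ?thesis
        unfolding v_def by (simp add: scaleR_sum_right linear_scale[OF bounded_linear.linear[OF bounded_linear_single]])
    qed
    ultimately show ?thesis by (simp add: has_vector_derivative_def)
  qed
  have id_jet: "identity_jet A n z \<in> jets A n G" 
    unfolding jets_def mem_Collect_eq using \<gamma>0[of False] e(1) ez pk
    by (intro exI[of _ e] exI[of _ z]) (auto simp: \<gamma>_def ph_def)
  have id_dom: "identity_jet A n z \<in> dom (jet_chart A n k k)"
    unfolding identity_jet_def using jet_chart_jet[OF k(1,1) local_diffeos_Some k(2) refl zk] by auto
  have "v True - v False \<in> jet_tangent A n k k (jets A n G) (identity_jet A n z)"
    by (rule jet_tangent_diff[OF emb k(1,1) id_dom id_jet curve \<gamma>0 \<gamma>R \<tau> d\<tau>])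
  moreover have "v True - v False = (0, deriv_array n (dir_deriv u (\<lambda>x. f True x - f False x)) a)"
  proof -
    \<comment> \<open>The velocity of the array has \<open>u\<close> as outermost direction, the
      array of \<open>dir_deriv u\<close> has it innermost; symmetry of derivatives identifies
      them.\<close>
    have "iter_deriv bs (dir_deriv u (\<lambda>x. f True x - f False x)) a = dir_deriv u (iter_deriv bs (f True)) a - dir_deriv u (iter_deriv bs (f False)) a" for bs
    proof -
      have "iter_deriv bs (dir_deriv u (\<lambda>x. f True x - f False x)) a = iter_deriv (u # bs) (\<lambda>x. f True x - f False x) a"
        unfolding iter_deriv_Cons' by (rule iter_deriv_dir_deriv_commute[OF smooth_at_diff[OF f f]])
      also have "\<dots> = iter_deriv (u # bs) (f True) a - iter_deriv (u # bs) (f False) a" by (rule iter_deriv_diff[OF f f])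
      finally show ?thesis unfolding iter_deriv_Cons' .
    qed
    then show ?thesis by (simp add: v_def deriv_array_def single_diff sum_subtractf)
  qed
  ultimately show ?thesis unfolding inf_determining_eqs_def by (simp add: f_def ph_def)
qed

end

section \<open>Jets of flows\<close>

lemma norm_diff_le_vector_derivative_bound:
  fixes y :: "real \<Rightarrow> 'e::real_normed_vector"
  assumes "0 \<le> s" "\<And>t. t \<in> {0..s} \<Longrightarrow> (y has_vector_derivative y' t) (at t within {0..s})"
    "\<And>t. t \<in> {0..s} \<Longrightarrow> norm (y' t) \<le> B"
  shows "norm (y s - y 0) \<le> B * s"
proof -
  have "norm (y s - y 0) \<le> B * norm (s - 0)"
  proof (rule differentiable_bound[of "{0..s}" y "\<lambda>t h. h *\<^sub>R y' t"])
    show "onorm (\<lambda>h. h *\<^sub>R y' t) \<le> B" if "t \<in> {0..s}" for t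
      using assms(3)[OF that] by (intro onorm_le) (simp add: mult.commute[of B] mult_left_mono)
  qed (use assms in \<open>auto simp: has_vector_derivative_def\<close>)
  then show ?thesis using assms(1) by simp
qed

text \<open>The gradient vanishes at \<open>a\<close>, so it is of order r on the ball of radius r
  and the Lipschitz constant shrinks with the ball. This makes integral curves unique and supplies
  the last power of r in the flow estimate.\<close>

lemma lipschitz_if_flat:
  fixes f :: "'x::euclidean_space \<Rightarrow> 'y::real_normed_vector"
  assumes "smooth_at f a" "\<And>vs. length vs < 2 \<Longrightarrow> iter_deriv vs f a = 0"
  obtains C d where "0 \<le> C" "0 < d"
    "\<And>r x y. r \<le> d \<Longrightarrow> x \<in> cball a r \<Longrightarrow> y \<in> cball a r \<Longrightarrow> norm (f x - f y) \<le> C * r * norm (x - y)"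
proof -
  have "\<exists>C. \<forall>\<^sub>F x in nhds a. norm (dir_deriv b f x) \<le> C * dist a x ^ 1" for b
  proof (rule bigo_if_iter_deriv_eq_0[OF smooth_at_dir_deriv[OF assms(1)]])
    show "iter_deriv vs (dir_deriv b f) a = 0" if "length vs < 1" for vs
      unfolding iter_deriv_snoc[symmetric] using that by (intro assms(2)) simp
  qed
  then have "\<forall>b. \<exists>C. \<forall>\<^sub>F x in nhds a. norm (dir_deriv b f x) \<le> C * dist a x" by simp
  from choice[OF this] obtain C where C: "\<forall>b. \<forall>\<^sub>F x in nhds a. norm (dir_deriv b f x) \<le> C b * dist a x" by blast
  have "\<forall>\<^sub>F x in nhds a. \<forall>b\<in>Basis. norm (dir_deriv b f x) \<le> C b * dist a x"
    using C by (intro eventually_ball_finite) auto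
  with smooth_at_eventually[OF assms(1)]
  have "\<forall>\<^sub>F x in nhds a. smooth_at f x \<and> (\<forall>b\<in>Basis. norm (dir_deriv b f x) \<le> C b * dist a x)"
    by eventually_elim auto
  then obtain e where e: "0 < e" "\<And>x. dist x a < e \<Longrightarrow> smooth_at f x \<and> (\<forall>b\<in>Basis. norm (dir_deriv b f x) \<le> C b * dist a x)"
    unfolding eventually_nhds_metric by blast
  show thesis
  proof (rule that[of "\<Sum>b\<in>Basis. \<bar>C b\<bar>" "e / 2"])
    fix r x y assume r: "r \<le> e / 2" "x \<in> cball a r" "y \<in> cball a r"
    have "norm (f x - f y) \<le> (\<Sum>b\<in>Basis. \<bar>C b\<bar> * r) * norm (x - y)"
    proof (rule norm_diff_le_dir_deriv_bound[OF convex_cball _ _ r(2,3)])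
      fix u assume u: "u \<in> cball a r"
      then have ue: "dist u a < e" using r(1) e(1) by (simp add: dist_commute)
      show "f differentiable (at u)" using e(2)[OF ue] smooth_at_differentiable by blast
      fix b :: 'x assume "b \<in> Basis"
      then have "norm (dir_deriv b f u) \<le> C b * dist a u" using e(2)[OF ue] by blast
      also have "\<dots> \<le> \<bar>C b\<bar> * r" using u by (intro mult_mono) auto
      finally show "norm (dir_deriv b f u) \<le> \<bar>C b\<bar> * r" .
    qed
    then show "norm (f x - f y) \<le> (\<Sum>b\<in>Basis. \<bar>C b\<bar>) * r * norm (x - y)" by (simp add: sum_distrib_right)
  qed (use e in auto)
qed

lemma bigo_ball:
  assumes "\<exists>C. \<forall>\<^sub>F x in nhds a. norm (f x) \<le> C * dist a x ^ m"
  obtains C d where "0 \<le> C" "0 < d" "\<And>r x. r \<le> d \<Longrightarrow> x \<in> cball a r \<Longrightarrow> norm (f x) \<le> C * r ^ m"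
proof -
  obtain C where "\<forall>\<^sub>F x in nhds a. norm (f x) \<le> C * dist a x ^ m" using assms by blast
  then obtain e where e: "0 < e" "\<And>x. dist x a < e \<Longrightarrow> norm (f x) \<le> C * dist a x ^ m"
    unfolding eventually_nhds_metric by blast
  show thesis
  proof (rule that[of "\<bar>C\<bar>" "e / 2"])
    fix r x assume r: "r \<le> e / 2" "x \<in> cball a r"
    then have "norm (f x) \<le> C * dist a x ^ m" using e by (intro e(2)) (simp add: dist_commute)
    also have "\<dots> \<le> \<bar>C\<bar> * r ^ m" using r by (intro mult_mono power_mono) auto
    finally show "norm (f x) \<le> \<bar>C\<bar> * r ^ m" .
  qed (use e in auto)
qed

context manifold
begin

lemma smooth_at_vector_field:
  assumes "vector_field A V Y" "z \<in> V" "k \<in> A" "k z = Some a"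
  obtains W where "open W" "a \<in> W" "smooth W (\<lambda>x. Y k (the (pinv k x)))" "W \<subseteq> ran k" "\<And>x. x \<in> W \<Longrightarrow> the (pinv k x) \<in> V"
proof -
  define W where "W = ran k \<inter> (the \<circ> pinv k) -` V"
  have V: "open V" and s: "smooth ((the \<circ> k) ` (V \<inter> dom k)) (\<lambda>x. Y k (the (pinv k x)))"
    using assms(1,3) unfolding vector_field_def by auto
  have W: "open W" unfolding W_def by (rule continuous_open_preimage[OF chart_continuous(2)[OF assms(3)] chart_open(2)[OF assms(3)] V])
  have "W \<subseteq> (the \<circ> k) ` (V \<inter> dom k)"
  proof
    fix x assume x: "x \<in> W"
    then obtain m where m: "k m = Some x" unfolding W_def ran_def by blast
    then show "x \<in> (the \<circ> k) ` (V \<inter> dom k)"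
      using x chart_inverse[OF assms(3) m] by (intro image_eqI[of _ _ m]) (auto simp: W_def)
  qed
  moreover have "a \<in> W" using assms chart_inverse[OF assms(3,4)] by (auto simp: W_def ran_def)
  ultimately show thesis using that[OF W _ smooth_subset[OF s]] by (auto simp: W_def)
qed

text \<open>The flow map is a local diffeomorphism by assumption, so its domain is open and no existence theorem
  for integral curves is needed. Their uniqueness is needed, as \<open>flow\<close> is defined by a \<open>THE\<close>. A curve that
  starts at distance \<open>r\<close> from the zero \<open>a\<close> of the field stays at distance at most \<open>2 r\<close> up to time one, as the
  field is of order \<open>r\<^sup>2\<close> there.\<close>

lemma flow_jets_agree:
  assumes Y: "vector_field A V Y" "z \<in> V" and k: "k \<in> A" "k z = Some a" and flow: "flow A V Y 1 \<in> local_diffeos A"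
    and N: "2 \<le> N"
  defines "\<eta> \<equiv> \<lambda>x. Y k (the (pinv k x))"
  assumes flat: "\<And>vs. length vs < N \<Longrightarrow> iter_deriv vs \<eta> a = 0"
  shows "flow A V Y 1 z = Some z" "jets_agree N (in_charts k k (flow A V Y 1)) (\<lambda>x. x + \<eta> x) a"
proof -
  obtain W where W: "open W" "a \<in> W" "smooth W \<eta>" "W \<subseteq> ran k" "\<And>x. x \<in> W \<Longrightarrow> the (pinv k x) \<in> V"
    using smooth_at_vector_field[OF Y k] unfolding \<eta>_def by blast
  have \<eta>: "smooth_at \<eta> a" by (rule smooth_atI[OF W(3,1,2)])
  obtain C1 d1 where C1: "0 \<le> C1" "0 < d1" "\<And>r x. r \<le> d1 \<Longrightarrow> x \<in> cball a r \<Longrightarrow> norm (\<eta> x) \<le> C1 * r ^ N"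
    by (rule bigo_ball[OF bigo_if_iter_deriv_eq_0[OF \<eta> flat]]) auto
  obtain C2 d2 where C2: "0 \<le> C2" "0 < d2" "\<And>r x. r \<le> d2 \<Longrightarrow> x \<in> cball a r \<Longrightarrow> norm (\<eta> x) \<le> C2 * r ^ 2"
    by (rule bigo_ball[OF bigo_if_iter_deriv_eq_0[OF \<eta>, of 2]]) (use flat N in auto)
  obtain C3 d3 where C3: "0 \<le> C3" "0 < d3"
    "\<And>r x y. r \<le> d3 \<Longrightarrow> x \<in> cball a r \<Longrightarrow> y \<in> cball a r \<Longrightarrow> norm (\<eta> x - \<eta> y) \<le> C3 * r * norm (x - y)"
    by (rule lipschitz_if_flat[OF \<eta>]) (use flat N in auto)
  obtain d4 where d4: "0 < d4" "cball a d4 \<subseteq> W" using W(1,2) open_contains_cball by blast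
  \<comment> \<open>The halves make room for balls of radius \<open>2 * r\<close>. The last two
    entries make the field at most \<open>r / 2\<close> and its Lipschitz constant at most 1/2
    there; adding 1 keeps the denominators positive.\<close>
  define r0 where "r0 = Min {d1 / 2, d2 / 2, d3 / 2, d4 / 2, 1 / (8 * C2 + 1), 1 / (4 * C3 + 1)}"
  have r0: "0 < r0" "r0 \<le> d1 / 2" "r0 \<le> d2 / 2" "r0 \<le> d3 / 2" "r0 \<le> d4 / 2" "r0 \<le> 1 / (8 * C2 + 1)" "r0 \<le> 1 / (4 * C3 + 1)"
    using C1 C2 C3 d4 by (auto simp: r0_def)
  have small: "2 * r \<le> d1" "2 * r \<le> d2" "2 * r \<le> d3" "cball a (2 * r) \<subseteq> W" "C2 * (2 * r)\<^sup>2 \<le> r / 2" "C3 * (2 * r) \<le> 1 / 2"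
    if r: "0 < r" "r \<le> r0" for r
  proof -
    have "r \<le> 1 / (8 * C2 + 1)" "r \<le> 1 / (4 * C3 + 1)" using r(2) r0(6,7) by auto
    then have r1: "r * (8 * C2 + 1) \<le> 1" and r2: "r * (4 * C3 + 1) \<le> 1"
      using C2(1) C3(1) by (simp_all add: pos_le_divide_eq)
    show "2 * r \<le> d1" "2 * r \<le> d2" "2 * r \<le> d3" using r r0 by auto
    have "2 * r \<le> d4" using r r0 by auto
    then show "cball a (2 * r) \<subseteq> W" using d4(2) subset_cball[of "2 * r" d4 a] by blast
    have "8 * C2 * r \<le> 1" using r1 r by (simp add: algebra_simps)
    then have "8 * C2 * r * r \<le> 1 * r" using r by (intro mult_right_mono) auto
    then show "C2 * (2 * r)\<^sup>2 \<le> r / 2" by (simp add: power2_eq_square)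
    show "C3 * (2 * r) \<le> 1 / 2" using r r2 by (simp add: algebra_simps)
  qed
  have seg: "closed_segment 0 1 = {0..1::real}" by (simp add: closed_segment_eq_real_ivl)
  have ic: "continuous_on {0..1} \<gamma>" "\<And>s. s \<in> {0..1} \<Longrightarrow> \<gamma> s \<in> V"
    "\<And>s c. s \<in> {0..1} \<Longrightarrow> c \<in> A \<Longrightarrow> \<gamma> s \<in> dom c \<Longrightarrow> ((\<lambda>r. the (c (\<gamma> r))) has_vector_derivative Y c (\<gamma> s)) (at s within {0..1})"
    if "integral_curve A V Y 1 \<gamma>" for \<gamma> using that unfolding integral_curve_def seg by auto
  have ode: "((\<lambda>r. the (k (\<gamma> r))) has_vector_derivative \<eta> (the (k (\<gamma> s)))) (at s within {0..t})"
    if c: "integral_curve A V Y 1 \<gamma>" "s \<in> {0..t}" "t \<le> 1" "\<gamma> s \<in> dom k" for \<gamma> s t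
  proof -
    obtain u where u: "k (\<gamma> s) = Some u" using c(4) by auto
    have "\<eta> (the (k (\<gamma> s))) = Y k (\<gamma> s)" using chart_inverse[OF k(1) u] u by (simp add: \<eta>_def)
    moreover have "((\<lambda>r. the (k (\<gamma> r))) has_vector_derivative Y k (\<gamma> s)) (at s within {0..1})"
      using ic(3)[OF c(1) _ k(1) c(4)] c(2,3) by auto
    ultimately show ?thesis using has_vector_derivative_within_subset[of _ _ s "{0..1}" "{0..t}"] c(3) by auto
  qed
  have confined: "\<gamma> s \<in> dom k \<and> the (k (\<gamma> s)) \<in> cball a (2 * r)"
    if r: "0 < r" "r \<le> r0" and \<gamma>: "integral_curve A V Y 1 \<gamma>" "k (\<gamma> 0) = Some u" "u \<in> cball a r" and s: "s \<in> {0..1}" for \<gamma> u r s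
  proof -
    define Ob where "Ob = dom k \<inter> (the \<circ> k) -` ball a (2 * r)"
    have Ob: "open Ob" unfolding Ob_def
      by (rule continuous_open_preimage[OF chart_continuous(1)[OF k(1)] chart_open(1)[OF k(1)] open_ball])
    define Bad where "Bad = {0..1} \<inter> \<gamma> -` (- Ob)"
    have Bad: "closed Bad" unfolding Bad_def
      by (rule continuous_closed_preimage[OF ic(1)[OF \<gamma>(1)]]) (use Ob in auto)
    have "Bad = {}"
    proof (rule ccontr)
      assume ne: "Bad \<noteq> {}"
      define t where "t = Inf Bad"
      have bdd: "bdd_below Bad" unfolding Bad_def by (auto intro: bdd_belowI[of _ 0])
      have t: "t \<in> Bad" unfolding t_def by (rule closed_contains_Inf[OF ne bdd Bad])
      have good: "\<gamma> s \<in> Ob" if "0 \<le> s" "s < t" for s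
      proof (rule ccontr)
        assume "\<gamma> s \<notin> Ob"
        then have "s \<in> Bad" using that t by (auto simp: Bad_def)
        then show False using cInf_lower[OF _ bdd, of s] that by (simp add: t_def)
      qed
      have "\<gamma> 0 \<in> Ob" using \<gamma>(2,3) r(1) by (auto simp: Ob_def)
      then have t0: "0 < t" using t by (cases "t = 0") (auto simp: Bad_def)
      \<comment> \<open>Before the first exit time \<open>t\<close> the speed is at most
        \<open>r / 2\<close>, so up to time one the curve stays within \<open>3 / 2 * r\<close> of
        \<open>a\<close>. The set \<open>Kc\<close> of such points is compact, hence closed in the
        Hausdorff manifold, so it contains the curve at time \<open>t\<close>, which therefore has
        not left the chart.\<close>
      define Kc where "Kc = (the \<circ> pinv k) ` cball a (3 / 2 * r)"
      have sub: "cball a (3 / 2 * r) \<subseteq> W" using small(4)[OF r] r(1) subset_cball[of "3 / 2 * r" "2 * r" a] by auto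
      have "compact Kc" unfolding Kc_def
        by (rule compact_continuous_image[OF continuous_on_subset[OF chart_continuous(2)[OF k(1)]] compact_cball]) (use sub W(4) in blast)
      then have Kc: "closed Kc" by (rule compact_imp_closed)
      have KcO: "Kc \<subseteq> Ob"
      proof
        fix m assume "m \<in> Kc"
        then obtain x where x: "x \<in> cball a (3 / 2 * r)" "m = the (pinv k x)" unfolding Kc_def by auto
        then obtain m' where "k m' = Some x" using sub W(4) unfolding ran_def by blast
        then have "k m = Some x" using x(2) chart_inverse[OF k(1)] by simp
        then show "m \<in> Ob" using x(1) r(1) by (auto simp: Ob_def)
      qed
      have inKc: "\<gamma> s \<in> Kc" if s: "0 \<le> s" "s < t" for s
      proof -
        have "norm (the (k (\<gamma> s)) - the (k (\<gamma> 0))) \<le> r / 2 * s"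
        proof (rule norm_diff_le_vector_derivative_bound[OF s(1)])
          fix \<tau> assume \<tau>: "\<tau> \<in> {0..s}"
          have O\<tau>: "\<gamma> \<tau> \<in> Ob" using good \<tau> s by auto
          show "((\<lambda>\<tau>. the (k (\<gamma> \<tau>))) has_vector_derivative \<eta> (the (k (\<gamma> \<tau>)))) (at \<tau> within {0..s})"
            using ode[OF \<gamma>(1) \<tau>] O\<tau> s t by (auto simp: Ob_def Bad_def)
          have "the (k (\<gamma> \<tau>)) \<in> cball a (2 * r)" using O\<tau> by (auto simp: Ob_def)
          then have "norm (\<eta> (the (k (\<gamma> \<tau>)))) \<le> C2 * (2 * r)\<^sup>2" by (rule C2(3)[OF small(2)[OF r]])
          then show "norm (\<eta> (the (k (\<gamma> \<tau>)))) \<le> r / 2" using small(5)[OF r] by simp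
        qed
        also have "\<dots> \<le> r / 2 * 1" using s t r(1) by (intro mult_left_mono) (auto simp: Bad_def)
        finally have "dist u (the (k (\<gamma> s))) \<le> r / 2" using \<gamma>(2) by (simp add: dist_norm norm_minus_commute)
        then have c: "the (k (\<gamma> s)) \<in> cball a (3 / 2 * r)"
          using \<gamma>(3) dist_triangle[of a "the (k (\<gamma> s))" u] by simp
        obtain y where y: "k (\<gamma> s) = Some y" using good[OF s] by (auto simp: Ob_def)
        show ?thesis unfolding Kc_def using c y chart_inverse[OF k(1) y] by (intro image_eqI[of _ _ y]) auto
      qed
      have "closed ({0..1} \<inter> \<gamma> -` Kc)" by (rule continuous_closed_preimage[OF ic(1)[OF \<gamma>(1)] _ Kc]) auto
      moreover have "{0..<t} \<subseteq> {0..1} \<inter> \<gamma> -` Kc" using inKc t by (auto simp: Bad_def)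
      ultimately have "closure {0..<t} \<subseteq> {0..1} \<inter> \<gamma> -` Kc" by (rule closure_minimal[rotated])
      moreover have "t \<in> closure {0..<t}" using t0 closure_atLeastLessThan[of 0 t] by simp
      ultimately have "\<gamma> t \<in> Kc" by blast
      then show False using t KcO by (auto simp: Bad_def)
    qed
    then have "\<gamma> s \<in> Ob" using s unfolding Bad_def by blast
    then show ?thesis by (auto simp: Ob_def)
  qed
  have unique: "\<gamma> 1 = \<gamma>' 1" if \<gamma>: "integral_curve A V Y 1 \<gamma>" "integral_curve A V Y 1 \<gamma>'" "\<gamma>' 0 = \<gamma> 0" "k (\<gamma> 0) = Some u" "u \<in> cball a r0" for \<gamma> \<gamma>' u
  proof -
    note r = r0(1) order_refl[of r0]
    have c1: "\<gamma> s \<in> dom k" "the (k (\<gamma> s)) \<in> cball a (2 * r0)" if "s \<in> {0..1}" for s using confined[OF r \<gamma>(1,4,5) that] by auto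
    have c2: "\<gamma>' s \<in> dom k" "the (k (\<gamma>' s)) \<in> cball a (2 * r0)" if "s \<in> {0..1}" for s using confined[OF r \<gamma>(2) _ \<gamma>(5) that] \<gamma>(3,4) by auto
    define D where "D s = the (k (\<gamma> s)) - the (k (\<gamma>' s))" for s
    have d: "(D has_vector_derivative (\<eta> (the (k (\<gamma> s))) - \<eta> (the (k (\<gamma>' s))))) (at s within {0..t})"
      if "s \<in> {0..t}" "t \<le> 1" for s t
      unfolding D_def[abs_def] using that c1[of s] c2[of s]
      by (intro has_vector_derivative_diff ode \<gamma>(1,2)) auto
    have "continuous_on {0..1} D"
      using has_vector_derivative_continuous[OF d[of _ 1]] by (auto simp: continuous_on_eq_continuous_within)
    then have "continuous_on {0..1} (\<lambda>s. norm (D s))" by (intro continuous_intros)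
    then obtain s0 where s0: "s0 \<in> {0..1}" "\<And>s. s \<in> {0..1} \<Longrightarrow> norm (D s) \<le> norm (D s0)"
      using continuous_attains_sup[OF compact_Icc, of 0 1 "\<lambda>s. norm (D s)"] by (metis atLeastAtMost_iff empty_iff le_numeral_extra(3) zero_le_one)
    \<comment> \<open>At the time \<open>s0\<close> of greatest distance, integration over a time of
      at most one bounds this distance by half of itself. The Lipschitz constant 1/2 takes the place
      of Gronwall's inequality.\<close>
    have "norm (D s0 - D 0) \<le> 1 / 2 * norm (D s0) * s0"
    proof (rule norm_diff_le_vector_derivative_bound)
      show "0 \<le> s0" using s0 by auto
      fix s assume s: "s \<in> {0..s0}"
      then have s1: "s \<in> {0..1}" using s0 by auto
      show "(D has_vector_derivative (\<eta> (the (k (\<gamma> s))) - \<eta> (the (k (\<gamma>' s))))) (at s within {0..s0})"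
        using d[OF s] s0 by auto
      have "norm (\<eta> (the (k (\<gamma> s))) - \<eta> (the (k (\<gamma>' s)))) \<le> C3 * (2 * r0) * norm (D s)"
        unfolding D_def by (rule C3(3)[OF small(3)[OF r] c1(2)[OF s1] c2(2)[OF s1]])
      also have "\<dots> \<le> 1 / 2 * norm (D s0)"
        using small(6)[OF r] s0(2)[OF s1] by (intro mult_mono) auto
      finally show "norm (\<eta> (the (k (\<gamma> s))) - \<eta> (the (k (\<gamma>' s)))) \<le> 1 / 2 * norm (D s0)" .
    qed
    moreover have D0: "D 0 = 0" by (simp add: D_def \<gamma>(3))
    moreover have "1 / 2 * norm (D s0) * s0 \<le> 1 / 2 * norm (D s0) * 1" using s0(1) by (intro mult_left_mono) auto
    ultimately have "norm (D s0) \<le> 1 / 2 * norm (D s0)" unfolding D0 diff_zero by linarith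
    then have "norm (D s0) \<le> 0" by simp
    then have "D 1 = 0" using s0(2)[of 1] by simp
    then show ?thesis using c1(1)[of 1] c2(1)[of 1] chart_pinj[OF k(1)] unfolding D_def pinj_def by auto
  qed
  have flow_eq: "flow A V Y 1 (\<gamma> 0) = Some (\<gamma> 1)" if "integral_curve A V Y 1 \<gamma>" "k (\<gamma> 0) = Some u" "u \<in> cball a r0" for \<gamma> u
  proof -
    have "(THE y. \<exists>\<gamma>'. integral_curve A V Y 1 \<gamma>' \<and> \<gamma>' 0 = \<gamma> 0 \<and> \<gamma>' 1 = y) = \<gamma> 1"
    proof (rule the_equality)
      show "\<exists>\<gamma>'. integral_curve A V Y 1 \<gamma>' \<and> \<gamma>' 0 = \<gamma> 0 \<and> \<gamma>' 1 = \<gamma> 1" using that(1) by blast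
      fix y assume "\<exists>\<gamma>'. integral_curve A V Y 1 \<gamma>' \<and> \<gamma>' 0 = \<gamma> 0 \<and> \<gamma>' 1 = y"
      then obtain \<gamma>' where "integral_curve A V Y 1 \<gamma>'" "\<gamma>' 0 = \<gamma> 0" "\<gamma>' 1 = y" by blast
      then show "y = \<gamma> 1" using unique[OF that(1) _ _ that(2,3), of \<gamma>'] by simp
    qed
    then show ?thesis using that(1) unfolding flow_def by auto
  qed
  have \<eta>a: "\<eta> a = 0" using flat[of "[]"] N by simp
  have Yz: "Y c z = 0" if c: "c \<in> A" "z \<in> dom c" for c
  proof -
    have "Y k z = 0" using \<eta>a chart_inverse[OF k] by (simp add: \<eta>_def)
    moreover have "z \<in> V \<inter> dom k \<inter> dom c" using Y(2) k c by auto
    then have "Y c z = frechet_derivative (in_charts k c Some) (at (the (k z))) (Y k z)"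
      using Y(1) k(1) c(1) unfolding vector_field_def by blast
    ultimately have "Y c z = dir_deriv 0 (in_charts k c Some) a" using k(2) by (simp add: dir_deriv_def)
    also have "\<dots> = 0"
      by (rule linear_0[OF bounded_linear.linear[OF bounded_linear_dir_deriv[OF smooth_at_differentiable[OF smooth_at_in_charts[OF k(1) c(1) local_diffeos_Some k(2) refl c(2)]]]]])
    finally show ?thesis .
  qed
  have "integral_curve A V Y 1 (\<lambda>s. z)" unfolding integral_curve_def using Y(2) Yz by auto
  from flow_eq[OF this k(2)] r0(1) show z: "flow A V Y 1 z = Some z" by simp
  have zk: "z \<in> dom k" using k by auto
  show "jets_agree N (in_charts k k (flow A V Y 1)) (\<lambda>x. x + \<eta> x) a"
  proof (rule jets_agree_if_bigo)
    show "smooth_at (in_charts k k (flow A V Y 1)) a" by (rule smooth_at_in_charts[OF k(1,1) flow k(2) z zk])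
    show "smooth_at (\<lambda>x. x + \<eta> x) a" by (intro smooth_at_add smooth_at_id \<eta>)
    have ev: "\<forall>\<^sub>F x in nhds a. x \<in> ball a r0" by (rule eventually_nhds_in_open) (use r0(1) in auto)
    show "\<forall>\<^sub>F x in nhds a. norm (in_charts k k (flow A V Y 1) x - (x + \<eta> x)) \<le> (C3 * C1 * 2 ^ Suc N) * dist a x ^ Suc N"
      using eventually_in_charts[OF k(1,1) flow k(2) z zk] ev
    proof eventually_elim
      case (elim x)
      then obtain p q where p: "k p = Some x" "flow A V Y 1 p = Some q" "k q = Some (in_charts k k (flow A V Y 1) x)" by blast
      obtain \<gamma> where \<gamma>: "integral_curve A V Y 1 \<gamma>" "\<gamma> 0 = p" using p(2) unfolding flow_def by (auto split: if_splits)
      have xr0: "x \<in> cball a r0" using elim(2) by auto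
      have q: "q = \<gamma> 1" using flow_eq[OF \<gamma>(1) _ xr0] \<gamma>(2) p(1,2) by simp
      define y where "y s = the (k (\<gamma> s))" for s
      have y: "y 0 = x" "y 1 = in_charts k k (flow A V Y 1) x" using p \<gamma>(2) q by (auto simp: y_def)
      \<comment> \<open>\<open>confined\<close> asks for a positive radius, which
        \<open>dist a x\<close> provides only away from \<open>a\<close>.\<close>
      show ?case
      proof (cases "x = a")
        case True
        have "in_charts k k (flow A V Y 1) a = a" using in_charts_eq[of k z a "flow A V Y 1" z k] k z by simp
        then show ?thesis using True \<eta>a by simp
      next
        case False
        define r where "r = dist a x"
        have r: "0 < r" "r \<le> r0" using False xr0 by (auto simp: r_def)
        have xr: "x \<in> cball a r" "x \<in> cball a (2 * r)" using r by (auto simp: r_def)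
        have c: "\<gamma> s \<in> dom k" "y s \<in> cball a (2 * r)" if "s \<in> {0..1}" for s
          using confined[OF r \<gamma>(1) _ xr(1) that] \<gamma>(2) p(1) by (auto simp: y_def)
        have d: "(y has_vector_derivative \<eta> (y s)) (at s within {0..t})" if "s \<in> {0..t}" "t \<le> 1" for s t
          unfolding y_def[abs_def] using ode[OF \<gamma>(1) that] c[of s] that by auto
        have b: "norm (y s - x) \<le> C1 * (2 * r) ^ N" if s: "s \<in> {0..1}" for s
        proof -
          have "norm (y s - y 0) \<le> C1 * (2 * r) ^ N * s"
          proof (rule norm_diff_le_vector_derivative_bound)
            show "0 \<le> s" using s by auto
            fix t assume t: "t \<in> {0..s}"
            show "(y has_vector_derivative \<eta> (y t)) (at t within {0..s})" using d[OF t] s by auto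
            have "t \<in> {0..1}" using t s by auto
            then show "norm (\<eta> (y t)) \<le> C1 * (2 * r) ^ N" by (intro C1(3)[OF small(1)[OF r]] c(2))
          qed
          also have "\<dots> \<le> C1 * (2 * r) ^ N * 1" using s r C1(1) by (intro mult_left_mono) auto
          finally show ?thesis by (simp add: y(1))
        qed
        \<comment> \<open>The increment of \<open>h\<close> over the unit interval is the deviation
          of the flow from \<open>x + \<eta> x\<close>. Its derivative is a difference of values of
          \<eta>: a Lipschitz constant of order r times a displacement of order r^N, which is order
          r^(N+1).\<close>
        define h where "h s = y s - s *\<^sub>R \<eta> x" for s
        have "norm (h 1 - h 0) \<le> (C3 * (2 * r) * (C1 * (2 * r) ^ N)) * 1"
        proof (rule norm_diff_le_vector_derivative_bound)
          fix s :: real assume s: "s \<in> {0..1}"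
          show "(h has_vector_derivative (\<eta> (y s) - \<eta> x)) (at s within {0..1})"
            unfolding h_def[abs_def] using d[OF s] by (auto intro!: derivative_eq_intros)
          have "norm (\<eta> (y s) - \<eta> x) \<le> C3 * (2 * r) * norm (y s - x)" by (rule C3(3)[OF small(3)[OF r] c(2)[OF s] xr(2)])
          also have "\<dots> \<le> C3 * (2 * r) * (C1 * (2 * r) ^ N)" using b[OF s] C3(1) r by (intro mult_left_mono) auto
          finally show "norm (\<eta> (y s) - \<eta> x) \<le> C3 * (2 * r) * (C1 * (2 * r) ^ N)" .
        qed simp
        also have "\<dots> = (C3 * C1 * 2 ^ Suc N) * dist a x ^ Suc N" by (simp add: r_def power_mult_distrib)
        finally show ?thesis using y by (simp add: h_def algebra_simps)
      qed
    qed
  qed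
qed

end

section \<open>Persistence of freeness\<close>

lemma iter_deriv_zero: "iter_deriv vs (\<lambda>x. 0) a = 0"
  using iter_deriv_diff[OF smooth_at_const smooth_at_const, of vs 0 0 a] by simp

lemma jets_agree_zero: "jets_agree m f (\<lambda>x. 0) a \<longleftrightarrow> (\<forall>vs. length vs \<le> m \<longrightarrow> iter_deriv vs f a = 0)"
  by (simp add: jets_agree_def iter_deriv_zero)

lemma jets_agree_zero_if_dir_deriv:
  fixes f :: "'x::real_normed_vector \<Rightarrow> 'y::real_normed_vector"
  assumes "f a = 0" "\<And>v. jets_agree m (dir_deriv v f) (\<lambda>x. 0) a"
  shows "jets_agree (Suc m) f (\<lambda>x. 0) a"
proof -
  have "dir_deriv v (\<lambda>x::'x. 0::'y) = (\<lambda>x. 0)" for v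
    unfolding dir_deriv_def by (auto simp: frechet_derivative_const)
  then show ?thesis using assms by (simp add: jets_agree_Suc)
qed

lemma subspace_diff_mem_iff: "subspace L \<Longrightarrow> w \<in> L \<Longrightarrow> v + w \<in> L \<longleftrightarrow> v \<in> L"
  using subspace_add subspace_diff by (metis add_diff_cancel_right')

section \<open>Prescribed jets of vector fields, and the step to the next order\<close>

context manifold
begin

text \<open>\<open>tame\<close> quantifies over vector fields, which have components in all charts.
  The components outside \<open>k\<close> are forced by the transformation law: they are
  push-forwards of \<open>X0\<close>.\<close>

lemma vector_field_from_chart:
  assumes k: "k \<in> A" "k z = Some a" and X0: "smooth_at X0 a"
  obtains U X where "vector_field A U X" "z \<in> U" "vector_jet n k X z = deriv_array n X0 a"
proof -
  obtain W0 where W0: "open W0" "a \<in> W0" "smooth W0 X0" using X0 unfolding smooth_at_def by blast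
  define U where "U = dom k \<inter> (the \<circ> k) -` W0"
  define X where "X c m = dir_deriv (X0 (the (k m))) (in_charts k c Some) (the (k m))" for c :: "'a \<rightharpoonup> 'e" and m
  have U: "open U" unfolding U_def by (rule continuous_open_preimage[OF chart_continuous(1)[OF k(1)] chart_open(1)[OF k(1)] W0(1)])
  have Uk: "\<exists>x. k m = Some x \<and> x \<in> W0" if "m \<in> U" for m using that by (auto simp: U_def)
  have sm: "smooth_at (in_charts k c Some) x" if "c \<in> A" "k m = Some x" "m \<in> dom c" for c m x
    by (rule smooth_at_in_charts[OF k(1) that(1) local_diffeos_Some that(2) refl that(3)])
  have vf: "vector_field A U X"
    unfolding vector_field_def
  proof (intro conjI ballI U)
    fix c assume c: "c \<in> A"
    have op: "open ((the \<circ> c) ` (U \<inter> dom c))"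
    proof -
      have "(the \<circ> c) ` (U \<inter> dom c) = ran c \<inter> (the \<circ> pinv c) -` U"
        using chart_inverse[OF c] by (force simp: ran_def image_iff)
      then show ?thesis using continuous_open_preimage[OF chart_continuous(2)[OF c] chart_open(2)[OF c] U] by simp
    qed
    have "smooth_at (\<lambda>x. X c (the (pinv c x))) x0" if "x0 \<in> (the \<circ> c) ` (U \<inter> dom c)" for x0
    proof -
      obtain m where m: "m \<in> U" "c m = Some x0" using \<open>x0 \<in> _\<close> by auto
      obtain x where x: "k m = Some x" "x \<in> W0" using Uk[OF m(1)] by blast
      have mk: "m \<in> dom k" using x by auto
      define T where "T = in_charts c k Some"
      have Tx: "T x0 = x" using in_charts_eq[of c m x0 Some m k] c m x by (simp add: T_def)
      have T: "smooth_at T x0" unfolding T_def by (rule smooth_at_in_charts[OF c k(1) local_diffeos_Some m(2) refl mk])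
      have X0x: "smooth_at X0 x" by (rule smooth_atI[OF W0(3,1) x(2)])
      have mc: "m \<in> dom c" using m by auto
      \<comment> \<open>In \<open>X\<close> the direction of differentiation varies with the point;
        the expansion in the basis makes it fixed, where smoothness is known.\<close>
      have "smooth_at (\<lambda>x'. \<Sum>b\<in>Basis. (X0 (T x') \<bullet> b) *\<^sub>R dir_deriv b (in_charts k c Some) (T x')) x0"
      proof (intro smooth_at_sum smooth_at_scaleR)
        fix b :: 'e
        have "smooth_at (\<lambda>x'. X0 (T x')) x0" by (rule smooth_at_compose[OF T]) (simp add: Tx X0x)
        then show "smooth_at (\<lambda>x'. X0 (T x') \<bullet> b) x0" by (rule smooth_at_compose_linear[OF bounded_linear_inner_left])
        show "smooth_at (\<lambda>x'. dir_deriv b (in_charts k c Some) (T x')) x0"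
          by (rule smooth_at_compose[OF T]) (simp add: Tx smooth_at_dir_deriv[OF sm[OF c x(1) mc]])
      qed
      moreover have "\<forall>\<^sub>F x' in nhds x0. (\<Sum>b\<in>Basis. (X0 (T x') \<bullet> b) *\<^sub>R dir_deriv b (in_charts k c Some) (T x')) = X c (the (pinv c x'))"
        using eventually_in_charts[OF c k(1) local_diffeos_Some m(2) refl mk, folded T_def]
      proof eventually_elim
        case (elim x')
        then obtain m' where m': "c m' = Some x'" "k m' = Some (T x')" by auto
        have "linear (\<lambda>v. dir_deriv v (in_charts k c Some) (T x'))"
          by (rule bounded_linear.linear[OF bounded_linear_dir_deriv[OF smooth_at_differentiable[OF sm[OF c m'(2)]]]]) (use m' in auto)
        from linear_sum_Basis[OF this, of "X0 (T x')"] show ?case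
          using chart_inverse[OF c m'(1)] m'(2) by (simp add: X_def)
      qed
      ultimately show ?thesis by (rule smooth_at_cong_ev[rotated])
    qed
    then show "smooth ((the \<circ> c) ` (U \<inter> dom c)) (\<lambda>x. X c (the (pinv c x)))"
      using smooth_iff_smooth_at[OF op] by blast
  next
    fix c d m assume c: "c \<in> A" and d: "d \<in> A" and m: "m \<in> U \<inter> dom c \<inter> dom d"
    obtain x where x: "k m = Some x" "x \<in> W0" using Uk m by blast
    obtain y where y: "c m = Some y" using m by auto
    have mc: "m \<in> dom c" "m \<in> dom d" using m by auto
    have val: "in_charts k c Some x = y" using in_charts_eq[of k m x Some m c] k x y by simp
    have s2: "smooth_at (in_charts c d Some) y" by (rule smooth_at_in_charts[OF c d local_diffeos_Some y refl mc(2)])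
    have "\<forall>\<^sub>F x' in nhds x. in_charts k d (Some \<circ>\<^sub>m Some) x' = in_charts c d Some (in_charts k c Some x')"
      by (rule in_charts_comp[OF k(1) c d local_diffeos_Some local_diffeos_Some x(1) refl refl mc])
    then have "dir_deriv v (in_charts k d Some) x = dir_deriv v (\<lambda>x'. in_charts c d Some (in_charts k c Some x')) x" for v
      by (intro dir_deriv_cong_ev) simp
    also have "dir_deriv v (\<lambda>x'. in_charts c d Some (in_charts k c Some x')) x = dir_deriv (dir_deriv v (in_charts k c Some) x) (in_charts c d Some) y" for v
      using dir_deriv_compose[where g = "in_charts c d Some" and f = "in_charts k c Some" and x = x and v = v]
        smooth_at_differentiable[OF sm[OF c x(1) mc(1)]] smooth_at_differentiable[OF s2] val by simp
    finally show "X d m = frechet_derivative (in_charts c d Some) (at (the (c m))) (X c m)"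
      using x y by (simp add: X_def dir_deriv_def)
  qed
  have "\<forall>\<^sub>F x in nhds a. X k (the (pinv k x)) = X0 x"
    using eventually_eventually_nhds[OF in_charts_Some_id[OF k]] eventually_in_charts[OF k(1,1) local_diffeos_Some k(2) refl domI[of k, OF k(2)]]
  proof eventually_elim
    case (elim x)
    then obtain m where m: "k m = Some x" by blast
    have "dir_deriv (X0 x) (in_charts k k Some) x = dir_deriv (X0 x) (\<lambda>x. x) x" by (rule dir_deriv_cong_ev(2)) (use elim in blast)
    also have "\<dots> = X0 x" by (rule dir_deriv_bounded_linear[OF bounded_linear_ident])
    finally show ?case using chart_inverse[OF k(1) m] m by (simp add: X_def)
  qed
  from iter_deriv_cong_ev(2)[OF this] have "vector_jet n k X z = deriv_array n X0 a"
    using k by (simp add: vector_jet_def deriv_array_eq_iff)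
  moreover have "z \<in> U" using k W0 by (auto simp: U_def)
  ultimately show thesis using that vf by blast
qed

text \<open>A local diffeomorphism that, in a slice chart \<open>k\<close> of \<open>S\<close>, is \<open>id + \<eta>\<close> to order \<open>n\<close>, with \<open>\<eta>\<close> tangent
  to \<open>S\<close> to order \<open>n\<close>, preserves the \<open>n\<close>-jet of \<open>S\<close>: the image of \<open>S\<close> has the same parametrization as \<open>S\<close>
  itself, reparametrized by \<open>id + \<pi> \<circ> \<eta>\<close> for a projection \<open>\<pi>\<close> onto the slice.\<close>

lemma contact_image_if_tangent:
  assumes L: "subspace L" "dim L = p" and k: "slice_chart A L S k" "k z = Some a" "a \<in> L"
    and \<psi>: "\<psi> \<in> local_diffeos A" "\<psi> z = Some z"
    and \<eta>: "smooth_at \<eta> a" "\<eta> a = 0" "\<And>v. dir_deriv v \<eta> a = 0"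
    and agree: "jets_agree n (in_charts k k \<psi>) (\<lambda>x. x + \<eta> x) a"
    and tangent: "jets_agree n (\<lambda>x. \<eta> (projection L x)) (\<lambda>x. projection L (\<eta> (projection L x))) a"
  shows "contact A p n z (ran (\<psi> |` S)) S"
proof -
  note kA = slice_chartD(1)[OF k(1)] and P = projection[OF L(1)]
  have Pa: "projection L a = a" by (rule P(3)[OF k(3)])
  have zk: "z \<in> dom k" using k by auto
  \<comment> \<open>Adding only the component in \<open>L\<close> makes \<mu> preserve membership in
    \<open>L\<close> exactly and not just to order \<open>n\<close>, so that its inverse after
    \<open>k\<close> is again a slice chart of \<open>S\<close>.\<close>
  define \<mu> where "\<mu> x = x + projection L (\<eta> x)" for x
  have P\<eta>: "smooth_at (\<lambda>x. projection L (\<eta> x)) a" by (rule smooth_at_compose_linear[OF P(1) \<eta>(1)])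
  have \<mu>: "smooth_at \<mu> a" unfolding \<mu>_def[abs_def] by (intro smooth_at_add smooth_at_id P\<eta>)
  have P0: "projection L 0 = 0" by (rule linear_0[OF bounded_linear.linear[OF P(1)]])
  have \<mu>a: "\<mu> a = a" by (simp add: \<mu>_def \<eta>(2) P0)
  have "dir_deriv v \<mu> a = v" for v
    unfolding \<mu>_def[abs_def] dir_deriv_add[OF smooth_at_differentiable[OF smooth_at_id] smooth_at_differentiable[OF P\<eta>]]
      dir_deriv_compose_linear[OF P(1) smooth_at_differentiable[OF \<eta>(1)]] dir_deriv_bounded_linear[OF bounded_linear_ident] \<eta>(3) P0
    by simp
  from smooth_inverse_function[OF \<mu> this] obtain U V g where
    U: "open U" "a \<in> U" "open V" "a \<in> V" and hom: "homeomorphism U V \<mu> g" and sm: "smooth U \<mu>" "smooth V g"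
    unfolding \<mu>a by blast
  have hom': "\<And>x. x \<in> U \<Longrightarrow> \<mu> x \<in> V \<and> g (\<mu> x) = x" "\<And>y. y \<in> V \<Longrightarrow> g y \<in> U \<and> \<mu> (g y) = y"
    using hom unfolding homeomorphism_def by blast+
  define h where "h x = (if x \<in> V then Some (g x) else None)" for x
  have h: "h x = Some y \<longleftrightarrow> y \<in> U \<and> x = \<mu> y" for x y using hom' by (auto simp: h_def)
  have pinj_h: "pinj h" unfolding pinj_def h by auto
  have dom_h: "dom h = V" by (auto simp: h_def split: if_splits)
  have pinv_h: "pinv h = (\<lambda>x. if x \<in> U then Some (\<mu> x) else None)"
    by (rule partial_eqI) (auto simp: pinv_eq_Some[OF pinj_h] h)
  have ps_h: "psmooth h" unfolding psmooth_def dom_h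
    using U smooth_cong[OF U(3), of "the \<circ> h" g] sm(2) by (auto simp: h_def)
  have dom_pinv_h: "dom (pinv h) = U" unfolding pinv_h by (auto split: if_splits)
  have ps_ih: "psmooth (pinv h)" unfolding psmooth_def dom_pinv_h
    using U smooth_cong[OF U(1), of "the \<circ> pinv h" \<mu>] sm(1) by (auto simp: pinv_h)
  \<comment> \<open>This is \<open>h\<close> after \<open>k\<close>, restricted to values in
    \<open>ran k\<close>; the detour through the manifold exhibits it as a chart composed with a
    local diffeomorphism.\<close>
  define d where "d = k \<circ>\<^sub>m (pinv k \<circ>\<^sub>m h \<circ>\<^sub>m k)"
  have dA: "d \<in> A" unfolding d_def
    by (intro chart_comp_local_diffeo kA local_diffeo_from_charts pinj_h ps_h ps_ih)
  have d: "d x = Some v \<longleftrightarrow> (\<exists>u. k x = Some u \<and> v \<in> U \<and> u = \<mu> v \<and> v \<in> ran k)" for x v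
    by (auto simp: d_def map_comp_eq_Some pinv_chart[OF kA] h ran_def)
  have d_slice: "slice_chart A L S d"
    unfolding slice_chart_def
  proof (intro conjI ballI dA)
    fix x assume "x \<in> dom d"
    then obtain v where v: "d x = Some v" by auto
    then have "k x = Some (\<mu> v)" using d by blast
    then have "x \<in> S \<longleftrightarrow> \<mu> v \<in> L" using slice_chartD(2)[OF k(1)] by blast
    also have "\<dots> \<longleftrightarrow> v \<in> L" unfolding \<mu>_def by (rule subspace_diff_mem_iff[OF L(1) P(2)])
    finally show "x \<in> S \<longleftrightarrow> the (d x) \<in> L" using v by simp
  qed
  have dz: "d z = Some a" unfolding d using k(2) U(2) \<mu>a by (auto simp: ran_def)
  have "\<forall>\<^sub>F x in nhds a. \<mu> x \<in> ran k"
    by (rule eventually_compose_isCont[OF smooth_at_isCont[OF \<mu>] eventually_nhds_in_open[OF chart_open(2)[OF kA]]]) (use \<mu>a k(2) in \<open>auto simp: ran_def\<close>)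
  moreover have "\<forall>\<^sub>F x in nhds a. x \<in> ran k" by (rule eventually_nhds_in_open[OF chart_open(2)[OF kA]]) (use k(2) in \<open>auto simp: ran_def\<close>)
  ultimately have d_eq: "\<forall>\<^sub>F x in nhds a. in_charts d k Some x = \<mu> x"
    using eventually_nhds_in_open[OF U(1,2)]
  proof eventually_elim
    case (elim x)
    then obtain m where m: "k m = Some (\<mu> x)" by (auto simp: ran_def)
    then have "d m = Some x" using elim d by blast
    then show ?case using in_charts_eq[of d m x Some m k] dA m by simp
  qed
  have c_slice: "slice_chart A L (ran (\<psi> |` S)) (k \<circ>\<^sub>m pinv \<psi>)" by (rule slice_chart_image[OF k(1) \<psi>(1)])
  have cz: "(k \<circ>\<^sub>m pinv \<psi>) z = Some a"
    using \<psi>(2) k(2) by (auto simp: map_comp_eq_Some pinv_eq_Some[OF local_diffeosD(1)[OF \<psi>(1)]])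
  have sP: "smooth_at (projection L) a" by (rule smooth_at_bounded_linear[OF P(1)])
  have \<eta>P: "smooth_at (\<lambda>x. \<eta> (projection L x)) a" by (rule smooth_at_precompose_linear[OF P(1)]) (simp add: Pa \<eta>(1))
  have s\<psi>: "smooth_at (in_charts k k \<psi>) a" by (rule smooth_at_in_charts[OF kA kA \<psi>(1) k(2) \<psi>(2) zk])
  have s\<eta>: "smooth_at (\<lambda>x. x + \<eta> x) a" by (intro smooth_at_add smooth_at_id \<eta>(1))
  have 1: "jets_agree n (\<lambda>x. in_charts k k \<psi> (projection L x)) (\<lambda>x. projection L x + \<eta> (projection L x)) a"
    by (rule jets_agree_compose[where g = "in_charts k k \<psi>" and g' = "\<lambda>x. x + \<eta> x", OF jets_agree_refl _ sP sP])
      (simp_all add: Pa agree s\<psi> s\<eta>)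
  have 2: "jets_agree n (\<lambda>x. projection L x + \<eta> (projection L x)) (\<lambda>x. projection L x + projection L (\<eta> (projection L x))) a"
    by (rule jets_agree_add[OF jets_agree_refl tangent sP \<eta>P sP smooth_at_compose_linear[OF P(1) \<eta>P]])
  have 3: "\<forall>\<^sub>F x in nhds a. projection L x + projection L (\<eta> (projection L x)) = in_charts d k Some (projection L x)"
    using eventually_projection[OF L(1) k(3) d_eq] by eventually_elim (simp add: \<mu>_def)
  have "jets_agree n (\<lambda>x. in_charts (k \<circ>\<^sub>m pinv \<psi>) k Some (projection L x)) (\<lambda>x. in_charts d k Some (projection L x)) a"
    unfolding in_charts_image_chart[OF kA \<psi>(1)]
    by (rule jets_agree_trans[OF 1 jets_agree_trans[OF 2 jets_agree_cong_ev[OF 3]]])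
  then show ?thesis by (rule contactI[OF L c_slice d_slice cz dz k(3) kA zk])
qed

lemma acts_freely_at_Suc:
  assumes G: "lie_pseudogroup A G ns" "tame A G ns" and N: "ns + 1 \<le> N"
    and S: "submanifold A p S" "z \<in> S" and free: "acts_freely_at A G p N (sub_jet A p N S z)"
  shows "acts_freely_at A G p (Suc N) (sub_jet A p (Suc N) S z)"
proof -
  have GL: "G \<subseteq> local_diffeos A" and Gcomp: "\<And>\<phi> \<psi>. \<phi> \<in> G \<Longrightarrow> \<psi> \<in> G \<Longrightarrow> \<phi> \<circ>\<^sub>m pinv \<psi> \<in> G" and ns: "1 \<le> ns"
    using G(1) unfolding lie_pseudogroup_def by auto
  have N2: "2 \<le> N" "ns \<le> N" using N ns by auto
  obtain dm where emb: "embedded_submanifold (jet_atlas A N) dm (jets A N G)"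
    using G(1) N2(2) unfolding lie_pseudogroup_def smooth_subbundle_def by blast
  have id_dom: "z \<in> dom Some" by auto
  \<comment> \<open>Freeness at order \<open>N\<close> in the form in which it is applied twice: to
    the given element and to the time one flow maps.\<close>
  have fixing: "same_jet A N z \<phi> Some" if "\<phi> \<in> G" "\<phi> z = Some z" "contact A p N z (ran (\<phi> |` S)) S" for \<phi>
  proof -
    have "jet A N \<phi> z \<in> isotropy A G p N (sub_jet A p N S z)" using isotropy_iff[OF GL S] that by blast
    then have "jet A N \<phi> z = jet A N Some z"
      using free by (simp add: acts_freely_at_def sub_jet_base_sub_jet identity_jet_def)
    then show ?thesis using jet_eq_iff[of \<phi> z N Some] GL that by auto
  qed
  have "identity_jet A N z \<in> isotropy A G p N (sub_jet A p N S z)"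
    using free by (simp add: acts_freely_at_def sub_jet_base_sub_jet)
  then obtain \<phi>0 where \<phi>0: "\<phi>0 \<in> G" "\<phi>0 z = Some z" using isotropy_iff[OF GL S] by blast
  \<comment> \<open>\<open>Some\<close> need not belong to \<open>G\<close>, as the definition of a Lie pseudogroup does not provide identities at
    points that are not targets. At \<open>z\<close>, freeness provides an element with target \<open>z\<close>.\<close>
  define e where "e = \<phi>0 \<circ>\<^sub>m pinv \<phi>0"
  have eG: "e \<in> G" unfolding e_def by (rule Gcomp[OF \<phi>0(1,1)])
  have eL: "e \<in> local_diffeos A" using eG GL by blast
  have \<phi>0L: "\<phi>0 \<in> local_diffeos A" using \<phi>0 GL by blast
  have e_id: "e x = Some y \<Longrightarrow> x = y" for x y
    using local_diffeosD(1)[OF \<phi>0L] by (auto simp: e_def map_comp_eq_Some pinv_eq_Some)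
  have ez: "e z = Some z"
    using \<phi>0(2) local_diffeosD(1)[OF \<phi>0L] by (auto simp: e_def map_comp_eq_Some pinv_eq_Some)
  have e_charts: "\<forall>\<^sub>F x in nhds a. in_charts k k e x = x" if "k \<in> A" "k z = Some a" for k a
    using eventually_in_charts[OF that(1,1) eL that(2) ez domI[of k, OF that(2)]]
    by eventually_elim (auto dest: e_id)
  have e_jet: "same_jet A n z e Some" for n
  proof -
    obtain k where k: "k \<in> A" "z \<in> dom k" by (rule chart_exists)
    obtain a where a: "k z = Some a" using k by auto
    show ?thesis
      by (rule same_jetI[OF k(1,1) eL local_diffeos_Some a ez refl k(2)
            jets_agree_trans[OF jets_agree_cong_ev[OF e_charts[OF k(1) a]] jets_agree_sym[OF jets_agree_cong_ev[OF in_charts_Some_id[OF k(1) a]]]]])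
  qed
  have main: "same_jet A (Suc N) z \<phi> Some" if \<phi>: "\<phi> \<in> G" "\<phi> z = Some z" "contact A p (Suc N) z (ran (\<phi> |` S)) S" for \<phi>
  proof -
    have \<phi>L: "\<phi> \<in> local_diffeos A" using \<phi>(1) GL by blast
    have \<phi>N: "same_jet A N z \<phi> Some" by (rule fixing[OF \<phi>(1,2) contact_mono[OF \<phi>(3)]]) simp
    obtain L c k a where L: "subspace L" "dim L = p" and c: "slice_chart A L (ran (\<phi> |` S)) c" and k: "slice_chart A L S k"
      and a: "c z = Some a" "k z = Some a" "a \<in> L"
      and ag: "\<And>k'. k' \<in> A \<Longrightarrow> z \<in> dom k' \<Longrightarrow>
       jets_agree (Suc N) (\<lambda>x. in_charts c k' Some (projection L x)) (\<lambda>x. in_charts k k' Some (projection L x)) a"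
      using contactD[OF \<phi>(3)] by metis
    note cA = slice_chartD(1)[OF c] and kA = slice_chartD(1)[OF k] and P = projection[OF L(1)]
    have Pa: "projection L a = a" by (rule P(3)[OF a(3)])
    have zk: "z \<in> dom k" and zc: "z \<in> dom c" using a by auto
    define F where "F = in_charts k k \<phi>"
    \<comment> \<open>\<open>in_charts k k e\<close> is known to be the identity only near
      \<open>a\<close>. Subtracting it, with \<open>e\<close> in \<open>G\<close>, matches the lemma
      on the determining equations.\<close>
    define E where "E x = in_charts k k \<phi> x - in_charts k k e x" for x
    have F: "smooth_at F a" unfolding F_def by (rule smooth_at_in_charts[OF kA kA \<phi>L a(2) \<phi>(2) zk])
    have Ie: "smooth_at (in_charts k k e) a" by (rule smooth_at_in_charts[OF kA kA eL a(2) ez zk])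
    have E: "smooth_at E a" unfolding E_def[abs_def] F_def[symmetric] by (rule smooth_at_diff[OF F Ie])
    have sP: "smooth_at (projection L) a" by (rule smooth_at_bounded_linear[OF P(1)])
    have E_eq: "\<forall>\<^sub>F x in nhds a. E x = F x - x"
      using e_charts[OF kA a(2)] by eventually_elim (simp add: E_def F_def)
    have "jets_agree N (in_charts k k \<phi>) (in_charts k k e) a"
      using same_jetD(2)[OF same_jet_trans[OF \<phi>N same_jet_sym[OF e_jet]] kA kA \<phi>L eL a(2) \<phi>(2) zk] .
    from jets_agree_diff[OF this jets_agree_refl F[unfolded F_def] Ie Ie Ie]
    have EN: "jets_agree N E (\<lambda>x. 0) a" by (simp add: E_def[abs_def])
    then have E0: "length vs \<le> N \<Longrightarrow> iter_deriv vs E a = 0" for vs unfolding jets_agree_zero by blast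
    define Q where "Q x = x - projection L x" for x
    have Q: "bounded_linear Q" unfolding Q_def[abs_def] by (intro bounded_linear_sub bounded_linear_ident P(1))
    \<comment> \<open>Read from \<open>k\<close> to \<open>c\<close>, \<phi> maps \<open>L\<close>
      into \<open>L\<close>, since \<open>c\<close> is a slice chart of the image of
      \<open>S\<close>. So \<phi> along \<open>L\<close> is the parametrization by \<open>c\<close>
      after \<open>M\<close>. By contact this parametrization agrees to order \<open>N + 1\<close>
      with the one by \<open>k\<close>, the inclusion of \<open>L\<close>; and \<open>Q\<close>
      kills \<open>L\<close>.\<close>
    have normal: "jets_agree (Suc N) (\<lambda>x. Q (E (projection L x))) (\<lambda>x. 0) a"
    proof -
      define M where "M = in_charts k c \<phi>"
      have M: "smooth_at M a" unfolding M_def by (rule smooth_at_in_charts[OF kA cA \<phi>L a(2) \<phi>(2) zc])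
      have Ma: "M a = a" using in_charts_eq[of k z a \<phi> z c] kA a \<phi>(2) by (simp add: M_def)
      have MP: "smooth_at (\<lambda>x. M (projection L x)) a" by (rule smooth_at_precompose_linear[OF P(1)]) (simp add: Pa M)
      have M_mem: "\<forall>\<^sub>F x in nhds a. M (projection L x) \<in> L"
        using eventually_projection[OF L(1) a(3) eventually_in_charts[OF kA cA \<phi>L a(2) \<phi>(2) zc]]
      proof eventually_elim
        case (elim x)
        then obtain y y' where y: "k y = Some (projection L x)" "\<phi> y = Some y'" "c y' = Some (M (projection L x))" unfolding M_def by blast
        have "y \<in> S" using slice_chartD(2)[OF k y(1)] P(2) by simp
        then have "y' \<in> ran (\<phi> |` S)" using y(2) by (auto simp: ran_def restrict_map_def intro!: exI[of _ y])
        then show ?case using slice_chartD(2)[OF c y(3)] by simp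
      qed
      have F_eq: "\<forall>\<^sub>F x in nhds a. in_charts c k Some (projection L (M (projection L x))) = F (projection L x)"
        using eventually_projection[OF L(1) a(3) in_charts_comp[OF kA cA kA local_diffeos_Some \<phi>L a(2) \<phi>(2) refl zc zk]] M_mem
        by eventually_elim (simp add: F_def M_def P(3))
      have sc: "smooth_at (\<lambda>x. in_charts c k Some (projection L x)) a"
        by (rule smooth_at_in_charts_projection[OF L(1) a(3) cA kA local_diffeos_Some a(1) refl zk])
      have "jets_agree (Suc N) (\<lambda>x. in_charts c k Some (projection L x)) (projection L) a"
        by (rule jets_agree_trans[OF ag[OF kA zk] jets_agree_cong_ev[OF eventually_projection[OF L(1) a(3) in_charts_Some_id[OF kA a(2)]]]])
      then have "jets_agree (Suc N) (\<lambda>x. in_charts c k Some (projection L (M (projection L x)))) (\<lambda>x. projection L (M (projection L x))) a"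
        by (intro jets_agree_compose[where g = "\<lambda>x. in_charts c k Some (projection L x)" and g' = "projection L", OF jets_agree_refl _ MP MP])
          (simp_all add: Pa Ma sc sP)
      from jets_agree_trans[OF jets_agree_sym[OF jets_agree_cong_ev[OF F_eq]] this]
      have FP: "jets_agree (Suc N) (\<lambda>x. F (projection L x)) (\<lambda>x. projection L (M (projection L x))) a" .
      have sFP: "smooth_at (\<lambda>x. F (projection L x)) a" by (rule smooth_at_precompose_linear[OF P(1)]) (simp add: Pa F)
      from jets_agree_compose_linear[OF Q FP sFP smooth_at_compose_linear[OF P(1) MP]]
      have QF: "jets_agree (Suc N) (\<lambda>x. Q (F (projection L x))) (\<lambda>x. 0) a" by (simp add: Q_def P(2,3))
      have "\<forall>\<^sub>F x in nhds a. Q (E (projection L x)) = Q (F (projection L x))"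
        using eventually_projection[OF L(1) a(3) E_eq]
        by eventually_elim (simp add: Q_def linear_diff[OF bounded_linear.linear[OF P(1)]] P(2,3))
      from jets_agree_trans[OF jets_agree_cong_ev[OF this] QF] show ?thesis .
    qed
    have flat_if_tangent: "jets_agree N (dir_deriv u E) (\<lambda>x. 0) a"
      if tangent: "jets_agree N (\<lambda>x. Q (dir_deriv u E (projection L x))) (\<lambda>x. 0) a" for u
    proof -
      have DE: "smooth_at (dir_deriv u E) a" by (rule smooth_at_dir_deriv[OF E])
      obtain U X where X: "vector_field A U X" "z \<in> U" "vector_jet N k X z = deriv_array N (dir_deriv u E) a"
        by (rule vector_field_from_chart[OF kA a(2) DE])
      have "inf_determining_eqs A G N k z (vector_jet N k X z)"
        unfolding X(3) E_def[abs_def] by (rule dir_deriv_satisfies_inf_determining_eqs[OF GL eG e_jet emb \<phi>(1) \<phi>N kA a(2)])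
      then obtain V Y where Y: "pseudogroup_vector_field A G V Y" "z \<in> V" "vector_jet N k Y z = vector_jet N k X z"
        using G(2) N2(2) kA zk X(1,2) unfolding tame_def by blast
      define \<eta> where "\<eta> = (\<lambda>x. Y k (the (pinv k x)))"
      have vY: "vector_field A V Y" and flow: "flow A V Y 1 \<in> G" using Y(1) unfolding pseudogroup_vector_field_def by auto
      have \<eta>: "smooth_at \<eta> a"
        unfolding \<eta>_def by (rule smooth_at_vector_field[OF vY Y(2) kA a(2)]) (rule smooth_atI)
      have "deriv_array N \<eta> a = deriv_array N (dir_deriv u E) a"
        using Y(3) X(3) a(2) by (simp add: vector_jet_def \<eta>_def)
      then have \<eta>E: "jets_agree N \<eta> (dir_deriv u E) a"
        unfolding deriv_array_eq_iff by (intro jets_agree_Basis \<eta> DE) blast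
      \<comment> \<open>\<eta> has the \<open>N\<close>-jet of a first derivative of
        \<open>E\<close>, which is flat to order \<open>N\<close>; one order is lost, hence the
        strict inequality.\<close>
      have flat: "iter_deriv vs \<eta> a = 0" if "length vs < N" for vs
      proof -
        have "iter_deriv vs \<eta> a = iter_deriv (vs @ [u]) E a"
          using \<eta>E that unfolding iter_deriv_snoc jets_agree_def by simp
        then show ?thesis using E0[of "vs @ [u]"] that by simp
      qed
      have flowL: "flow A V Y 1 \<in> local_diffeos A" using flow GL by blast
      have fl: "flow A V Y 1 z = Some z" "jets_agree N (in_charts k k (flow A V Y 1)) (\<lambda>x. x + \<eta> x) a"
        using flow_jets_agree[OF vY Y(2) kA a(2) flowL N2(1)] flat unfolding \<eta>_def by blast+
      have \<eta>P: "smooth_at (\<lambda>x. h (projection L x)) a" if "smooth_at h a" for h :: "'e \<Rightarrow> 'e"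
        by (rule smooth_at_precompose_linear[OF P(1)]) (simp add: Pa that)
      have "jets_agree N (\<lambda>x. \<eta> (projection L x)) (\<lambda>x. dir_deriv u E (projection L x)) a"
        by (rule jets_agree_compose[where g = \<eta> and g' = "dir_deriv u E", OF jets_agree_refl _ sP sP]) (simp_all add: Pa \<eta>E \<eta> DE)
      from jets_agree_trans[OF jets_agree_compose_linear[OF Q this \<eta>P[OF \<eta>] \<eta>P[OF DE]] tangent]
      have Q\<eta>: "jets_agree N (\<lambda>x. Q (\<eta> (projection L x))) (\<lambda>x. 0) a" .
      have "jets_agree N (\<lambda>x. Q (\<eta> (projection L x)) + projection L (\<eta> (projection L x))) (\<lambda>x. 0 + projection L (\<eta> (projection L x))) a"
        by (intro jets_agree_add Q\<eta> jets_agree_refl smooth_at_const smooth_at_compose_linear[OF Q \<eta>P[OF \<eta>]] smooth_at_compose_linear[OF P(1) \<eta>P[OF \<eta>]])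
      then have tan: "jets_agree N (\<lambda>x. \<eta> (projection L x)) (\<lambda>x. projection L (\<eta> (projection L x))) a" by (simp add: Q_def)
      have "\<eta> a = 0" "dir_deriv v \<eta> a = 0" for v
        using flat[of "[]"] flat[of "[v]"] N2(1) by (auto simp: dir_deriv_def)
      from contact_image_if_tangent[OF L k a(2,3) flowL fl(1) \<eta> this fl(2) tan]
      have "same_jet A N z (flow A V Y 1) Some" by (rule fixing[OF flow fl(1)])
      from same_jetD(2)[OF this kA kA flowL local_diffeos_Some a(2) fl(1) zk]
      have "jets_agree N (in_charts k k (flow A V Y 1)) (\<lambda>x. x) a"
        using jets_agree_trans jets_agree_cong_ev[OF in_charts_Some_id[OF kA a(2)]] by blast
      from jets_agree_trans[OF jets_agree_sym[OF fl(2)] this]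
      have "jets_agree N (\<lambda>x. x + \<eta> x) (\<lambda>x. x) a" .
      from jets_agree_diff[OF this jets_agree_refl smooth_at_add[OF smooth_at_id \<eta>] smooth_at_id smooth_at_id smooth_at_id]
      have "jets_agree N \<eta> (\<lambda>x. 0) a" by simp
      then show ?thesis using \<eta>E jets_agree_sym jets_agree_trans by blast
    qed
    \<comment> \<open>For \<open>u\<close> in \<open>L\<close> the derivative commutes with the
      retraction and with \<open>Q\<close>, so tangency to order \<open>N\<close> is
      \<open>normal\<close> with one derivative spent. This is why contact of order
      \<open>N + 1\<close> enters.\<close>
    have flat_L: "jets_agree N (dir_deriv u E) (\<lambda>x. 0) a" if u: "u \<in> L" for u
    proof (rule flat_if_tangent)
      have "\<forall>\<^sub>F x in nhds a. smooth_at E (projection L x)" by (rule eventually_projection[OF L(1) a(3) smooth_at_eventually[OF E]])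
      then have "\<forall>\<^sub>F x in nhds a. Q (dir_deriv u E (projection L x)) = dir_deriv u (\<lambda>x. Q (E (projection L x))) x"
      proof eventually_elim
        case (elim x)
        have "dir_deriv u (\<lambda>x. E (projection L x)) x = dir_deriv u E (projection L x)"
          using dir_deriv_compose[OF bounded_linear_differentiable[OF P(1)] smooth_at_differentiable[OF elim], of u]
          by (simp add: dir_deriv_bounded_linear[OF P(1)] P(3)[OF u])
        then show ?case
          using dir_deriv_compose_linear[OF Q differentiable_compose_at[OF bounded_linear_differentiable[OF P(1)] smooth_at_differentiable[OF elim]], of u]
          by simp
      qed
      from jets_agree_cong_ev[OF this]
      have "jets_agree N (\<lambda>x. Q (dir_deriv u E (projection L x))) (dir_deriv u (\<lambda>x. Q (E (projection L x)))) a" .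
      moreover have "jets_agree N (dir_deriv u (\<lambda>x. Q (E (projection L x)))) (\<lambda>x. 0) a"
        unfolding jets_agree_zero iter_deriv_snoc[symmetric] using normal[unfolded jets_agree_zero] by simp
      ultimately show "jets_agree N (\<lambda>x. Q (dir_deriv u E (projection L x))) (\<lambda>x. 0) a" by (rule jets_agree_trans)
    qed
    have "jets_agree N (dir_deriv v E) (\<lambda>x. 0) a" for v
    proof (rule flat_if_tangent)
      have DE: "smooth_at (dir_deriv v E) a" by (rule smooth_at_dir_deriv[OF E])
      have "iter_deriv vs (\<lambda>x. dir_deriv v E (projection L x)) a = 0" if l: "length vs \<le> N" for vs
      proof -
        have "iter_deriv vs (\<lambda>x. dir_deriv v E (projection L x)) a = iter_deriv (map (projection L) vs) (dir_deriv v E) a"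
          using iter_deriv_precompose_linear[OF P(1), of "dir_deriv v E" a vs] by (simp add: Pa DE)
        also have "\<dots> = 0"
        proof (cases vs rule: rev_cases)
          case Nil
          \<comment> \<open>There is no direction along \<open>L\<close> to exchange with
            \<open>v\<close>; instead \<open>E\<close> is flat to order
            \<open>N \<ge> 2\<close>.\<close>
          then show ?thesis using E0[of "[v]"] N2(1) by (simp add: dir_deriv_def)
        next
          case (snoc us u)
          \<comment> \<open>The direction next to \<open>v\<close> lies in \<open>L\<close>. After
            the exchange it acts first, where \<open>flat_L\<close> applies, and \<open>v\<close>
            joins the others; their number is that of \<open>vs\<close>, hence still at most
            \<open>N\<close>.\<close>
          have "\<forall>\<^sub>F x in nhds a. dir_deriv (projection L u) (dir_deriv v E) x = dir_deriv v (dir_deriv (projection L u) E) x"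
            using smooth_at_eventually[OF E] by eventually_elim (rule dir_deriv_commute)
          from iter_deriv_cong_ev(2)[OF this, of "map (projection L) us"]
          have "iter_deriv (map (projection L) vs) (dir_deriv v E) a = iter_deriv (map (projection L) us @ [v]) (dir_deriv (projection L u) E) a"
            unfolding snoc by (simp add: iter_deriv_snoc)
          also have "\<dots> = 0"
            using flat_L[OF P(2), unfolded jets_agree_zero, of u] l snoc by simp
          finally show ?thesis .
        qed
        finally show ?thesis .
      qed
      then have "jets_agree N (\<lambda>x. dir_deriv v E (projection L x)) (\<lambda>x. 0) a" unfolding jets_agree_zero by blast
      from jets_agree_compose_linear[OF Q this smooth_at_precompose_linear[OF P(1)] smooth_at_const]
      show "jets_agree N (\<lambda>x. Q (dir_deriv v E (projection L x))) (\<lambda>x. 0) a"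
        by (simp add: Pa DE linear_0[OF bounded_linear.linear[OF Q]])
    qed
    then have "jets_agree (Suc N) E (\<lambda>x. 0) a" using E0[of "[]"] by (intro jets_agree_zero_if_dir_deriv) simp_all
    from jets_agree_add[OF this jets_agree_refl[of _ "in_charts k k e"] E Ie smooth_at_const Ie]
    have "jets_agree (Suc N) (in_charts k k \<phi>) (in_charts k k e) a" by (simp add: E_def)
    then have "same_jet A (Suc N) z \<phi> e" by (rule same_jetI[OF kA kA \<phi>L eL a(2) \<phi>(2) ez zk])
    then show ?thesis by (rule same_jet_trans[OF _ e_jet])
  qed
  \<comment> \<open>Freeness is an equality of sets, so the identity jet has to be an element of the
    isotropy group at the new order as well; \<open>e\<close> represents it within
    \<open>G\<close>.\<close>
  have e_contact: "contact A p (Suc N) z (ran (e |` S)) S"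
  proof -
    have "ran (Some |` S) = S" by (auto simp: ran_def restrict_map_def)
    then show ?thesis using contact_image[OF eL local_diffeos_Some e_jet ez contact_refl[OF S]] by simp
  qed
  have id_e: "identity_jet A n z = jet A n e z" for n
    unfolding identity_jet_def using jet_eq_iff[OF eL domI[of e, OF ez], of n Some] e_jet by simp
  show ?thesis
    unfolding acts_freely_at_def sub_jet_base_sub_jet
  proof (intro equalityI subsetI)
    fix g assume "g \<in> isotropy A G p (Suc N) (sub_jet A p (Suc N) S z)"
    then obtain \<phi> where \<phi>: "\<phi> \<in> G" "\<phi> z = Some z" "g = jet A (Suc N) \<phi> z" "contact A p (Suc N) z (ran (\<phi> |` S)) S"
      using isotropy_iff[OF GL S] by blast
    have "g = identity_jet A (Suc N) z"
      unfolding identity_jet_def \<phi>(3) using jet_eq_iff[of \<phi> z "Suc N" Some] main[OF \<phi>(1,2,4)] \<phi>(1,2) GL by auto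
    then show "g \<in> {identity_jet A (Suc N) z}" by simp
  next
    fix g assume "g \<in> {identity_jet A (Suc N) z}"
    then have "g = jet A (Suc N) e z" using id_e by simp
    then show "g \<in> isotropy A G p (Suc N) (sub_jet A p (Suc N) S z)"
      using isotropy_iff[OF GL S] eG ez e_contact by blast
  qed
qed

section \<open>Induction on the order\<close>

lemma acts_freely_at_add:
  assumes G: "lie_pseudogroup A G ns" "tame A G ns" and n: "ns + 1 \<le> n"
    and S: "submanifold A p S" "z \<in> S" and free: "acts_freely_at A G p n (sub_jet A p n S z)"
  shows "acts_freely_at A G p (n + k) (sub_jet A p (n + k) S z)"
proof (induction k)
  case (Suc k)
  show ?case using acts_freely_at_Suc[OF G _ S Suc] n by simp
qed (simp add: free)

end

theorem theorem5p2:
  fixes A :: "('a::{t2_space,second_countable_topology} \<rightharpoonup> 'e::euclidean_space) set"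
    and G :: "('a \<rightharpoonup> 'a) set"
    and ns p n :: nat
    and w\<^sub>o :: "'a sub_jet"
  assumes "smooth_manifold A"
    and "lie_pseudogroup A G ns"
    and "tame A G ns"
    and "ns + 1 \<le> n"
    and "w\<^sub>o \<in> sub_jets A p n"
    and "acts_freely_at A G p n w\<^sub>o"
  shows "\<forall>k. \<forall>w \<in> sub_jets A p (n + k).
           sub_jet_proj A p n w = w\<^sub>o \<longrightarrow> acts_freely_at A G p (n + k) w"
proof (intro allI ballI impI)
  interpret manifold A by (rule manifold.intro[OF assms(1)])
  fix k w assume w: "w \<in> sub_jets A p (n + k)" "sub_jet_proj A p n w = w\<^sub>o"
  obtain S z where S: "submanifold A p S" "z \<in> S" "w = sub_jet A p (n + k) S z"
    using w(1) unfolding sub_jets_def by blast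
  \<comment> \<open>A submanifold representing \<open>w\<close> represents its projection too, so
    the induction can run along the jets of this one \<open>S\<close>.\<close>
  have "w\<^sub>o = sub_jet A p n S z" using w(2) sub_jet_proj_sub_jet[OF S(1,2), of n "n + k"] S(3) by simp
  then show "acts_freely_at A G p (n + k) w"
    unfolding S(3) by (intro acts_freely_at_add[OF assms(2-4) S(1,2)]) (use assms(6) in simp)
qed



end
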